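(* Let $q,k\in\mathbb{N}$, $m\in\mathbb{N}_*$ and $\mathbf{e}\in\mathcal{E}$. (i) Take $q=0$. Then $\mathcal{S}_{0,k,m,\mathbf{e}}\subset L^{\mathbf{e}}$, in the sense that if $\mu\in\mathcal{S}_{0,k,m,\mathbf{e}}$ then $\mu$ is absolutely continuous with respect to Lebesgue measure and its density $p_\mu$ belongs to $L^{\mathbf{e}}$. Moreover there exists a universal constant $C$ such that $\|p_\mu\|_{\mathbf{e}}\le C\rho_{0,k,m,\mathbf{e}}(\mu)$ for all such $\mu$. (ii) Take $q\ge1$. Then $\mathcal{S}_{q,k,m,\mathbf{e}}\subset W^{q,\mathbf{e}}$ (in the same sense: $\mu$ is absolutely continuous with density $p_\mu\in W^{q,\mathbf{e}}$), and there is a universal constant $C$ such that $\|p_\mu\|_{q,\mathbf{e}}\le C\rho_{q,k,m,\mathbf{e}}(\mu)$ for every $\mu\in\mathcal{S}_{q,k,m,\mathbf{e}}$.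
   Context: $\mathbb{N}=\{0,1,2,\dots\}$, $\mathbb{N}_*=\mathbb{N}\setminus\{0\}$. $\mathcal{M}$ is the set of finite signed Borel measures on $\mathbb{R}^d$, $\mathcal{M}_a\subset\mathcal{M}$ the absolutely continuous ones (with respect to Lebesgue measure), and $p_\mu$ is the density of $\mu\in\mathcal{M}_a$. A Young function is a symmetric, strictly convex, non-negative function $\mathbf{e}:\mathbb{R}\to\mathbb{R}_+$ with $\mathbf{e}(0)=0$. $\mathcal{E}$ is the set of Young functions such that (i) there is $\lambda>0$ with $\mathbf{e}(2s)\le\lambda\mathbf{e}(s)$ for all $s$, and (ii) $s\mapsto\mathbf{e}(s)/s$ is non-decreasing (on $s>0$). Put $\|f\|_{\mathbf{e}}=\inf\{c>0:\int\mathbf{e}(f(x)/c)\,dx\le1\}$, $L^{\mathbf{e}}=\{f:\|f\|_{\mathbf{e}}<\infty\}$, and for $a,R>0$, $\mathbf{e}^{-1}(a)=\sup\{c:\mathbf{e}(c)\le a\}$, $\beta_{\mathbf{e}}(R)=R/\mathbf{e}^{-1}(R)$. For multi-indices $\alpha,\gamma\in\mathbb{N}^d$ put $|\alpha|=\sum_i\alpha_i$, $\partial_\alpha=\partial_{x_1}^{\alpha_1}\cdots\partial_{x_d}^{\alpha_d}$, $x^\gamma=\prod_i x_i^{\gamma_i}$. Define $\|f\|_{k,\mathbf{e}}=\sum_{0\le|\alpha|\le k}\|\partial_\alpha f\|_{\mathbf{e}}$, $\ W^{k,\mathbf{e}}=\{f:\|f\|_{k,\mathbf{e}}<\infty\}$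 (weak derivatives), $\ \|f\|_{k,\infty}=\sum_{0\le|\alpha|\le k}\|\partial_\alpha f\|_\infty$, $\ \|f\|_{k,l,\mathbf{e}}=\sum_{0\le|\alpha|\le k}\sum_{0\le|\gamma|\le l}\|x^\gamma\partial_\alpha f(x)\|_{\mathbf{e}}$. For $\mu,\nu\in\mathcal{M}$: $d_k(\mu,\nu)=\sup\{|\int\phi\,d\mu-\int\phi\,d\nu|:\phi\in C^\infty(\mathbb{R}^d),\ \|\phi\|_{k,\infty}\le1\}$. For $\mu\in\mathcal{M}$ and a sequence $(\mu_n)_{n\in\mathbb{N}}\subset\mathcal{M}_a$, $$\pi_{q,k,m,\mathbf{e}}(\mu,(\mu_n)_n)=\sum_{n=0}^\infty2^{n(q+k)}\beta_{\mathbf{e}}(2^{nd})d_k(\mu,\mu_n)+\sum_{n=0}^\infty2^{-2nm}\|p_{\mu_n}\|_{2m+q,2m,\mathbf{e}},$$ $\rho_{q,k,m,\mathbf{e}}(\mu)=\inf\pi_{q,k,m,\mathbf{e}}(\mu,(\mu_n)_n)$, the infimum being over all sequences $(\mu_n)_n$ in $\mathcal{M}_a$, and $\mathcal{S}_{q,k,m,\mathbf{e}}=\{\mu\in\mathcal{M}:\rho_{q,k,m,\mathbf{e}}(\mu)<\infty\}$. "Universal constant" means depending only on $q,k,m,d,\mathbf{e}$. *)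

theory Defs
  imports "HOL-Analysis.Analysis"
begin

section \<open>Young functions and Orlicz norms\<close>

definition young_function :: "(real \<Rightarrow> real) \<Rightarrow> bool" where
  "young_function e \<longleftrightarrow>
     (\<forall>s. e (- s) = e s) \<and>
     (\<forall>x y t. x \<noteq> y \<longrightarrow> 0 < t \<longrightarrow> t < 1 \<longrightarrow>
        e ((1 - t) * x + t * y) < (1 - t) * e x + t * e y) \<and>
     (\<forall>s. 0 \<le> e s) \<and> e 0 = 0"

definition young_class :: "(real \<Rightarrow> real) set" where
  "young_class = {e. young_function e \<and>
     (\<exists>l>0. \<forall>s. e (2 * s) \<le> l * e s) \<and>
     mono_on {0<..} (\<lambda>s. e s / s)}"

text \<open>Norms take values in \<open>[0, \<infinity>]\<close>; the infimum of the empty set is \<open>\<infinity>\<close>.\<close>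

definition orlicz_norm :: "(real \<Rightarrow> real) \<Rightarrow> (real ^ 'n \<Rightarrow> real) \<Rightarrow> ennreal" where
  "orlicz_norm e f =
     Inf {ennreal c |c. c > 0 \<and> (\<integral>\<^sup>+x. ennreal (e (f x / c)) \<partial>lborel) \<le> 1}"

definition orlicz_space :: "(real \<Rightarrow> real) \<Rightarrow> (real ^ 'n \<Rightarrow> real) set" where
  "orlicz_space e = {f \<in> borel_measurable borel. orlicz_norm e f < \<infinity>}"

definition young_inv :: "(real \<Rightarrow> real) \<Rightarrow> real \<Rightarrow> real" where
  "young_inv e a = Sup {c. e c \<le> a}"

definition young_beta :: "(real \<Rightarrow> real) \<Rightarrow> real \<Rightarrow> real" where
  "young_beta e R = R / young_inv e R"


section \<open>Classical derivatives and smooth functions\<close>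

definition partial_deriv :: "'n \<Rightarrow> (real ^ 'n \<Rightarrow> real) \<Rightarrow> real ^ 'n \<Rightarrow> real" where
  "partial_deriv i f x = deriv (\<lambda>t. f (x + t *\<^sub>R axis i 1)) 0"

fun iter_partial :: "'n list \<Rightarrow> (real ^ 'n \<Rightarrow> real) \<Rightarrow> real ^ 'n \<Rightarrow> real" where
  "iter_partial [] f = f"
| "iter_partial (i # is) f = partial_deriv i (iter_partial is f)"

definition smooth :: "(real ^ 'n \<Rightarrow> real) \<Rightarrow> bool" where
  "smooth f \<longleftrightarrow> (\<forall>is. continuous_on UNIV (iter_partial is f) \<and>
     (\<forall>i x. (\<lambda>t. iter_partial is f (x + t *\<^sub>R axis i 1)) field_differentiable at 0))"

text \<open>Multi-indices are functions \<open>'n \<Rightarrow> nat\<close>. The index type carries no order, so an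
  enumeration of the coordinates is fixed arbitrarily; \<open>multi_deriv\<close> is only applied to smooth
  functions, for which the order of differentiation does not matter.\<close>

definition coords :: "'n::finite list" where
  "coords = (SOME is. distinct is \<and> set is = UNIV)"

definition multi_deriv :: "('n \<Rightarrow> nat) \<Rightarrow> (real ^ 'n \<Rightarrow> real) \<Rightarrow> real ^ 'n \<Rightarrow> real" where
  "multi_deriv \<alpha> f = iter_partial (concat (map (\<lambda>i. replicate (\<alpha> i) i) coords)) f"

definition mi_order :: "('n::finite \<Rightarrow> nat) \<Rightarrow> nat" where
  "mi_order \<alpha> = (\<Sum>i\<in>UNIV. \<alpha> i)"

definition mi_upto :: "nat \<Rightarrow> ('n::finite \<Rightarrow> nat) set" where
  "mi_upto k = {\<alpha>. mi_order \<alpha> \<le> k}"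

definition monomial :: "('n \<Rightarrow> nat) \<Rightarrow> real ^ 'n \<Rightarrow> real" where
  "monomial \<gamma> x = (\<Prod>i\<in>UNIV. (x $ i) ^ \<gamma> i)"

definition sup_norm :: "nat \<Rightarrow> (real ^ 'n \<Rightarrow> real) \<Rightarrow> ennreal" where
  "sup_norm k f = (\<Sum>\<alpha>\<in>mi_upto k. SUP x. ennreal \<bar>multi_deriv \<alpha> f x\<bar>)"


section \<open>Weak derivatives and Sobolev--Orlicz norms\<close>

definition locally_integrable :: "(real ^ 'n \<Rightarrow> real) \<Rightarrow> bool" where
  "locally_integrable f \<longleftrightarrow> (\<forall>K. compact K \<longrightarrow> set_integrable lborel K f)"

definition has_weak_deriv ::
  "('n \<Rightarrow> nat) \<Rightarrow> (real ^ 'n \<Rightarrow> real) \<Rightarrow> (real ^ 'n \<Rightarrow> real) \<Rightarrow> bool" where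
  "has_weak_deriv \<alpha> f g \<longleftrightarrow> locally_integrable f \<and> locally_integrable g \<and>
     (\<forall>\<phi>. smooth \<phi> \<longrightarrow> compact (closure {x. \<phi> x \<noteq> 0}) \<longrightarrow>
        (LINT x|lborel. f x * multi_deriv \<alpha> \<phi> x) =
        (- 1) ^ mi_order \<alpha> * (LINT x|lborel. g x * \<phi> x))"

text \<open>Weak derivatives are unique almost everywhere and the norms below do not see null sets, so
  the choice of representative is immaterial. A function that lacks some weak derivative of
  order at most \<open>k\<close> has infinite norm.\<close>

definition weak_deriv :: "('n \<Rightarrow> nat) \<Rightarrow> (real ^ 'n \<Rightarrow> real) \<Rightarrow> real ^ 'n \<Rightarrow> real" where
  "weak_deriv \<alpha> f = (SOME g. has_weak_deriv \<alpha> f g)"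

definition weakly_differentiable :: "nat \<Rightarrow> (real ^ 'n \<Rightarrow> real) \<Rightarrow> bool" where
  "weakly_differentiable k f \<longleftrightarrow> (\<forall>\<alpha>\<in>mi_upto k. \<exists>g. has_weak_deriv \<alpha> f g)"

definition sobolev_norm :: "nat \<Rightarrow> (real \<Rightarrow> real) \<Rightarrow> (real ^ 'n \<Rightarrow> real) \<Rightarrow> ennreal" where
  "sobolev_norm k e f =
     (if weakly_differentiable k f
      then \<Sum>\<alpha>\<in>mi_upto k. orlicz_norm e (weak_deriv \<alpha> f) else \<infinity>)"

definition sobolev_space :: "nat \<Rightarrow> (real \<Rightarrow> real) \<Rightarrow> (real ^ 'n \<Rightarrow> real) set" where
  "sobolev_space k e = {f \<in> borel_measurable borel. sobolev_norm k e f < \<infinity>}"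

definition weighted_sobolev_norm ::
  "nat \<Rightarrow> nat \<Rightarrow> (real \<Rightarrow> real) \<Rightarrow> (real ^ 'n \<Rightarrow> real) \<Rightarrow> ennreal" where
  "weighted_sobolev_norm k l e f =
     (if weakly_differentiable k f
      then \<Sum>\<alpha>\<in>mi_upto k. \<Sum>\<gamma>\<in>mi_upto l.
             orlicz_norm e (\<lambda>x. monomial \<gamma> x * weak_deriv \<alpha> f x)
      else \<infinity>)"


section \<open>Finite signed Borel measures\<close>

text \<open>A finite signed Borel measure is a real-valued countably additive function on the Borel
  sets; its values on other sets are irrelevant.\<close>

definition signed_measures :: "((real ^ 'n) set \<Rightarrow> real) set" where
  "signed_measures = {\<mu>. \<mu> {} = 0 \<and>
     (\<forall>A :: nat \<Rightarrow> (real ^ 'n) set. range A \<subseteq> sets borel \<longrightarrow> disjoint_family A \<longrightarrow>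
        (\<lambda>n. \<mu> (A n)) sums \<mu> (\<Union>n. A n))}"

text \<open>The positive part of the Jordan decomposition, \<open>\<mu>\<^sup>+(A) = sup {\<mu>(B) | B \<subseteq> A}\<close>. Since
  \<open>B = {}\<close> is allowed, truncation of negative values by \<open>ennreal\<close> does not change the supremum.\<close>

definition pos_part :: "((real ^ 'n) set \<Rightarrow> real) \<Rightarrow> (real ^ 'n) measure" where
  "pos_part \<mu> = measure_of UNIV (sets borel)
     (\<lambda>A. SUP B\<in>{B \<in> sets borel. B \<subseteq> A}. ennreal (\<mu> B))"

definition signed_integral ::
  "((real ^ 'n) set \<Rightarrow> real) \<Rightarrow> (real ^ 'n \<Rightarrow> real) \<Rightarrow> real" where
  "signed_integral \<mu> f =
     (LINT x|pos_part \<mu>. f x) - (LINT x|pos_part (\<lambda>A. - \<mu> A). f x)"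

definition ac_measures :: "((real ^ 'n) set \<Rightarrow> real) set" where
  "ac_measures = {\<mu> \<in> signed_measures.
     \<forall>A\<in>sets borel. emeasure lborel A = 0 \<longrightarrow> \<mu> A = 0}"

text \<open>For \<open>\<mu> \<in> ac_measures\<close> the density exists and is unique almost everywhere (Radon--Nikodym).\<close>

definition signed_density :: "((real ^ 'n) set \<Rightarrow> real) \<Rightarrow> real ^ 'n \<Rightarrow> real" where
  "signed_density \<mu> = (SOME p. integrable lborel p \<and>
     (\<forall>A\<in>sets borel. \<mu> A = (LINT x:A|lborel. p x)))"


section \<open>The interpolation functionals\<close>

definition dist_k ::
  "nat \<Rightarrow> ((real ^ 'n) set \<Rightarrow> real) \<Rightarrow> ((real ^ 'n) set \<Rightarrow> real) \<Rightarrow> ennreal" where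
  "dist_k k \<mu> \<nu> = (SUP \<phi>\<in>{\<phi>. smooth \<phi> \<and> sup_norm k \<phi> \<le> 1}.
     ennreal \<bar>signed_integral \<mu> \<phi> - signed_integral \<nu> \<phi>\<bar>)"

definition interp_pi ::
  "nat \<Rightarrow> nat \<Rightarrow> nat \<Rightarrow> (real \<Rightarrow> real) \<Rightarrow> ((real ^ 'n) set \<Rightarrow> real) \<Rightarrow>
     (nat \<Rightarrow> (real ^ 'n) set \<Rightarrow> real) \<Rightarrow> ennreal" where
  "interp_pi q k m e \<mu> \<mu>s =
     (\<Sum>n. ennreal (2 ^ (n * (q + k)) * young_beta e (2 ^ (n * CARD('n)))) * dist_k k \<mu> (\<mu>s n)) +
     (\<Sum>n. ennreal (1 / 2 ^ (2 * n * m)) *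
        weighted_sobolev_norm (2 * m + q) (2 * m) e (signed_density (\<mu>s n)))"

definition interp_rho ::
  "nat \<Rightarrow> nat \<Rightarrow> nat \<Rightarrow> (real \<Rightarrow> real) \<Rightarrow> ((real ^ 'n) set \<Rightarrow> real) \<Rightarrow> ennreal" where
  "interp_rho q k m e \<mu> = (INF \<mu>s\<in>{\<mu>s. \<forall>n. \<mu>s n \<in> ac_measures}. interp_pi q k m e \<mu> \<mu>s)"

definition interp_space ::
  "nat \<Rightarrow> nat \<Rightarrow> nat \<Rightarrow> (real \<Rightarrow> real) \<Rightarrow> ((real ^ 'n) set \<Rightarrow> real) set" where
  "interp_space q k m e = {\<mu> \<in> signed_measures. interp_rho q k m e \<mu> < \<infinity>}"

end

theory Submission
  imports Defs
begin

text \<open>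
  Fix a smooth compactly supported kernel \<open>\<phi>\<close> on \<open>\<real>\<^sup>d\<close> with integral one and
  put \<open>\<phi>\<^sub>n(z) = 2\<^sup>n\<^sup>d \<phi>(2\<^sup>n z)\<close>. The smoothed measures \<open>T\<^sub>n(x) = \<integral> (\<partial>\<^sub>\<beta> \<phi>\<^sub>n)(y - x) d\<mu>(y)\<close> converge in the
  sense of distributions to \<open>\<partial>\<^sub>\<beta> \<mu>\<close> up to sign, so it suffices to bound
  \<open>\<parallel>T\<^sub>0\<parallel> + (\<Sum>n. \<parallel>T\<^sub>n\<^sub>+\<^sub>1 - T\<^sub>n\<parallel>)\<close> in the Orlicz norm by a multiple of \<open>\<pi>(\<mu>, (\<mu>\<^sub>n))\<close>, for every
  \<open>|\<beta>| \<le> q\<close>.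

  The kernel is the tensor power of a function \<open>\<kappa>\<close> of one variable such that
  \<open>\<kappa>(t) - 2 \<kappa>(2 t)\<close> is the derivative of order \<open>2 m\<close> of a test function
  (\<open>exists_moment_kernel\<close>). Exchanging the factors one coordinate at a time
  (\<open>kernel_telescope\<close>), \<open>\<partial>\<^sub>\<beta> \<phi>\<^sub>n - \<partial>\<^sub>\<beta> \<phi>\<^sub>n\<^sub>+\<^sub>1\<close> becomes a sum of \<open>d\<close> kernels
  \<open>2\<^sup>n\<^sup>|\<^sup>\<beta>\<^sup>| (\<partial>\<^sub>\<theta> \<Psi>)\<^sub>n\<close> with \<open>|\<theta>| = |\<beta>| + 2 m\<close>. The action of one such kernel on \<open>\<mu>\<close> is estimated by splitting
  \<open>\<mu> = (\<mu> - \<mu>\<^sub>n) + \<mu>\<^sub>n\<close> (\<open>sconv_interpolation\<close>).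

  On \<open>\<mu> - \<mu>\<^sub>n\<close>, duality with \<open>d\<^sub>k\<close> bounds the sup norm and the \<open>L\<^sup>1\<close> norm by multiples of
  \<open>2\<^sup>n\<^sup>k 2\<^sup>n\<^sup>d d\<^sub>k(\<mu>, \<mu>\<^sub>n)\<close> and \<open>2\<^sup>n\<^sup>k d\<^sub>k(\<mu>, \<mu>\<^sub>n)\<close>. Since \<open>e\<close> is convex and \<open>e 0 = 0\<close>, a function \<open>g\<close> with
  \<open>\<parallel>g\<parallel>\<^sub>1 \<le> A\<close> and \<open>\<parallel>g\<parallel>\<^sub>\<infinity> \<le> A R\<close> has Orlicz norm at most \<open>A \<beta>\<^sub>e(R)\<close> (\<open>orlicz_norm_interpolation\<close>), and
  \<open>R = 2\<^sup>n\<^sup>d\<close> gives the first series in \<open>\<pi>\<close>. On \<open>\<mu>\<^sub>n\<close>, all \<open>|\<theta>|\<close> derivatives are moved from the kernel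
  onto the density, which gains \<open>2\<^sup>-\<^sup>n\<^sup>|\<^sup>\<theta>\<^sup>|\<close>, and convolution with an \<open>L\<^sup>1\<close> kernel is bounded on
  Orlicz spaces by Jensen's inequality (\<open>orlicz_norm_schur\<close>); this gives the second series.

  Since the increments are summable in norm, \<open>T\<^sub>n\<close> converges almost everywhere, dominated by a locally
  integrable function, to some \<open>G\<^sub>\<beta>\<close> with \<open>\<parallel>G\<^sub>\<beta>\<parallel> \<le> C \<pi>\<close> and \<open>\<integral> G\<^sub>\<beta> \<psi> = \<integral> \<partial>\<^sub>\<beta> \<psi> d\<mu>\<close> for all test
  functions \<open>\<psi>\<close> (\<open>limit_derivative\<close>). For \<open>\<beta> = 0\<close> this identifies \<open>G\<^sub>0\<close> as the density of \<open>\<mu>\<close>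
  (\<open>signed_measure_density_of_distribution\<close>); for general \<open>\<beta>\<close> it says that \<open>(-1)\<^sup>|\<^sup>\<beta>\<^sup>| G\<^sub>\<beta>\<close> is the weak
  derivative of that density, which is unique by the fundamental lemma of the calculus of
  variations. Taking the infimum over all sequences \<open>(\<mu>\<^sub>n)\<close> finishes the proof.
\<close>

section \<open>Smooth functions on the real line and a kernel of high order\<close>

text \<open>Infinitely differentiable functions of one real variable, and those with compact support.
  \<open>deriv\<close> is total, so the iterated derivative is always defined; requiring every iterate to be
  differentiable everywhere makes it the true derivative.\<close>
definition smooth_real :: "(real \<Rightarrow> real) \<Rightarrow> bool" where
  "smooth_real f \<longleftrightarrow> (\<forall>n x. (deriv ^^ n) f field_differentiable at x)"

definition test_function :: "(real \<Rightarrow> real) \<Rightarrow> bool" where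
  "test_function f \<longleftrightarrow> smooth_real f \<and> (\<exists>L. \<forall>t. L < \<bar>t\<bar> \<longrightarrow> f t = 0)"

text \<open>To show that a function is smooth it is enough to place it in a class of functions that is
  closed under taking derivatives.\<close>
lemma smooth_real_coinduct:
  assumes "f \<in> S" and "\<And>f. f \<in> S \<Longrightarrow> \<exists>f'\<in>S. \<forall>x. (f has_real_derivative f' x) (at x)"
  shows "smooth_real f"
proof -
  have "(deriv ^^ n) f \<in> S" for n
  proof (induction n)
    case (Suc n)
    then obtain f' where f': "f' \<in> S" "\<And>x. ((deriv ^^ n) f has_real_derivative f' x) (at x)"
      using assms(2) by blast
    have "deriv ((deriv ^^ n) f) = f'"
      using f'(2) by (intro ext DERIV_imp_deriv)
    then show ?case using f'(1) by simp
  qed (use assms in simp)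
  then show ?thesis
    unfolding smooth_real_def field_differentiable_def using assms(2) by blast
qed

lemma smooth_real_has_derivative:
  "smooth_real f \<Longrightarrow> ((deriv ^^ n) f has_real_derivative (deriv ^^ Suc n) f x) (at x)"
  unfolding smooth_real_def
  by (simp add: DERIV_deriv_iff_field_differentiable)

lemma smooth_real_has_derivative_1:
  "smooth_real f \<Longrightarrow> (f has_real_derivative deriv f x) (at x)"
  using smooth_real_has_derivative[of f 0] by simp

lemma smooth_real_iter_deriv: "smooth_real f \<Longrightarrow> smooth_real ((deriv ^^ n) f)"
  unfolding smooth_real_def by (metis funpow_add comp_apply)

lemma smooth_real_deriv: "smooth_real f \<Longrightarrow> smooth_real (deriv f)"
  using smooth_real_iter_deriv[of f 1] by simp

lemma smooth_real_continuous: "smooth_real f \<Longrightarrow> continuous_on A ((deriv ^^ n) f)"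
  by (meson DERIV_isCont continuous_at_imp_continuous_on smooth_real_has_derivative)

lemma smooth_real_add:
  assumes "smooth_real f" "smooth_real g"
  shows "smooth_real (\<lambda>x. f x + g x)"
proof (rule smooth_real_coinduct[where S = "{\<lambda>x. f x + g x |f g. smooth_real f \<and> smooth_real g}"])
  fix h assume "h \<in> {\<lambda>x. f x + g x |f g. smooth_real f \<and> smooth_real g}"
  then obtain f g where "h = (\<lambda>x. f x + g x)" "smooth_real f" "smooth_real g" by blast
  then show "\<exists>h'\<in>{\<lambda>x. f x + g x |f g. smooth_real f \<and> smooth_real g}.
      \<forall>x. (h has_real_derivative h' x) (at x)"
    by (intro bexI[of _ "\<lambda>x. deriv f x + deriv g x"])
       (auto intro!: DERIV_add smooth_real_has_derivative_1 smooth_real_deriv)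
qed (use assms in blast)

lemma smooth_real_mult:
  assumes "smooth_real f" "smooth_real g"
  shows "smooth_real (\<lambda>x. f x * g x)"
proof -
  define S where "S = {\<lambda>x. (\<Sum>(a, b)\<leftarrow>ps. a x * b x) |ps.
     \<forall>(a, b)\<in>set ps. smooth_real a \<and> smooth_real b}"
  show ?thesis
  proof (rule smooth_real_coinduct[where S = S])
    show "(\<lambda>x. f x * g x) \<in> S"
      unfolding S_def using assms by (auto intro!: exI[of _ "[(f, g)]"])
  next
    fix h assume "h \<in> S"
    then obtain ps where h: "h = (\<lambda>x. (\<Sum>(a, b)\<leftarrow>ps. a x * b x))"
      and ps: "\<forall>(a, b)\<in>set ps. smooth_real a \<and> smooth_real b"
      unfolding S_def by blast
    define qs where "qs = concat (map (\<lambda>(a, b). [(deriv a, b), (a, deriv b)]) ps)"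
    have "\<forall>(a, b)\<in>set qs. smooth_real a \<and> smooth_real b"
      unfolding qs_def using ps by (auto intro: smooth_real_deriv)
    moreover have "(h has_real_derivative (\<Sum>(a, b)\<leftarrow>qs. a x * b x)) (at x)" for x
      unfolding h qs_def using ps
    proof (induction ps)
      case (Cons p ps)
      obtain a b where p: "p = (a, b)" by fastforce
      have "((\<lambda>x. a x * b x) has_real_derivative deriv a x * b x + deriv b x * a x) (at x)"
        using Cons.prems unfolding p
        by (intro DERIV_mult smooth_real_has_derivative_1) auto
      from DERIV_add[OF this Cons.IH] Cons.prems show ?case
        by (simp add: p algebra_simps)
    qed auto
    ultimately show "\<exists>h'\<in>S. \<forall>x. (h has_real_derivative h' x) (at x)"
      unfolding S_def by (intro bexI[of _ "\<lambda>x. \<Sum>(a, b)\<leftarrow>qs. a x * b x"]) blast+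
  qed
qed

lemma smooth_real_const: "smooth_real (\<lambda>x. c)"
  by (rule smooth_real_coinduct[where S = "range (\<lambda>c x. c)"])
     (auto intro!: exI[of _ 0] bexI[of _ "\<lambda>x. 0"])

lemma iter_deriv_affine:
  assumes "smooth_real f"
  shows "(deriv ^^ n) (\<lambda>t. f (a * t + b)) = (\<lambda>t. a ^ n * (deriv ^^ n) f (a * t + b))"
proof (induction n)
  case (Suc n)
  have "((\<lambda>t. a ^ n * (deriv ^^ n) f (a * t + b)) has_real_derivative
      a ^ n * ((deriv ^^ Suc n) f (a * t + b) * (a * 1 + 0))) (at t)" for t
    by (intro DERIV_cmult DERIV_chain2[OF smooth_real_has_derivative[OF assms]] DERIV_add
        DERIV_ident DERIV_const)
  note DERIV_imp_deriv[OF this]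
  then have "deriv (\<lambda>t. a ^ n * (deriv ^^ n) f (a * t + b)) t =
      a ^ Suc n * (deriv ^^ Suc n) f (a * t + b)" for t
    by (simp add: mult_ac)
  then show ?case by (simp add: Suc fun_eq_iff)
qed simp

lemma smooth_real_affine:
  assumes "smooth_real f"
  shows "smooth_real (\<lambda>t. f (a * t + b))"
proof (rule smooth_real_coinduct[where S = "{\<lambda>t. c * f (a * t + b) |c f. smooth_real f}"])
  show "(\<lambda>t. f (a * t + b)) \<in> {\<lambda>t. c * f (a * t + b) |c f. smooth_real f}"
    using assms by (auto intro!: exI[of _ 1])
next
  fix h assume "h \<in> {\<lambda>t. c * f (a * t + b) |c f. smooth_real f}"
  then obtain c f where h: "h = (\<lambda>t. c * f (a * t + b))" "smooth_real f" by blast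
  have "(h has_real_derivative c * (deriv f (a * t + b) * (a * 1 + 0))) (at t)" for t
    unfolding h(1) using h(2)
    by (intro DERIV_cmult DERIV_chain2[OF smooth_real_has_derivative_1] DERIV_add
        DERIV_ident DERIV_const)
  then show "\<exists>h'\<in>{\<lambda>t. c * f (a * t + b) |c f. smooth_real f}.
      \<forall>x. (h has_real_derivative h' x) (at x)"
    using smooth_real_deriv[OF h(2)]
    by (intro bexI[of _ "\<lambda>t. (c * a) * deriv f (a * t + b)"]) (auto simp: mult_ac intro!: exI[of _ "a * c"] exI[of _ "deriv f"])
qed

lemma iter_deriv_cmult:
  assumes "smooth_real f"
  shows "(deriv ^^ n) (\<lambda>t. c * f t) = (\<lambda>t. c * (deriv ^^ n) f t)"
proof (induction n)
  case (Suc n)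
  have "((\<lambda>t. c * (deriv ^^ n) f t) has_real_derivative c * (deriv ^^ Suc n) f t) (at t)" for t
    by (intro DERIV_cmult smooth_real_has_derivative assms)
  then have "deriv (\<lambda>t. c * (deriv ^^ n) f t) = (\<lambda>t. c * (deriv ^^ Suc n) f t)"
    by (intro ext DERIV_imp_deriv)
  then show ?case by (simp add: Suc)
qed simp

lemma iter_deriv_add:
  assumes "smooth_real f" "smooth_real g"
  shows "(deriv ^^ n) (\<lambda>t. f t + g t) = (\<lambda>t. (deriv ^^ n) f t + (deriv ^^ n) g t)"
proof (induction n)
  case (Suc n)
  have "((\<lambda>t. (deriv ^^ n) f t + (deriv ^^ n) g t) has_real_derivative
      (deriv ^^ Suc n) f t + (deriv ^^ Suc n) g t) (at t)" for t
    by (intro DERIV_add smooth_real_has_derivative assms)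
  then have "deriv (\<lambda>t. (deriv ^^ n) f t + (deriv ^^ n) g t) =
      (\<lambda>t. (deriv ^^ Suc n) f t + (deriv ^^ Suc n) g t)"
    by (intro ext DERIV_imp_deriv)
  then show ?case by (simp add: Suc)
qed simp

lemma smooth_real_cmult: "smooth_real f \<Longrightarrow> smooth_real (\<lambda>x. c * f x)"
  by (intro smooth_real_mult smooth_real_const)

lemma test_function_smooth: "test_function f \<Longrightarrow> smooth_real f"
  by (simp add: test_function_def)

lemma test_function_add:
  assumes "test_function f" "test_function g"
  shows "test_function (\<lambda>x. f x + g x)"
proof -
  obtain L M where "\<And>t. L < \<bar>t\<bar> \<Longrightarrow> f t = 0" "\<And>t. M < \<bar>t\<bar> \<Longrightarrow> g t = 0"
    using assms unfolding test_function_def by blast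
  then have "\<forall>t. max L M < \<bar>t\<bar> \<longrightarrow> f t + g t = 0" by simp
  then show ?thesis
    using assms unfolding test_function_def by (blast intro: smooth_real_add)
qed

lemma test_function_cmult: "test_function f \<Longrightarrow> test_function (\<lambda>x. c * f x)"
  unfolding test_function_def by (auto intro!: smooth_real_cmult)

lemma test_function_affine:
  assumes "test_function f" "a \<noteq> 0"
  shows "test_function (\<lambda>t. f (a * t + b))"
proof -
  obtain L where L: "\<And>t. L < \<bar>t\<bar> \<Longrightarrow> f t = 0"
    using assms unfolding test_function_def by blast
  have "f (a * t + b) = 0" if "(L + \<bar>b\<bar>) / \<bar>a\<bar> < \<bar>t\<bar>" for t
  proof (rule L)
    have "L + \<bar>b\<bar> < \<bar>a * t\<bar>" using that assms(2) by (simp add: field_simps abs_mult)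
    then show "L < \<bar>a * t + b\<bar>" by linarith
  qed
  then show ?thesis
    using assms unfolding test_function_def by (blast intro: smooth_real_affine)
qed

lemma iter_deriv_support:
  assumes "smooth_real f" "\<And>t. L < \<bar>t\<bar> \<Longrightarrow> f t = 0" "L < \<bar>t\<bar>"
  shows "(deriv ^^ n) f t = 0"
  using assms(3)
proof (induction n arbitrary: t)
  case (Suc n)
  have "open {t. L < \<bar>t\<bar>}" by (intro open_Collect_less continuous_intros)
  then have "((\<lambda>t. 0) has_real_derivative (deriv ^^ Suc n) f t) (at t)"
    by (rule has_field_derivative_transform_within_open[OF
        smooth_real_has_derivative[OF assms(1), of n]]) (use Suc in auto)
  then show ?case using DERIV_unique DERIV_const by blast
qed (use assms in auto)

lemma test_function_iter_deriv:
  assumes "test_function f" shows "test_function ((deriv ^^ n) f)"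
  using assms iter_deriv_support unfolding test_function_def
  by (metis smooth_real_iter_deriv)

lemma test_function_bounded:
  assumes "test_function f"
  obtains B where "0 < B" "\<And>t. \<bar>f t\<bar> \<le> B"
proof -
  obtain L where L: "\<And>t. L < \<bar>t\<bar> \<Longrightarrow> f t = 0" and s: "smooth_real f"
    using assms unfolding test_function_def by blast
  have "continuous_on {-L..L} f" using smooth_real_continuous[OF s, of _ 0] by simp
  then have "bounded (f ` {-L..L})" by (intro compact_imp_bounded compact_continuous_image) auto
  then obtain B where B: "\<And>t. t \<in> {-L..L} \<Longrightarrow> \<bar>f t\<bar> \<le> B"
    unfolding bounded_iff real_norm_def by blast
  have "\<bar>f t\<bar> \<le> max B 1" for t
  proof (cases "L < \<bar>t\<bar>")
    case False
    then have "t \<in> {-L..L}" by auto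
    from B[OF this] show ?thesis by simp
  qed (simp add: L)
  with that[of "max B 1"] show ?thesis by simp
qed

lemma test_function_continuous: "test_function f \<Longrightarrow> continuous_on A f"
  using smooth_real_continuous[of f A 0] by (simp add: test_function_def)

lemma test_function_integrable:
  assumes "test_function f" shows "integrable lborel f"
proof -
  obtain L where L: "\<And>t. L < \<bar>t\<bar> \<Longrightarrow> f t = 0" using assms unfolding test_function_def by blast
  have "integrable lborel (\<lambda>x. indicator {-L..L} x *\<^sub>R f x)"
    by (rule borel_integrable_compact) (auto intro: test_function_continuous assms)
  also have "(\<lambda>x. indicator {-L..L} x *\<^sub>R f x) = f"
    using L by (force simp: indicator_def)
  finally show ?thesis .
qed

text \<open>A test function with integral zero is the derivative of a test function: integrate from the
  left end of the support.\<close>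
lemma test_function_antideriv:
  assumes "test_function f" "(\<integral>x. f x \<partial>lborel) = 0"
  obtains g where "test_function g" "deriv g = f"
proof -
  obtain L0 where L0: "\<And>t. L0 < \<bar>t\<bar> \<Longrightarrow> f t = 0" and s: "smooth_real f"
    using assms unfolding test_function_def by blast
  define L where "L = max L0 1"
  have L: "f t = 0" if "L < \<bar>t\<bar>" for t using L0 that by (simp add: L_def)
  have cont: "continuous_on A f" for A using test_function_continuous assms(1) by blast
  define g where "g t = (if t < - L - 1 then 0 else integral {-L-1..t} f)" for t
  have zero: "integral {-L-1..t} f = 0" if "t \<le> -L" for t
  proof -
    have "integral {-L-1..t} f = integral {-L-1..t} (\<lambda>x. 0)"
      by (rule integral_spike[of "{-L}"]) (use that L in auto)
    then show ?thesis by simp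
  qed
  have d: "(g has_real_derivative f t) (at t)" for t
  proof (cases "t < -L")
    case True
    have "((\<lambda>t. 0) has_real_derivative 0) (at t)" by simp
    then have "(g has_real_derivative 0) (at t)"
      by (rule has_field_derivative_transform_within_open[of _ _ _ "{..<-L}"])
         (use True zero in \<open>auto simp: g_def\<close>)
    moreover have "f t = 0" using True by (intro L) auto
    ultimately show ?thesis by simp
  next
    case False
    have "((\<lambda>u. integral {-L-1..u} f) has_real_derivative f t) (at t within {-L-1..t+1})"
      by (rule integral_has_real_derivative) (use cont False in auto)
    then have "((\<lambda>u. integral {-L-1..u} f) has_real_derivative f t) (at t)"
      using at_within_interior[of t "{-L-1..t+1}"] False by simp
    then show ?thesis
      by (rule has_field_derivative_transform_within_open[of _ _ _ "{-L-1<..<t+1}"])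
         (use False in \<open>auto simp: g_def\<close>)
  qed
  then have dg: "deriv g = f" by (intro ext DERIV_imp_deriv)
  have "smooth_real g"
    by (rule smooth_real_coinduct[where S = "insert g {f. smooth_real f}"])
       (use d s smooth_real_has_derivative_1 smooth_real_deriv in blast)+
  moreover have "g t = 0" if t: "L < \<bar>t\<bar>" for t
  proof (cases "t < 0")
    case True
    then show ?thesis using zero t by (auto simp: g_def)
  next
    case False
    with t have "t > L" by auto
    have "(\<integral>x. f x \<partial>lborel) = (\<integral>x. indicator {-L-1..t} x *\<^sub>R f x \<partial>lborel)"
      by (rule Bochner_Integration.integral_cong) (use L \<open>t > L\<close> in \<open>force simp: indicator_def\<close>)+
    also have "\<dots> = integral {-L-1..t} f"
      using set_borel_integral_eq_integral(2)[of "{-L-1..t}" f]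
        borel_integrable_compact[of "{-L-1..t}" f] cont
      by (auto simp: set_integrable_def set_lebesgue_integral_def)
    finally show ?thesis using assms(2) \<open>t > L\<close> by (simp add: g_def L_def)
  qed
  ultimately have "test_function g" unfolding test_function_def by blast
  then show ?thesis using that dg by blast
qed

text \<open>The standard smooth function that vanishes exactly for \<open>x \<le> 0\<close>.\<close>
definition flat_exp :: "real \<Rightarrow> real" where
  "flat_exp x = (if x > 0 then exp (- 1 / x) else 0)"

lemma smooth_flat_exp: "smooth_real flat_exp"
proof -
  define F :: "real poly \<Rightarrow> real \<Rightarrow> real" where
    "F p x = (if x > 0 then poly p (1 / x) * exp (- 1 / x) else 0)" for p x
  show ?thesis
  proof (rule smooth_real_coinduct[where S = "range F"])
    have "flat_exp = F 1" by (auto simp: F_def flat_exp_def)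
    then show "flat_exp \<in> range F" by blast
  next
    fix h assume "h \<in> range F"
    then obtain p where h: "h = F p" by blast
    \<comment> \<open>\<open>(p(1/x) exp(-1/x))' = x\<^sup>-\<^sup>2 (p(1/x) - p'(1/x)) exp(-1/x)\<close>, and \<open>x\<^sup>-\<^sup>2\<close> is the polynomial \<open>X\<^sup>2\<close> at \<open>1/x\<close>\<close>
    define q where "q = [:0, 0, 1:] * (p - pderiv p)"
    have "(F p has_real_derivative F q x) (at x)" for x
    proof -
      consider "x > 0" | "x < 0" | "x = 0" by linarith
      then show ?thesis
      proof cases
        case 1
        have "((\<lambda>x. poly p (1 / x) * exp (- 1 / x)) has_real_derivative
           poly p (1 / x) * (exp (- 1 / x) * (1 / x\<^sup>2)) +
           poly (pderiv p) (1 / x) * (- (1 / x\<^sup>2)) * exp (- 1 / x)) (at x)"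
          using 1 by (auto intro!: derivative_eq_intros DERIV_chain2[OF poly_DERIV]
              simp: power2_eq_square field_simps)
        moreover have "poly p (1 / x) * (exp (- 1 / x) * (1 / x\<^sup>2)) +
           poly (pderiv p) (1 / x) * (- (1 / x\<^sup>2)) * exp (- 1 / x) = F q x"
          using 1 by (simp add: F_def q_def power2_eq_square field_simps)
        ultimately have "((\<lambda>x. poly p (1 / x) * exp (- 1 / x)) has_real_derivative F q x) (at x)"
          by simp
        then show ?thesis
          by (rule has_field_derivative_transform_within_open[of _ _ _ "{0<..}"])
             (use 1 in \<open>auto simp: F_def\<close>)
      next
        case 2
        have "((\<lambda>t. 0) has_real_derivative F q x) (at x)" using 2 by (simp add: F_def)
        then show ?thesis
          by (rule has_field_derivative_transform_within_open[of _ _ _ "{..<0}"])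
             (use 2 in \<open>auto simp: F_def\<close>)
      next
        case 3
        have l: "((\<lambda>t. poly r t * exp (- t)) \<longlongrightarrow> 0) at_top" for r :: "real poly"
        proof -
          have "((\<lambda>t. poly r t / exp t) \<longlongrightarrow> 0) at_top"
          proof -
            have "((\<lambda>t. \<Sum>i\<le>degree r. coeff r i * (t ^ i / exp t)) \<longlongrightarrow>
                (\<Sum>i\<le>degree r. coeff r i * 0)) at_top"
              by (intro tendsto_intros tendsto_power_div_exp_0)
            then show ?thesis
              by (simp add: poly_altdef sum_divide_distrib)
          qed
          then show ?thesis by (simp add: exp_minus field_simps)
        qed
        have "((\<lambda>t. F p t / t) \<longlongrightarrow> 0) (at_right 0)"
        proof -
          have "((\<lambda>x. poly (pCons 0 p) (inverse x) * exp (- inverse x)) \<longlongrightarrow> 0) (at_right 0)"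
            by (rule filterlim_compose[OF l filterlim_inverse_at_top_right])
          then show ?thesis
            by (rule Lim_transform_eventually)
               (auto simp: eventually_at_right_field F_def field_simps intro!: exI[of _ 1])
        qed
        moreover have "((\<lambda>t. F p t / t) \<longlongrightarrow> 0) (at_left 0)"
          by (rule Lim_transform_eventually[of "\<lambda>t. 0"])
             (auto simp: eventually_at_left_field F_def intro!: exI[of _ "-1"])
        ultimately have "((\<lambda>t. F p t / t) \<longlongrightarrow> 0) (at 0)"
          by (simp add: filterlim_split_at)
        moreover have "F p 0 = 0" "F q 0 = 0" by (simp_all add: F_def)
        ultimately show ?thesis unfolding 3 DERIV_def by simp
      qed
    qed
    then show "\<exists>f'\<in>range F. \<forall>x. (h has_real_derivative f' x) (at x)"
      unfolding h by blast
  qed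
qed

text \<open>A smooth function supported in \<open>[a, b]\<close> with values in \<open>[0, 1]\<close>. As \<open>j\<close> grows, it increases to
  the indicator of the open interval, because \<open>exp (- 1 / (j u)) \<longlonglongrightarrow> 1\<close> for \<open>u > 0\<close>.\<close>
definition bump :: "nat \<Rightarrow> real \<Rightarrow> real \<Rightarrow> real \<Rightarrow> real" where
  "bump j a b t = flat_exp (real j * (t - a)) * flat_exp (real j * (b - t))"

lemma flat_exp_range: "0 \<le> flat_exp x" "flat_exp x \<le> 1"
  by (auto simp: flat_exp_def)

lemma bump_range: "0 \<le> bump j a b t" "bump j a b t \<le> 1"
  unfolding bump_def by (auto intro!: mult_nonneg_nonneg mult_le_one flat_exp_range)

lemma bump_eq_0: "t \<le> a \<or> b \<le> t \<Longrightarrow> bump j a b t = 0"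
  by (auto simp: bump_def flat_exp_def zero_less_mult_iff)

lemma test_function_bump: "test_function (bump j a b)"
proof -
  have "smooth_real (\<lambda>t. flat_exp (real j * t + (- real j * a)) *
      flat_exp (- real j * t + real j * b))"
    by (intro smooth_real_mult smooth_real_affine smooth_flat_exp)
  also have "(\<lambda>t. flat_exp (real j * t + (- real j * a)) *
      flat_exp (- real j * t + real j * b)) = bump j a b"
    by (auto simp: bump_def algebra_simps)
  finally have "smooth_real (bump j a b)" .
  moreover have "\<forall>t. max \<bar>a\<bar> \<bar>b\<bar> < \<bar>t\<bar> \<longrightarrow> bump j a b t = 0"
    by (intro allI impI bump_eq_0) linarith
  ultimately show ?thesis unfolding test_function_def by blast
qed

lemma bump_tendsto: "(\<lambda>j. bump j a b t) \<longlonglongrightarrow> indicator {a<..<b} t"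
proof (cases "a < t \<and> t < b")
  case True
  have *: "(\<lambda>j. flat_exp (real j * u)) \<longlonglongrightarrow> 1" if "u > 0" for u
  proof -
    have "(\<lambda>j. exp (- (1 / u) / real j)) \<longlonglongrightarrow> exp 0"
      by (intro tendsto_exp lim_const_over_n)
    then have "(\<lambda>j. exp (- (1 / u) / real j)) \<longlonglongrightarrow> 1" by simp
    then show ?thesis
      by (rule Lim_transform_eventually)
         (use that in \<open>auto simp: flat_exp_def field_simps eventually_sequentially intro!: exI[of _ 1]\<close>)
  qed
  have "(\<lambda>j. bump j a b t) \<longlonglongrightarrow> 1 * 1"
    unfolding bump_def using True by (intro tendsto_mult *) auto
  then show ?thesis using True by simp
next
  case False
  then have "bump j a b t = 0" for j by (intro bump_eq_0) auto
  then show ?thesis using False by auto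
qed

text \<open>Dilation to scale \<open>2\<^sup>-\<^sup>n\<close>, normalised to preserve the integral.\<close>
definition dilate :: "nat \<Rightarrow> (real \<Rightarrow> real) \<Rightarrow> real \<Rightarrow> real" where
  "dilate n f t = 2 ^ n * f (2 ^ n * t)"

lemma test_function_dilate: "test_function f \<Longrightarrow> test_function (dilate n f)"
  unfolding dilate_def using test_function_cmult[OF test_function_affine[of f "2^n" 0], of "2^n"]
  by simp

lemma iter_deriv_dilate:
  assumes "smooth_real f"
  shows "(deriv ^^ k) (dilate n f) = (\<lambda>t. 2 ^ (n * k) * dilate n ((deriv ^^ k) f) t)"
proof -
  have "(deriv ^^ k) (\<lambda>t. 2 ^ n * f (2 ^ n * t + 0)) = (\<lambda>t. 2 ^ n * ((2 ^ n) ^ k * (deriv ^^ k) f (2 ^ n * t + 0)))"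
    by (simp only: iter_deriv_cmult[OF smooth_real_affine[OF assms]] iter_deriv_affine[OF assms])
  then show ?thesis
    by (simp add: dilate_def[abs_def] power_mult fun_eq_iff)
qed

lemma dilate_dilate: "dilate n (dilate k f) = dilate (n + k) f"
  by (auto simp: dilate_def power_add algebra_simps)

lemma integral_dilate: "(\<integral>t. dilate n f t \<partial>lborel) = (\<integral>t. f t \<partial>lborel)"
  using lborel_integral_real_affine[of "2 ^ n" f 0]
  by (simp add: dilate_def)

text \<open>A kernel \<open>\<kappa>\<close> of integral one whose difference with its dilation is a derivative of order \<open>r\<close>;
  equivalently, the moments of \<open>\<kappa>\<close> of orders \<open>1, \<dots>, r - 1\<close> vanish. The order is raised by one by
  replacing \<open>\<kappa>\<close> with a suitable affine combination of \<open>\<kappa>\<close> and its dilation.\<close>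
lemma exists_moment_kernel:
  assumes "1 \<le> r"
  obtains \<kappa> \<rho> where "test_function \<kappa>" "test_function \<rho>" "(\<integral>t. \<kappa> t \<partial>lborel) = 1"
    "\<And>t. \<kappa> t - dilate 1 \<kappa> t = (deriv ^^ r) \<rho> t"
proof -
  have "\<exists>\<kappa> \<rho>. test_function \<kappa> \<and> test_function \<rho> \<and> (\<integral>t. \<kappa> t \<partial>lborel) = 1 \<and>
    (\<forall>t. \<kappa> t - dilate 1 \<kappa> t = (deriv ^^ r) \<rho> t)"
    using assms
  proof (induction r rule: dec_induct)
    case base
    define b where "b = bump 1 0 1"
    have tb: "test_function b" unfolding b_def by (rule test_function_bump)
    have "(\<integral>t. b t \<partial>lborel) \<noteq> 0"
    proof
      assume "(\<integral>t. b t \<partial>lborel) = 0"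
      then have "AE t in lborel. b t = 0"
        using integral_nonneg_eq_0_iff_AE[OF test_function_integrable[OF tb]]
        by (simp add: b_def bump_range)
      then have "AE t in lborel. t \<notin> {0<..<1::real}"
        by eventually_elim (auto simp: b_def bump_def flat_exp_def split: if_splits)
      then have "emeasure lborel {0<..<1::real} = 0"
        by (subst (asm) AE_iff_measurable[of "{0<..<1}"]) auto
      then show False by simp
    qed
    define \<kappa> where "\<kappa> t = (1 / (\<integral>t. b t \<partial>lborel)) * b t" for t
    have k: "test_function \<kappa>" unfolding \<kappa>_def by (intro test_function_cmult tb)
    have ki: "(\<integral>t. \<kappa> t \<partial>lborel) = 1"
      unfolding \<kappa>_def using \<open>(\<integral>t. b t \<partial>lborel) \<noteq> 0\<close> by simp
    have "test_function (\<lambda>t. \<kappa> t + (-1) * dilate 1 \<kappa> t)"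
      by (intro test_function_add test_function_cmult test_function_dilate k)
    moreover have "(\<integral>t. \<kappa> t + (-1) * dilate 1 \<kappa> t \<partial>lborel) = 0"
      using test_function_integrable[OF k] test_function_integrable[OF test_function_dilate[OF k], of 1]
      by (simp add: integral_dilate)
    ultimately obtain \<rho> where "test_function \<rho>" "deriv \<rho> = (\<lambda>t. \<kappa> t + (-1) * dilate 1 \<kappa> t)"
      by (rule test_function_antideriv)
    then show ?case using k ki by (intro exI[of _ \<kappa>] exI[of _ \<rho>]) simp
  next
    case (step r)
    then obtain \<kappa> \<rho> where k: "test_function \<kappa>" and r: "test_function \<rho>"
      and ki: "(\<integral>t. \<kappa> t \<partial>lborel) = 1" and eq: "\<And>t. \<kappa> t - dilate 1 \<kappa> t = (deriv ^^ r) \<rho> t"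
      by blast
    \<comment> \<open>With weights \<open>1 - b\<close> and \<open>b\<close> the difference is the derivative of order \<open>r\<close> of \<open>\<sigma>\<close> below, and
      \<open>b\<close> is chosen so that \<open>\<sigma>\<close> has integral zero and is itself a derivative.\<close>
    define b where "b = (2::real) ^ r / (2 ^ r - 1)"
    have "(1::real) < 2 ^ r" by (rule one_less_power) (use step(1) in auto)
    then have "(2::real) ^ r \<noteq> 1" by linarith
    then have b: "(1 - b) + b / 2 ^ r = 0" by (simp add: b_def field_simps)
    define \<kappa>' where "\<kappa>' t = (1 - b) * \<kappa> t + b * dilate 1 \<kappa> t" for t
    define \<sigma> where "\<sigma> t = (1 - b) * \<rho> t + (b / 2 ^ r) * dilate 1 \<rho> t" for t
    note tfs = test_function_add test_function_cmult test_function_dilate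
    note ints = test_function_integrable[OF k] test_function_integrable[OF test_function_dilate[OF k], of 1]
      test_function_integrable[OF r] test_function_integrable[OF test_function_dilate[OF r], of 1]
    have k': "test_function \<kappa>'" unfolding \<kappa>'_def by (intro tfs k)
    have s: "test_function \<sigma>" unfolding \<sigma>_def by (intro tfs r)
    have ki': "(\<integral>t. \<kappa>' t \<partial>lborel) = 1"
      unfolding \<kappa>'_def using ints ki by (simp add: integral_dilate)
    have "(\<integral>t. \<sigma> t \<partial>lborel) = ((1 - b) + b / 2 ^ r) * (\<integral>t. \<rho> t \<partial>lborel)"
      unfolding \<sigma>_def using ints by (simp add: integral_dilate distrib_right)
    then have "(\<integral>t. \<sigma> t \<partial>lborel) = 0" using b by simp
    then obtain \<tau> where t: "test_function \<tau>" and dt: "deriv \<tau> = \<sigma>"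
      using test_function_antideriv[OF s] by blast
    have sm: "smooth_real \<rho>" "smooth_real (dilate 1 \<rho>)"
      using r by (auto intro: test_function_smooth test_function_dilate)
    have ds: "(deriv ^^ r) \<sigma> t = (1 - b) * (deriv ^^ r) \<rho> t + b * dilate 1 ((deriv ^^ r) \<rho>) t" for t
    proof -
      have "(deriv ^^ r) \<sigma> t = (1 - b) * (deriv ^^ r) \<rho> t + (b / 2 ^ r) * (deriv ^^ r) (dilate 1 \<rho>) t"
        unfolding \<sigma>_def using sm
        by (simp add: iter_deriv_add smooth_real_cmult iter_deriv_cmult del: funpow.simps
            times_divide_eq_left)
      also have "(deriv ^^ r) (dilate 1 \<rho>) t = 2 ^ r * dilate 1 ((deriv ^^ r) \<rho>) t"
        using iter_deriv_dilate[OF sm(1), of r 1] by simp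
      finally show ?thesis by simp
    qed
    have "\<kappa>' t - dilate 1 \<kappa>' t = (deriv ^^ r) \<sigma> t" for t
    proof -
      have "\<kappa>' t - dilate 1 \<kappa>' t = (1 - b) * (\<kappa> t - dilate 1 \<kappa> t) +
         b * (2 * (\<kappa> (2 * t) - dilate 1 \<kappa> (2 * t)))"
        by (simp add: \<kappa>'_def dilate_def algebra_simps)
      also have "\<dots> = (1 - b) * (deriv ^^ r) \<rho> t + b * dilate 1 ((deriv ^^ r) \<rho>) t"
        unfolding eq by (simp add: dilate_def)
      finally show ?thesis by (simp add: ds)
    qed
    moreover have "(deriv ^^ r) \<sigma> = (deriv ^^ Suc r) \<tau>"
      by (simp add: funpow_Suc_right dt del: funpow.simps)
    ultimately show ?case using k' t ki' by (intro exI[of _ \<kappa>'] exI[of _ \<tau>]) simp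
  qed
  then show ?thesis using that by blast
qed

section \<open>Tensor kernels, convolution and approximate identities\<close>

text \<open>The tensor product \<open>x \<mapsto> f\<^sub>1(x\<^sub>1) \<dots> f\<^sub>d(x\<^sub>d)\<close> of functions of one variable. Its iterated partial
  derivatives are again tensor products, in which only the number of differentiations in each
  coordinate matters; in particular the order of differentiation is irrelevant.\<close>
definition tensor :: "('n::finite \<Rightarrow> real \<Rightarrow> real) \<Rightarrow> real ^ 'n \<Rightarrow> real" where
  "tensor f x = (\<Prod>i\<in>UNIV. f i (x $ i))"

text \<open>The factors of the derivative \<open>\<partial>\<^sub>\<alpha>\<close> of a tensor product.\<close>
definition tensor_deriv :: "('n \<Rightarrow> nat) \<Rightarrow> ('n \<Rightarrow> real \<Rightarrow> real) \<Rightarrow> 'n \<Rightarrow> real \<Rightarrow> real" where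
  "tensor_deriv \<alpha> f = (\<lambda>i. (deriv ^^ \<alpha> i) (f i))"

lemma coords: "distinct (coords :: 'n::finite list)" "set (coords :: 'n list) = UNIV"
proof -
  have "\<exists>is :: 'n list. distinct is \<and> set is = UNIV"
    using finite_distinct_list[of "UNIV :: 'n set"] by auto
  from someI_ex[OF this] show "distinct (coords :: 'n list)" "set (coords :: 'n list) = UNIV"
    unfolding coords_def by auto
qed

text \<open>The list of coordinates along which \<open>multi_deriv \<alpha>\<close> differentiates.\<close>
definition mi_list :: "('n::finite \<Rightarrow> nat) \<Rightarrow> 'n list" where
  "mi_list \<alpha> = concat (map (\<lambda>i. replicate (\<alpha> i) i) coords)"

lemma multi_deriv_mi_list: "multi_deriv \<alpha> f = iter_partial (mi_list \<alpha>) f"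
  by (simp add: multi_deriv_def mi_list_def)

lemma count_list_replicate: "count_list (replicate n x) y = (if x = y then n else 0)"
  by (induction n) auto

lemma count_mi_list: "count_list (mi_list \<alpha>) i = \<alpha> i"
proof -
  have "count_list (concat (map (\<lambda>i. replicate (\<alpha> i) i) is)) i = (if i \<in> set is then \<alpha> i else 0)"
    if "distinct is" for "is"
    using that by (induction "is") (auto simp: count_list_replicate)
  from this[OF coords(1)] show ?thesis by (simp add: mi_list_def coords)
qed

lemma length_mi_list: "length (mi_list \<alpha>) = mi_order \<alpha>"
proof -
  have "length (mi_list \<alpha>) = (\<Sum>i\<leftarrow>coords. \<alpha> i)"
    by (simp add: mi_list_def length_concat comp_def)
  also have "\<dots> = (\<Sum>i\<in>set coords. \<alpha> i)"
    by (rule sum_list_distinct_conv_sum_set[OF coords(1)])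
  finally show ?thesis by (simp add: coords mi_order_def)
qed

lemma finite_mi_upto [simp]: "finite (mi_upto k :: ('n::finite \<Rightarrow> nat) set)"
proof (rule finite_subset)
  show "mi_upto k \<subseteq> (UNIV :: 'n set) \<rightarrow>\<^sub>E {..k}"
    unfolding mi_upto_def mi_order_def
    by (auto simp: PiE_def extensional_def intro: order_trans[OF member_le_sum[of _ UNIV]])
qed (intro finite_PiE; simp)

lemma axis_component: "(x + t *\<^sub>R axis i (1::real)) $ j = (if j = i then x $ j + t else x $ j)"
  by (simp add: axis_def)

lemma tensor_has_partial:
  assumes "\<And>i. smooth_real (f i)"
  shows "((\<lambda>t. tensor f (x + t *\<^sub>R axis i 1)) has_real_derivative
    tensor (f(i := deriv (f i))) (x + s *\<^sub>R axis i 1)) (at s)"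
proof -
  have eq: "tensor g (x + t *\<^sub>R axis i 1) = g i (x $ i + t) * (\<Prod>j\<in>UNIV - {i}. g j (x $ j))" for g t
    unfolding tensor_def
    by (subst prod.remove[of _ i]) (auto simp: axis_component simp del: vector_add_component intro!: prod.cong)
  have "((\<lambda>t. f i (x $ i + t)) has_real_derivative deriv (f i) (x $ i + s) * (0 + 1)) (at s)"
    by (intro DERIV_chain2[OF smooth_real_has_derivative_1[OF assms]] DERIV_add DERIV_const DERIV_ident)
  then have "((\<lambda>t. f i (x $ i + t)) has_real_derivative deriv (f i) (x $ i + s)) (at s)" by simp
  from DERIV_cmult_right[OF this, of "\<Prod>j\<in>UNIV - {i}. f j (x $ j)"]
  moreover have "(\<Prod>j\<in>UNIV - {i}. (f(i := deriv (f i))) j (x $ j)) = (\<Prod>j\<in>UNIV - {i}. f j (x $ j))"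
    by (intro prod.cong) auto
  ultimately show ?thesis unfolding eq by (simp only: fun_upd_same)
qed

lemma iter_partial_tensor:
  assumes "\<And>i. smooth_real (f i)"
  shows "iter_partial is (tensor f) = tensor (\<lambda>i. (deriv ^^ count_list is i) (f i))"
proof (induction "is")
  case (Cons i "is")
  let ?g = "\<lambda>i. (deriv ^^ count_list is i) (f i)"
  have "partial_deriv i (tensor ?g) = tensor (?g(i := deriv (?g i)))"
  proof
    fix x
    show "partial_deriv i (tensor ?g) x = tensor (?g(i := deriv (?g i))) x"
      unfolding partial_deriv_def
      using DERIV_imp_deriv[OF tensor_has_partial[of ?g x i 0]] assms
      by (simp add: smooth_real_iter_deriv)
  qed
  moreover have "?g(i := deriv (?g i)) = (\<lambda>j. (deriv ^^ count_list (i # is) j) (f j))" by auto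
  ultimately show ?case by (simp add: Cons)
qed simp

lemma multi_deriv_tensor:
  "(\<And>i. smooth_real (f i)) \<Longrightarrow> multi_deriv \<alpha> (tensor f) = tensor (tensor_deriv \<alpha> f)"
  by (simp add: multi_deriv_mi_list iter_partial_tensor count_mi_list tensor_deriv_def)

lemma continuous_tensor:
  assumes "\<And>i. continuous_on UNIV (f i)"
  shows "continuous_on A (tensor f)"
proof -
  have "continuous_on A (\<lambda>x. f i (x $ i))" for i
    by (rule continuous_on_compose2[OF assms[of i]]) (auto intro: continuous_intros)
  then show ?thesis unfolding tensor_def[abs_def] by (intro continuous_on_prod) auto
qed

lemma smooth_tensor:
  assumes "\<And>i. smooth_real (f i)"
  shows "smooth (tensor f)"
  unfolding smooth_def iter_partial_tensor[OF assms]
proof (intro allI conjI)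
  fix "is" and i x
  let ?g = "\<lambda>i. (deriv ^^ count_list is i) (f i)"
  show "continuous_on UNIV (tensor ?g)"
    by (intro continuous_tensor smooth_real_continuous assms)
  have "((\<lambda>t. tensor ?g (x + t *\<^sub>R axis i 1)) has_real_derivative
    tensor (?g(i := deriv (?g i))) (x + 0 *\<^sub>R axis i 1)) (at 0)"
    by (rule tensor_has_partial) (intro smooth_real_iter_deriv assms)
  then show "(\<lambda>t. tensor ?g (x + t *\<^sub>R axis i 1)) field_differentiable at 0"
    unfolding field_differentiable_def by blast
qed

lemma test_family_bounds:
  assumes "\<And>i::'n::finite. test_function (f i)"
  obtains L B where "0 < L" "0 < B" "\<And>i t. L < \<bar>t\<bar> \<Longrightarrow> f i t = 0" "\<And>i t. \<bar>f i t\<bar> \<le> B"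
proof -
  have "\<exists>L. \<forall>t. L < \<bar>t\<bar> \<longrightarrow> f i t = 0" for i using assms[of i] by (simp add: test_function_def)
  then obtain L where L: "\<And>i t. L i < \<bar>t\<bar> \<Longrightarrow> f i t = 0" by metis
  have "\<exists>B. \<forall>t. \<bar>f i t\<bar> \<le> B" for i using test_function_bounded[OF assms[of i]] by metis
  then obtain B where B: "\<And>i t. \<bar>f i t\<bar> \<le> B i" by metis
  have le: "g i \<le> max 1 (Max (range g))" for g :: "'n \<Rightarrow> real" and i
    by (simp add: le_max_iff_disj)
  have p: "0 < max 1 (Max (range g))" for g :: "'n \<Rightarrow> real" by simp
  show ?thesis
    by (rule that[OF p p, of L B]) (use L B le order_trans le_less_trans in blast)+
qed

lemma tensor_le:
  fixes f :: "'n::finite \<Rightarrow> real \<Rightarrow> real"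
  assumes "0 \<le> L" "0 \<le> B" "\<And>i t. L < \<bar>t\<bar> \<Longrightarrow> f i t = 0" "\<And>i t. \<bar>f i t\<bar> \<le> B"
  shows "\<bar>tensor f z\<bar> \<le> B ^ CARD('n) * indicator (cbox (- (\<chi> i. L)) (\<chi> i. L)) z"
proof (cases "z \<in> cbox (- (\<chi> i. L)) (\<chi> i. L)")
  case True
  have "\<bar>tensor f z\<bar> \<le> (\<Prod>i\<in>(UNIV::'n set). B)"
    unfolding tensor_def abs_prod by (intro prod_mono) (use assms in auto)
  then show ?thesis using True by simp
next
  case False
  then obtain i where "\<not> \<bar>z $ i\<bar> \<le> L" by (auto simp: mem_box_cart abs_le_iff) (metis minus_le_iff)+
  then have "tensor f z = 0" unfolding tensor_def using assms(3)[of "z $ i" i]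
    by (intro prod_zero) (auto intro!: bexI[of _ i])
  then show ?thesis using assms by simp
qed

lemma continuous_tensor_test:
  "(\<And>i. test_function (f i)) \<Longrightarrow> continuous_on A (tensor f)"
  by (intro continuous_tensor test_function_continuous)

lemma borel_measurable_tensor:
  "(\<And>i. test_function (f i)) \<Longrightarrow> tensor f \<in> borel_measurable borel"
  by (intro borel_measurable_continuous_onI continuous_tensor_test)

lemma measurable_tensor_diff:
  fixes f :: "'n::finite \<Rightarrow> real \<Rightarrow> real"
  assumes "\<And>i. test_function (f i)"
  shows "(\<lambda>(x, y). tensor f (y - x)) \<in> borel_measurable (borel \<Otimes>\<^sub>M borel)"
  unfolding case_prod_beta
  by (rule measurable_compose[OF _ borel_measurable_tensor[OF assms]]) measurable

lemma cbox_diff_iff: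
  fixes x :: "real ^ 'n"
  shows "y - x \<in> cbox (- c) c \<longleftrightarrow> x \<in> cbox (y - c) (y + c)" "y - x \<in> cbox (- c) c \<longleftrightarrow> y \<in> cbox (x - c) (x + c)"
proof -
  have "(\<forall>i. - c $ i \<le> y $ i - x $ i \<and> y $ i - x $ i \<le> c $ i) \<longleftrightarrow>
      (\<forall>i. y $ i - c $ i \<le> x $ i \<and> x $ i \<le> y $ i + c $ i)" by (rule all_cong1) linarith
  then show "y - x \<in> cbox (- c) c \<longleftrightarrow> x \<in> cbox (y - c) (y + c)" by (simp add: mem_box_cart)
  have "(\<forall>i. - c $ i \<le> y $ i - x $ i \<and> y $ i - x $ i \<le> c $ i) \<longleftrightarrow>
      (\<forall>i. x $ i - c $ i \<le> y $ i \<and> y $ i \<le> x $ i + c $ i)" by (rule all_cong1) linarith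
  then show "y - x \<in> cbox (- c) c \<longleftrightarrow> y \<in> cbox (x - c) (x + c)" by (simp add: mem_box_cart)
qed

lemma emeasure_cube:
  fixes x :: "real ^ 'n"
  assumes "0 \<le> L"
  shows "emeasure lborel (cbox (x - (\<chi> i. L)) (x + (\<chi> i. L))) = ennreal ((2 * L) ^ CARD('n))"
proof -
  have c: "(\<chi> i. L :: real ^ 'n) \<bullet> b = L" if "b \<in> Basis" for b
    using that by (auto simp: Basis_vec_def inner_axis)
  have "(x + (\<chi> i. L) - (x - (\<chi> i. L))) \<bullet> b = 2 * L" if "b \<in> Basis" for b
  proof -
    have "x + (\<chi> i. L) - (x - (\<chi> i. L)) = (\<chi> i. L) + (\<chi> i. L)" by simp
    then show ?thesis using c[OF that] by (simp only: inner_add_left)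
  qed
  moreover have "\<forall>b\<in>Basis. (x - (\<chi> i. L)) \<bullet> b \<le> (x + (\<chi> i. L)) \<bullet> b"
    using c assms by (simp add: inner_simps)
  ultimately show ?thesis by (simp add: emeasure_lborel_cbox_eq)
qed

text \<open>The \<open>L\<^sup>1\<close> norm of a dilated tensor kernel is bounded uniformly in the scale, its sup norm grows
  like \<open>2\<^sup>n\<^sup>d\<close>, and its support shrinks to the origin. The \<open>L\<^sup>1\<close> bound is only sup norm times volume of
  a supporting cube, which avoids a change of variables.\<close>
lemma dilated_tensor_bounds:
  fixes f :: "'n::finite \<Rightarrow> real \<Rightarrow> real"
  assumes f: "\<And>i. test_function (f i)"
  obtains M L where "0 < M" "0 < L"
    "\<And>n z. \<bar>tensor (\<lambda>i. dilate n (f i)) z\<bar> \<le> 2 ^ (n * CARD('n)) * M"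
    "\<And>n y. (\<integral>\<^sup>+x. ennreal \<bar>tensor (\<lambda>i. dilate n (f i)) (y - x)\<bar> \<partial>lborel) \<le> ennreal M"
    "\<And>n x. (\<integral>\<^sup>+y. ennreal \<bar>tensor (\<lambda>i. dilate n (f i)) (y - x)\<bar> \<partial>lborel) \<le> ennreal M"
    "\<And>n z i. L / 2 ^ n < \<bar>z $ i\<bar> \<Longrightarrow> tensor (\<lambda>i. dilate n (f i)) z = 0"
proof -
  obtain L B where L: "0 < L" "0 < B" "\<And>i t. L < \<bar>t\<bar> \<Longrightarrow> f i t = 0" "\<And>i t. \<bar>f i t\<bar> \<le> B"
    using test_family_bounds[of f, OF f] by metis
  define M where "M = max (B ^ CARD('n)) ((2 * L * B) ^ CARD('n))"
  have z: "dilate n (f i) t = 0" if "L / 2 ^ n < \<bar>t\<bar>" for n i t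
    using L(3)[of "2 ^ n * t" i] that by (simp add: dilate_def abs_mult field_simps)
  have le: "\<bar>tensor (\<lambda>i. dilate n (f i)) z\<bar> \<le>
     (2 ^ n * B) ^ CARD('n) * indicator (cbox (- (\<chi> i. L / 2 ^ n)) (\<chi> i. L / 2 ^ n)) z" for n z
    by (rule tensor_le[OF _ _ z]) (use L in \<open>auto simp: dilate_def abs_mult\<close>)
  have i1: "(\<integral>\<^sup>+x. ennreal ((2 ^ n * B) ^ CARD('n) * indicator (cbox (a - (\<chi> i. L / 2 ^ n)) (a + (\<chi> i. L / 2 ^ n))) x) \<partial>lborel)
     \<le> ennreal M" for n and a :: "real ^ 'n"
  proof -
    have "(\<integral>\<^sup>+x. ennreal ((2 ^ n * B) ^ CARD('n) * indicator (cbox (a - (\<chi> i. L / 2 ^ n)) (a + (\<chi> i. L / 2 ^ n))) x) \<partial>lborel)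
      = (\<integral>\<^sup>+x. ennreal ((2 ^ n * B) ^ CARD('n)) * indicator (cbox (a - (\<chi> i. L / 2 ^ n)) (a + (\<chi> i. L / 2 ^ n))) x \<partial>lborel)"
      by (intro nn_integral_cong) (auto simp: indicator_def)
    also have "\<dots> = ennreal ((2 ^ n * B) ^ CARD('n)) * ennreal ((2 * (L / 2 ^ n)) ^ CARD('n))"
      using L by (subst nn_integral_cmult_indicator) (auto simp: emeasure_cube)
    also have "\<dots> = ennreal ((2 * L * B) ^ CARD('n))"
    proof -
      have "(2 ^ n * B) * (2 * (L / 2 ^ n)) = 2 * L * B" by simp
      then have "(2 ^ n * B) ^ CARD('n) * (2 * (L / 2 ^ n)) ^ CARD('n) = (2 * L * B) ^ CARD('n)"
        by (simp only: power_mult_distrib[symmetric])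
      then show ?thesis using L by (subst ennreal_mult[symmetric]) auto
    qed
    also have "\<dots> \<le> ennreal M" by (intro ennreal_leI) (simp add: M_def)
    finally show ?thesis .
  qed
  show ?thesis
  proof (rule that[of M L])
    show "0 < M" using L by (simp add: M_def less_max_iff_disj)
    show "0 < L" by fact
    show "\<bar>tensor (\<lambda>i. dilate n (f i)) z\<bar> \<le> 2 ^ (n * CARD('n)) * M" for n z
    proof -
      have "\<bar>tensor (\<lambda>i. dilate n (f i)) z\<bar> \<le> (2 ^ n * B) ^ CARD('n) * 1"
        by (rule order_trans[OF le mult_left_mono]) (use L in \<open>auto simp: indicator_def\<close>)
      also have "\<dots> = 2 ^ (n * CARD('n)) * B ^ CARD('n)" by (simp add: power_mult power_mult_distrib)
      also have "\<dots> \<le> 2 ^ (n * CARD('n)) * M" by (intro mult_left_mono) (auto simp: M_def)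
      finally show ?thesis .
    qed
    show "(\<integral>\<^sup>+x. ennreal \<bar>tensor (\<lambda>i. dilate n (f i)) (y - x)\<bar> \<partial>lborel) \<le> ennreal M" for n y
      by (rule order_trans[OF nn_integral_mono[OF ennreal_leI[OF le]]])
         (use i1[of n y] in \<open>simp add: indicator_def cbox_diff_iff(1)\<close>)
    show "(\<integral>\<^sup>+y. ennreal \<bar>tensor (\<lambda>i. dilate n (f i)) (y - x)\<bar> \<partial>lborel) \<le> ennreal M" for n x
      by (rule order_trans[OF nn_integral_mono[OF ennreal_leI[OF le]]])
         (use i1[of n x] in \<open>simp add: indicator_def cbox_diff_iff(2)\<close>)
    show "tensor (\<lambda>i. dilate n (f i)) z = 0" if "L / 2 ^ n < \<bar>z $ i\<bar>" for n z i
      unfolding tensor_def using z[OF that] by (auto intro!: prod_zero)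
  qed
qed

text \<open>Differentiation under the integral sign.\<close>
lemma has_derivative_integral:
  fixes \<Phi> :: "real \<Rightarrow> 'a \<Rightarrow> real"
  assumes der: "\<And>t x. \<bar>t\<bar> < 1 \<Longrightarrow> ((\<lambda>t. \<Phi> t x) has_real_derivative \<Phi>' t x) (at t)"
    and bound: "\<And>t x. \<bar>t\<bar> < 1 \<Longrightarrow> \<bar>\<Phi>' t x\<bar> \<le> w x" and w: "integrable M w"
    and int: "\<And>t. \<bar>t\<bar> < 1 \<Longrightarrow> integrable M (\<Phi> t)" and meas: "\<Phi>' 0 \<in> borel_measurable M"
  shows "((\<lambda>t. \<integral>x. \<Phi> t x \<partial>M) has_real_derivative (\<integral>x. \<Phi>' 0 x \<partial>M)) (at 0)"
  unfolding DERIV_def tendsto_at_iff_sequentially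
proof (intro allI impI)
  fix X :: "nat \<Rightarrow> real" assume X: "\<forall>i. X i \<in> UNIV - {0}" "X \<longlonglongrightarrow> 0"
  then have "\<forall>\<^sub>F i in sequentially. \<bar>X i\<bar> < 1"
    using tendstoD[of X 0 sequentially 1] by (simp add: dist_real_def)
  then obtain N where N: "\<And>i. N \<le> i \<Longrightarrow> \<bar>X i\<bar> < 1" by (auto simp: eventually_sequentially)
  let ?Y = "\<lambda>i. X (i + N)"
  have Y: "\<bar>?Y i\<bar> < 1" "?Y i \<noteq> 0" for i using N X by auto
  have limY: "?Y \<longlonglongrightarrow> 0" using X by (intro LIMSEQ_ignore_initial_segment)
  have "(\<lambda>i. \<integral>x. (\<Phi> (?Y i) x - \<Phi> 0 x) / ?Y i \<partial>M) \<longlonglongrightarrow> (\<integral>x. \<Phi>' 0 x \<partial>M)"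
  proof (rule integral_dominated_convergence[where w = w])
    show "(\<lambda>x. (\<Phi> (?Y i) x - \<Phi> 0 x) / ?Y i) \<in> borel_measurable M" for i
      using int[OF Y(1)[of i]] int[of 0] by auto
    show "AE x in M. (\<lambda>i. (\<Phi> (?Y i) x - \<Phi> 0 x) / ?Y i) \<longlonglongrightarrow> \<Phi>' 0 x"
    proof (intro AE_I2)
      fix x
      have "((\<lambda>h. (\<Phi> (0 + h) x - \<Phi> 0 x) / h) \<longlongrightarrow> \<Phi>' 0 x) (at 0)"
        using der[of 0 x] by (simp add: DERIV_def)
      from this[unfolded tendsto_at_iff_sequentially, rule_format, of ?Y]
      show "(\<lambda>i. (\<Phi> (?Y i) x - \<Phi> 0 x) / ?Y i) \<longlonglongrightarrow> \<Phi>' 0 x"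
        using Y limY by (auto simp: comp_def)
    qed
    show "AE x in M. norm ((\<Phi> (?Y i) x - \<Phi> 0 x) / ?Y i) \<le> w x" for i
    proof (intro AE_I2)
      fix x
      have "norm (\<Phi> (?Y i) x - \<Phi> 0 x) \<le> w x * norm (?Y i - 0)"
      proof (rule field_differentiable_bound[of "{-1<..<1}" "\<lambda>t. \<Phi> t x" "\<lambda>t. \<Phi>' t x"])
        show "((\<lambda>t. \<Phi> t x) has_field_derivative \<Phi>' t x) (at t within {-1<..<1})"
          if "t \<in> {-1<..<1}" for t
          by (rule has_field_derivative_at_within[OF der]) (use that in auto)
        show "norm (\<Phi>' t x) \<le> w x" if "t \<in> {-1<..<1}" for t
          unfolding real_norm_def by (rule bound) (use that in auto)
      qed (use Y[of i] in auto)
      then show "norm ((\<Phi> (?Y i) x - \<Phi> 0 x) / ?Y i) \<le> w x"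
        using Y[of i] by (simp add: abs_divide field_simps)
    qed
  qed (use w meas in auto)
  then have "(\<lambda>i. ((\<integral>x. \<Phi> (?Y i) x \<partial>M) - (\<integral>x. \<Phi> 0 x \<partial>M)) / ?Y i) \<longlonglongrightarrow> (\<integral>x. \<Phi>' 0 x \<partial>M)"
    using int[OF Y(1)] int[of 0] by simp
  then show "((\<lambda>h. ((\<integral>x. \<Phi> (0 + h) x \<partial>M) - (\<integral>x. \<Phi> 0 x \<partial>M)) / h) \<circ> X) \<longlonglongrightarrow> (\<integral>x. \<Phi>' 0 x \<partial>M)"
    unfolding comp_def add_0 by (rule LIMSEQ_offset)
qed

text \<open>The kernel is evaluated at \<open>y - x\<close>, with \<open>x\<close> the integration variable. Derivatives in the free
  variable \<open>y\<close> therefore fall on the kernel without a sign.\<close>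
definition conv :: "(real ^ 'n \<Rightarrow> real) \<Rightarrow> ('n::finite \<Rightarrow> real \<Rightarrow> real) \<Rightarrow> real ^ 'n \<Rightarrow> real" where
  "conv s f y = (\<integral>x. s x * tensor f (y - x) \<partial>lborel)"

lemma integrable_indicator_cbox: "integrable lborel (\<lambda>x. c * indicator (cbox a b) x :: real)"
  by (intro integrable_mult_right integrable_real_indicator) (auto simp: emeasure_lborel_cbox_finite[simplified])

text \<open>An integrable majorant that is uniform for \<open>y\<close> in a ball, as needed for dominated convergence.\<close>
lemma tensor_diff_dominated:
  fixes f :: "'n::finite \<Rightarrow> real \<Rightarrow> real"
  assumes f: "\<And>i. test_function (f i)" and s: "\<And>x. \<bar>s x\<bar> \<le> S"
  obtains w where "integrable lborel w" "\<And>x y. norm y \<le> R \<Longrightarrow> \<bar>s x * tensor f (y - x)\<bar> \<le> w x"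
proof -
  obtain L B where L: "0 < L" "0 < B" "\<And>i t. L < \<bar>t\<bar> \<Longrightarrow> f i t = 0" "\<And>i t. \<bar>f i t\<bar> \<le> B"
    using test_family_bounds[of f, OF f] by metis
  let ?c = "\<chi> i. L :: real ^ 'n" and ?d = "\<chi> i. L + R :: real ^ 'n"
  have S: "0 \<le> S" using s[of undefined] by linarith
  show ?thesis
  proof (rule that[of "\<lambda>x. S * B ^ CARD('n) * indicator (cbox (- ?d) ?d) x"])
    show "integrable lborel (\<lambda>x. S * B ^ CARD('n) * indicator (cbox (- ?d) ?d) x)"
      by (rule integrable_indicator_cbox)
    fix x y :: "real ^ 'n" assume y: "norm y \<le> R"
    have "\<bar>tensor f (y - x)\<bar> \<le> B ^ CARD('n) * indicator (cbox (- ?c) ?c) (y - x)"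
      by (rule tensor_le[OF _ _ L(3,4)]) (use L in auto)
    also have "\<dots> \<le> B ^ CARD('n) * indicator (cbox (- ?d) ?d) x"
    proof (intro mult_left_mono)
      have "x \<in> cbox (- ?d) ?d" if "y - x \<in> cbox (- ?c) ?c"
        unfolding mem_box_cart
      proof (intro allI)
        fix i
        have "- L \<le> y $ i - x $ i" "y $ i - x $ i \<le> L" using that by (auto simp: mem_box_cart)
        moreover have "\<bar>y $ i\<bar> \<le> R" using component_le_norm_cart[of y i] y by linarith
        ultimately show "(- ?d) $ i \<le> x $ i \<and> x $ i \<le> ?d $ i" by auto
      qed
      then show "indicator (cbox (- ?c) ?c) (y - x) \<le> (indicator (cbox (- ?d) ?d) x :: real)"
        by (auto simp: indicator_def)
    qed (use L in auto)
    finally have "\<bar>s x\<bar> * \<bar>tensor f (y - x)\<bar> \<le> S * (B ^ CARD('n) * indicator (cbox (- ?d) ?d) x)"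
      by (intro mult_mono s) (use S in auto)
    then show "\<bar>s x * tensor f (y - x)\<bar> \<le> S * B ^ CARD('n) * indicator (cbox (- ?d) ?d) x"
      by (simp add: abs_mult mult.assoc)
  qed
qed

lemma integrable_tensor_diff:
  fixes f :: "'n::finite \<Rightarrow> real \<Rightarrow> real"
  assumes f: "\<And>i. test_function (f i)" and s: "\<And>x. \<bar>s x\<bar> \<le> S"
    and [measurable]: "s \<in> borel_measurable borel"
  shows "integrable lborel (\<lambda>x. s x * tensor f (y - x))"
proof -
  note [measurable] = borel_measurable_tensor[OF f]
  obtain w where w: "integrable lborel w" "\<And>x z. norm z \<le> norm y \<Longrightarrow> \<bar>s x * tensor f (z - x)\<bar> \<le> w x"
    using tensor_diff_dominated[of f s S "norm y", OF f s] by metis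
  show ?thesis
    by (rule Bochner_Integration.integrable_bound[OF w(1)])
       (auto intro!: AE_I2 order_trans[OF w(2)[OF order_refl] abs_ge_self])
qed

lemma test_family_upd:
  "(\<And>i. test_function (f i)) \<Longrightarrow> test_function ((f(i := deriv (f i))) j)"
  using test_function_iter_deriv[of "f i" 1] by auto

lemma conv_has_partial:
  fixes f :: "'n::finite \<Rightarrow> real \<Rightarrow> real"
  assumes f: "\<And>i. test_function (f i)" and s: "\<And>x. \<bar>s x\<bar> \<le> S"
    and [measurable]: "s \<in> borel_measurable borel"
  shows "((\<lambda>t. conv s f (y + t *\<^sub>R axis i 1)) has_real_derivative conv s (f(i := deriv (f i))) y) (at 0)"
proof -
  let ?g = "f(i := deriv (f i))"
  have g: "\<And>j. test_function (?g j)" by (rule test_family_upd[OF f])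
  note [measurable] = borel_measurable_tensor[OF g]
  obtain w where w: "integrable lborel w"
    "\<And>x z. norm z \<le> norm y + 1 \<Longrightarrow> \<bar>s x * tensor ?g (z - x)\<bar> \<le> w x"
    using tensor_diff_dominated[of ?g s S "norm y + 1", OF g s] by metis
  have "((\<lambda>t. \<integral>x. s x * tensor f (y + t *\<^sub>R axis i 1 - x) \<partial>lborel) has_real_derivative
     (\<integral>x. s x * tensor ?g (y + 0 *\<^sub>R axis i 1 - x) \<partial>lborel)) (at 0)"
  proof (rule has_derivative_integral[OF _ _ w(1)])
    fix t :: real and x :: "real ^ 'n" assume t: "\<bar>t\<bar> < 1"
    have "((\<lambda>t. s x * tensor f (y - x + t *\<^sub>R axis i 1)) has_real_derivative
        s x * tensor ?g (y - x + t *\<^sub>R axis i 1)) (at t)"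
      by (intro DERIV_cmult tensor_has_partial test_function_smooth f)
    then show "((\<lambda>t. s x * tensor f (y + t *\<^sub>R axis i 1 - x)) has_real_derivative
        s x * tensor ?g (y + t *\<^sub>R axis i 1 - x)) (at t)"
      by (simp add: algebra_simps)
    have "norm (y + t *\<^sub>R axis i 1) \<le> norm y + \<bar>t\<bar> * 1"
      by (rule norm_triangle_le) simp
    with t show "\<bar>s x * tensor ?g (y + t *\<^sub>R axis i 1 - x)\<bar> \<le> w x" by (intro w) auto
  next
    fix t :: real
    show "integrable lborel (\<lambda>x. s x * tensor f (y + t *\<^sub>R axis i 1 - x))"
      by (rule integrable_tensor_diff[OF f s]) measurable
  qed measurable
  then show ?thesis unfolding conv_def by simp
qed

lemma continuous_conv:
  fixes f :: "'n::finite \<Rightarrow> real \<Rightarrow> real"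
  assumes f: "\<And>i. test_function (f i)" and s: "\<And>x. \<bar>s x\<bar> \<le> S"
    and [measurable]: "s \<in> borel_measurable borel"
  shows "continuous_on A (conv s f)"
proof (intro continuous_at_imp_continuous_on ballI)
  fix y
  note [measurable] = borel_measurable_tensor[OF f]
  show "isCont (conv s f) y"
    unfolding continuous_at_sequentially
  proof (intro allI impI)
    fix X assume X: "X \<longlonglongrightarrow> y"
    then have "Bseq X" using convergentI convergent_imp_Bseq by blast
    then obtain R where R: "\<And>n. norm (X n) \<le> R" by (auto simp: Bseq_def)
    obtain w where w: "integrable lborel w" "\<And>x z. norm z \<le> R \<Longrightarrow> \<bar>s x * tensor f (z - x)\<bar> \<le> w x"
      using tensor_diff_dominated[of f s S R, OF f s] by metis
    show "(conv s f \<circ> X) \<longlonglongrightarrow> conv s f y"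
      unfolding comp_def conv_def
    proof (rule integral_dominated_convergence[where w = w])
      have "(\<lambda>n. tensor f (X n - x)) \<longlonglongrightarrow> tensor f (y - x)" for x
        by (rule continuous_on_tendsto_compose[OF continuous_tensor_test[OF f, of UNIV]])
           (auto intro!: tendsto_intros X)
      then show "AE x in lborel. (\<lambda>n. s x * tensor f (X n - x)) \<longlonglongrightarrow> s x * tensor f (y - x)"
        by (intro AE_I2 tendsto_mult tendsto_const)
    qed (use w R in auto)
  qed
qed

lemma iter_partial_conv:
  fixes f :: "'n::finite \<Rightarrow> real \<Rightarrow> real"
  assumes f: "\<And>i. test_function (f i)" and s: "\<And>x. \<bar>s x\<bar> \<le> S"
    and sm: "s \<in> borel_measurable borel"
  shows "iter_partial is (conv s f) = conv s (\<lambda>i. (deriv ^^ count_list is i) (f i))"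
proof (induction "is")
  case (Cons i "is")
  let ?g = "\<lambda>i. (deriv ^^ count_list is i) (f i)"
  have "partial_deriv i (conv s ?g) = conv s (?g(i := deriv (?g i)))"
    unfolding partial_deriv_def
    by (intro ext DERIV_imp_deriv conv_has_partial[OF _ s sm] test_function_iter_deriv f)
  moreover have "?g(i := deriv (?g i)) = (\<lambda>j. (deriv ^^ count_list (i # is) j) (f j))" by auto
  ultimately show ?case by (simp add: Cons)
qed simp

lemma
  fixes f :: "'n::finite \<Rightarrow> real \<Rightarrow> real"
  assumes f: "\<And>i. test_function (f i)" and s: "\<And>x. \<bar>s x\<bar> \<le> S"
    and sm: "s \<in> borel_measurable borel"
  shows smooth_conv: "smooth (conv s f)"
    and multi_deriv_conv: "multi_deriv \<alpha> (conv s f) = conv s (tensor_deriv \<alpha> f)"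
proof -
  show "smooth (conv s f)"
    unfolding smooth_def iter_partial_conv[OF f s sm]
  proof (intro allI conjI)
    fix "is" and i x
    let ?g = "\<lambda>i. (deriv ^^ count_list is i) (f i)"
    have g: "\<And>i. test_function (?g i)" by (intro test_function_iter_deriv f)
    show "continuous_on UNIV (conv s ?g)" by (rule continuous_conv[OF g s sm])
    show "(\<lambda>t. conv s ?g (x + t *\<^sub>R axis i 1)) field_differentiable at 0"
      unfolding field_differentiable_def by (rule exI, rule conv_has_partial[OF g s sm])
  qed
  show "multi_deriv \<alpha> (conv s f) = conv s (tensor_deriv \<alpha> f)"
    by (simp add: multi_deriv_mi_list iter_partial_conv[OF f s sm] count_mi_list tensor_deriv_def)
qed

text \<open>The test functions in the definition of weak derivatives.\<close>
definition compact_smooth :: "(real ^ 'n::finite \<Rightarrow> real) \<Rightarrow> bool" where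
  "compact_smooth \<psi> \<longleftrightarrow> smooth \<psi> \<and> compact (closure {x. \<psi> x \<noteq> 0})"

lemma smooth_partial_deriv: "smooth \<psi> \<Longrightarrow> smooth (iter_partial is \<psi>)"
proof -
  have "iter_partial js (iter_partial is \<psi>) = iter_partial (js @ is) \<psi>" for js
    by (induction js) auto
  then show "smooth \<psi> \<Longrightarrow> smooth (iter_partial is \<psi>)" by (auto simp: smooth_def)
qed

lemma smooth_continuous: "smooth \<psi> \<Longrightarrow> continuous_on A \<psi>"
  using continuous_on_subset unfolding smooth_def by (metis iter_partial.simps(1) subset_UNIV)

lemma smooth_has_partial:
  assumes "smooth \<psi>"
  shows "((\<lambda>t. \<psi> (x + t *\<^sub>R axis i 1)) has_real_derivative partial_deriv i \<psi> (x + s *\<^sub>R axis i 1)) (at s)"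
proof -
  have "((\<lambda>t. iter_partial [] \<psi> (x + s *\<^sub>R axis i 1 + t *\<^sub>R axis i 1)) has_real_derivative
      partial_deriv i \<psi> (x + s *\<^sub>R axis i 1)) (at 0)"
    using assms unfolding smooth_def partial_deriv_def
    by (metis DERIV_deriv_iff_field_differentiable iter_partial.simps(1))
  then show ?thesis
    using DERIV_shift[of "\<lambda>t. \<psi> (x + t *\<^sub>R axis i 1)" "partial_deriv i \<psi> (x + s *\<^sub>R axis i 1)" 0 s]
    by (simp add: algebra_simps)
qed

lemma compact_smooth_partial:
  assumes "compact_smooth \<psi>"
  shows "compact_smooth (partial_deriv i \<psi>)"
proof -
  let ?K = "closure {x. \<psi> x \<noteq> 0}"
  have s: "smooth \<psi>" and K: "compact ?K" using assms by (auto simp: compact_smooth_def)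
  have "partial_deriv i \<psi> x = 0" if x: "x \<notin> ?K" for x
  proof -
    have "open ((\<lambda>t. x + t *\<^sub>R axis i 1) -` (- ?K))"
      by (intro open_vimage continuous_intros) auto
    then have "((\<lambda>t. 0) has_real_derivative partial_deriv i \<psi> (x + 0 *\<^sub>R axis i 1)) (at 0)"
      by (rule has_field_derivative_transform_within_open[OF smooth_has_partial[OF s]])
         (use x closure_subset[of "{x. \<psi> x \<noteq> 0}"] in auto)
    then have "partial_deriv i \<psi> (x + 0 *\<^sub>R axis i 1) = 0" using DERIV_unique DERIV_const by blast
    then show ?thesis by simp
  qed
  then have "closure {x. partial_deriv i \<psi> x \<noteq> 0} \<subseteq> ?K"
    by (intro closure_minimal) auto
  then have "compact (closure {x. partial_deriv i \<psi> x \<noteq> 0})"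
    using K by (meson closed_closure compact_Int_closed compact_closure bounded_closure bounded_subset compact_imp_bounded compact_eq_bounded_closed)
  moreover have "smooth (partial_deriv i \<psi>)" using smooth_partial_deriv[OF s, of "[i]"] by simp
  ultimately show ?thesis by (simp add: compact_smooth_def)
qed

lemma compact_smooth_iter_partial: "compact_smooth \<psi> \<Longrightarrow> compact_smooth (iter_partial is \<psi>)"
  by (induction "is") (auto intro: compact_smooth_partial)

lemma compact_smooth_bounds:
  assumes "compact_smooth \<psi>"
  obtains B R where "0 < B" "0 < R" "\<And>x. \<bar>\<psi> x\<bar> \<le> B" "\<And>x. R < norm x \<Longrightarrow> \<psi> x = 0"
proof -
  let ?K = "closure {x. \<psi> x \<noteq> 0}"
  have s: "smooth \<psi>" and K: "compact ?K" using assms by (auto simp: compact_smooth_def)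
  obtain R where R: "0 < R" "\<And>x. x \<in> ?K \<Longrightarrow> norm x \<le> R"
    using compact_imp_bounded[OF K] unfolding bounded_pos by blast
  have "bounded (\<psi> ` ?K)"
    by (intro compact_imp_bounded compact_continuous_image smooth_continuous s K)
  then obtain B where B: "0 < B" "\<And>x. x \<in> ?K \<Longrightarrow> \<bar>\<psi> x\<bar> \<le> B" unfolding bounded_pos by auto
  have out: "\<psi> x = 0" if "x \<notin> ?K" for x using that closure_subset[of "{x. \<psi> x \<noteq> 0}"] by auto
  show ?thesis
  proof (rule that[OF B(1) R(1)])
    show "\<bar>\<psi> x\<bar> \<le> B" for x using B out[of x] by (cases "x \<in> ?K") auto
    show "\<psi> x = 0" if "R < norm x" for x using R(2)[of x] out[of x] that by force
  qed
qed

lemma compact_smooth_measurable: "compact_smooth \<psi> \<Longrightarrow> \<psi> \<in> borel_measurable borel"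
  by (intro borel_measurable_continuous_onI smooth_continuous) (simp add: compact_smooth_def)

lemma integral_translate:
  fixes g :: "real ^ 'n \<Rightarrow> real"
  assumes [measurable]: "g \<in> borel_measurable borel"
  shows "(\<integral>x. g x \<partial>lborel) = (\<integral>x. g (a + x) \<partial>lborel)"
  using integral_distr[of "\<lambda>x. a + x" lborel borel g] by (simp add: lborel_distr_plus)

text \<open>Integration by parts. Translation invariance shows that shifting \<open>\<psi>\<close> or shifting the kernel in
  the direction of coordinate \<open>i\<close> gives the same integral; the two sides are its derivative computed
  in these two ways.\<close>
lemma conv_by_parts_partial:
  fixes f :: "'n::finite \<Rightarrow> real \<Rightarrow> real"
  assumes f: "\<And>i. test_function (f i)" and \<psi>: "compact_smooth \<psi>"
  shows "conv (partial_deriv i \<psi>) f y = conv \<psi> (f(i := deriv (f i))) y"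
proof -
  let ?\<psi>' = "partial_deriv i \<psi>"
  have \<psi>': "compact_smooth ?\<psi>'" by (rule compact_smooth_partial[OF \<psi>])
  note [measurable] = borel_measurable_tensor[OF f] compact_smooth_measurable[OF \<psi>]
    compact_smooth_measurable[OF \<psi>']
  obtain S where S: "\<And>x. \<bar>\<psi> x\<bar> \<le> S" using compact_smooth_bounds[OF \<psi>] by metis
  obtain S' where S': "\<And>x. \<bar>?\<psi>' x\<bar> \<le> S'" using compact_smooth_bounds[OF \<psi>'] by metis
  have "((\<lambda>t. \<integral>x. \<psi> (x + t *\<^sub>R axis i 1) * tensor f (y - x) \<partial>lborel) has_real_derivative
     (\<integral>x. ?\<psi>' (x + 0 *\<^sub>R axis i 1) * tensor f (y - x) \<partial>lborel)) (at 0)"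
  proof (rule has_derivative_integral)
    fix t :: real and x :: "real ^ 'n"
    show "((\<lambda>t. \<psi> (x + t *\<^sub>R axis i 1) * tensor f (y - x)) has_real_derivative
      ?\<psi>' (x + t *\<^sub>R axis i 1) * tensor f (y - x)) (at t)"
      by (intro DERIV_cmult_right smooth_has_partial) (use \<psi> in \<open>simp add: compact_smooth_def\<close>)
    show "\<bar>?\<psi>' (x + t *\<^sub>R axis i 1) * tensor f (y - x)\<bar> \<le> \<bar>S' * tensor f (y - x)\<bar>"
      unfolding abs_mult by (intro mult_right_mono order_trans[OF S' abs_ge_self]) auto
  next
    show "integrable lborel (\<lambda>x. \<bar>S' * tensor f (y - x)\<bar>)"
      by (intro integrable_abs integrable_tensor_diff[OF f, where S = "\<bar>S'\<bar>"]) auto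
    show "integrable lborel (\<lambda>x. \<psi> (x + t *\<^sub>R axis i 1) * tensor f (y - x))" for t
      by (rule integrable_tensor_diff[OF f, where S = S]) (use S in auto)
  qed measurable
  moreover have "(\<integral>x. \<psi> (x + t *\<^sub>R axis i 1) * tensor f (y - x) \<partial>lborel) =
      conv \<psi> f (y + t *\<^sub>R axis i 1)" for t
    unfolding conv_def
    by (subst integral_translate[of "\<lambda>x. \<psi> x * tensor f (y + t *\<^sub>R axis i 1 - x)" "t *\<^sub>R axis i 1"])
       (auto simp: algebra_simps)
  ultimately have "((\<lambda>t. conv \<psi> f (y + t *\<^sub>R axis i 1)) has_real_derivative conv ?\<psi>' f y) (at 0)"
    by (simp add: conv_def)
  moreover have "((\<lambda>t. conv \<psi> f (y + t *\<^sub>R axis i 1)) has_real_derivative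
      conv \<psi> (f(i := deriv (f i))) y) (at 0)"
    by (rule conv_has_partial[OF f S]) measurable
  ultimately show ?thesis by (rule DERIV_unique)
qed

lemma conv_by_parts:
  fixes f :: "'n::finite \<Rightarrow> real \<Rightarrow> real"
  assumes f: "\<And>i. test_function (f i)" and \<psi>: "compact_smooth \<psi>"
  shows "conv (multi_deriv \<alpha> \<psi>) f = conv \<psi> (tensor_deriv \<alpha> f)"
proof -
  have "conv (iter_partial is \<psi>) f = conv \<psi> (\<lambda>i. (deriv ^^ count_list is i) (f i))" for "is"
    using f
  proof (induction "is" arbitrary: f)
    case (Cons i "is")
    have "conv (iter_partial (i # is) \<psi>) f = conv (iter_partial is \<psi>) (f(i := deriv (f i)))"
      using conv_by_parts_partial[OF Cons.prems compact_smooth_iter_partial[OF \<psi>]] by auto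
    also have "\<dots> = conv \<psi> (\<lambda>j. (deriv ^^ count_list is j) ((f(i := deriv (f i))) j))"
      by (rule Cons.IH[OF test_family_upd[OF Cons.prems]])
    also have "(\<lambda>j. (deriv ^^ count_list is j) ((f(i := deriv (f i))) j)) =
        (\<lambda>j. (deriv ^^ count_list (i # is) j) (f j))"
      by (auto simp: funpow_swap1)
    finally show ?case .
  qed simp
  then show ?thesis by (simp add: multi_deriv_mi_list count_mi_list tensor_deriv_def)
qed

text \<open>Fubini for tensor products. Lebesgue measure on \<open>real ^ 'n\<close> is a product over the standard basis,
  which is identified with the index type through \<open>i \<mapsto> axis i 1\<close>.\<close>
lemma integral_tensor:
  fixes f :: "'n::finite \<Rightarrow> real \<Rightarrow> real"
  assumes f: "\<And>i. integrable lborel (f i)"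
  shows "(\<integral>x. tensor f x \<partial>lborel) = (\<Prod>i\<in>UNIV. \<integral>t. f i t \<partial>lborel)"
proof -
  have [measurable]: "f i \<in> borel_measurable borel" for i using f[of i] by auto
  define ix :: "real ^ 'n \<Rightarrow> 'n" where "ix b = (THE i. b = axis i 1)" for b
  have ix: "ix (axis i 1) = i" for i
    unfolding ix_def by (rule the_equality) (auto simp: axis_eq_axis)
  have B: "(Basis :: (real ^ 'n) set) = (\<lambda>i. axis i 1) ` UNIV" by (auto simp: Basis_vec_def)
  have inj: "inj (\<lambda>i. axis i 1 :: real ^ 'n)" by (auto simp: inj_on_def axis_eq_axis)
  have pr: "(\<Prod>b\<in>(Basis :: (real ^ 'n) set). h b) = (\<Prod>i\<in>UNIV. h (axis i 1))" for h :: "real ^ 'n \<Rightarrow> real"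
    unfolding B by (subst prod.reindex[OF inj]) simp
  interpret product_sigma_finite "\<lambda>_ :: real ^ 'n. lborel :: real measure" ..
  have "(\<integral>x. tensor f x \<partial>lborel) =
    (\<integral>g. tensor f (\<Sum>b\<in>Basis. g b *\<^sub>R b) \<partial>(\<Pi>\<^sub>M b\<in>(Basis :: (real ^ 'n) set). lborel))"
    unfolding tensor_def by (subst lborel_eq, subst integral_distr) auto
  also have "\<dots> = (\<integral>g. (\<Prod>b\<in>Basis. f (ix b) (g b)) \<partial>(\<Pi>\<^sub>M b\<in>(Basis :: (real ^ 'n) set). lborel))"
  proof (intro Bochner_Integration.integral_cong refl)
    fix g :: "real ^ 'n \<Rightarrow> real"
    have "(\<Sum>b\<in>Basis. g b *\<^sub>R b) $ i = g (axis i 1)" for i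
    proof -
      have "(\<Sum>b\<in>Basis. g b *\<^sub>R b) $ i = (\<Sum>b\<in>Basis. g b *\<^sub>R b) \<bullet> axis i 1"
        by (simp add: inner_axis)
      also have "\<dots> = g (axis i 1)" by (rule inner_sum_left_Basis) (simp add: B)
      finally show ?thesis .
    qed
    then show "tensor f (\<Sum>b\<in>Basis. g b *\<^sub>R b) = (\<Prod>b\<in>Basis. f (ix b) (g b))"
      by (simp add: tensor_def pr ix)
  qed
  also have "\<dots> = (\<Prod>b\<in>(Basis :: (real ^ 'n) set). \<integral>t. f (ix b) t \<partial>lborel)"
    by (rule product_integral_prod) (use f in auto)
  finally show ?thesis by (simp add: pr ix)
qed

lemma integral_dilated_tensor:
  assumes k: "test_function \<kappa>" "(\<integral>t. \<kappa> t \<partial>lborel) = 1"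
  shows "(\<integral>x. tensor (\<lambda>i. dilate n \<kappa>) (y - x) \<partial>lborel) = 1"
proof -
  have t: "test_function (\<lambda>t. dilate n \<kappa> ((-1) * t + y $ i))" for i
    by (intro test_function_affine test_function_dilate k) auto
  have "(\<integral>t. dilate n \<kappa> ((-1) * t + y $ i) \<partial>lborel) = (\<integral>t. dilate n \<kappa> t \<partial>lborel)" for i
    using lborel_integral_real_affine[of "-1" "dilate n \<kappa>" "y $ i"] by (simp add: add.commute)
  then have *: "(\<integral>t. dilate n \<kappa> ((-1) * t + y $ i) \<partial>lborel) = 1" for i
    using k by (simp add: integral_dilate)
  have "(\<integral>x. tensor (\<lambda>i t. dilate n \<kappa> ((-1) * t + y $ i)) x \<partial>lborel) = 1"
    by (subst integral_tensor[OF test_function_integrable[OF t]]) (simp only: * prod.neutral_const)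
  moreover have "tensor (\<lambda>i t. dilate n \<kappa> ((-1) * t + y $ i)) x = tensor (\<lambda>i. dilate n \<kappa>) (y - x)" for x
    by (simp add: tensor_def algebra_simps)
  ultimately show ?thesis by simp
qed

text \<open>Only the uniform \<open>L\<^sup>1\<close> bound and the shrinking supports are used, since \<open>\<kappa>\<close> may change sign.\<close>
lemma approximate_identity:
  fixes \<psi> :: "real ^ 'n::finite \<Rightarrow> real"
  assumes k: "test_function \<kappa>" "(\<integral>t. \<kappa> t \<partial>lborel) = 1" and \<psi>: "compact_smooth \<psi>"
  shows "\<exists>B. \<forall>n y. \<bar>conv \<psi> (\<lambda>i::'n. dilate n \<kappa>) y\<bar> \<le> B"
    and "(\<lambda>n. conv \<psi> (\<lambda>i::'n. dilate n \<kappa>) y) \<longlonglongrightarrow> \<psi> y"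
proof -
  note [measurable] = compact_smooth_measurable[OF \<psi>]
  obtain S where S: "0 < S" "\<And>x. \<bar>\<psi> x\<bar> \<le> S" using compact_smooth_bounds[OF \<psi>] by metis
  obtain M L where M: "0 < M" "0 < L"
    "\<And>n y. (\<integral>\<^sup>+x. ennreal \<bar>tensor (\<lambda>i::'n. dilate n \<kappa>) (y - x)\<bar> \<partial>lborel) \<le> ennreal M"
    "\<And>n z i. L / 2 ^ n < \<bar>z $ i\<bar> \<Longrightarrow> tensor (\<lambda>i::'n. dilate n \<kappa>) z = 0"
    using dilated_tensor_bounds[of "\<lambda>i::'n. \<kappa>", OF k(1)] by metis
  have d: "\<And>i. test_function (dilate n \<kappa>)" for n by (intro test_function_dilate k)
  note [measurable] = borel_measurable_tensor[OF d]
  have ti: "integrable lborel (\<lambda>x. tensor (\<lambda>i::'n. dilate n \<kappa>) (y - x))" for n y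
    using integrable_tensor_diff[OF d, where s = "\<lambda>_. 1" and S = 1] by simp
  have tM: "(\<integral>x. \<bar>tensor (\<lambda>i::'n. dilate n \<kappa>) (y - x)\<bar> \<partial>lborel) \<le> M" for n y
  proof -
    have "(\<integral>\<^sup>+x. ennreal \<bar>tensor (\<lambda>i::'n. dilate n \<kappa>) (y - x)\<bar> \<partial>lborel) =
       ennreal (\<integral>x. \<bar>tensor (\<lambda>i::'n. dilate n \<kappa>) (y - x)\<bar> \<partial>lborel)"
      by (intro nn_integral_eq_integral integrable_abs ti) auto
    with M(3)[of n y] M(1) show ?thesis by (simp add: ennreal_le_iff)
  qed
  have bound: "\<bar>\<integral>x. s x * tensor (\<lambda>i::'n. dilate n \<kappa>) (y - x) \<partial>lborel\<bar> \<le> c * M"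
    if [measurable]: "s \<in> borel_measurable borel" and c: "0 \<le> c"
      and s: "\<And>x. (\<And>i. \<bar>(y - x) $ i\<bar> \<le> L / 2 ^ n) \<Longrightarrow> \<bar>s x\<bar> \<le> c" for s c n y
  proof -
    have "\<bar>\<integral>x. s x * tensor (\<lambda>i::'n. dilate n \<kappa>) (y - x) \<partial>lborel\<bar> \<le>
        (\<integral>x. c * \<bar>tensor (\<lambda>i::'n. dilate n \<kappa>) (y - x)\<bar> \<partial>lborel)"
      unfolding real_norm_def[symmetric]
    proof (rule order_trans[OF integral_norm_bound integral_mono'])
      fix x
      show "norm (s x * tensor (\<lambda>i::'n. dilate n \<kappa>) (y - x)) \<le> c * norm (tensor (\<lambda>i::'n. dilate n \<kappa>) (y - x))"
      proof (cases "\<forall>i. \<bar>(y - x) $ i\<bar> \<le> L / 2 ^ n")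
        case True
        then show ?thesis using s[of x] by (auto simp: abs_mult intro!: mult_right_mono)
      next
        case False
        then have "tensor (\<lambda>i::'n. dilate n \<kappa>) (y - x) = 0" using M(4)[of n "y - x"] by (meson not_le)
        then show ?thesis by simp
      qed
    qed (use ti c in auto)
    also have "\<dots> \<le> c * M" using tM[of n y] c by (simp add: mult_left_mono)
    finally show ?thesis .
  qed
  have "\<bar>conv \<psi> (\<lambda>i::'n. dilate n \<kappa>) y\<bar> \<le> S * M" for n y
    unfolding conv_def by (rule bound) (use S in auto)
  then show "\<exists>B. \<forall>n y. \<bar>conv \<psi> (\<lambda>i::'n. dilate n \<kappa>) y\<bar> \<le> B" by blast
  show "(\<lambda>n. conv \<psi> (\<lambda>i::'n. dilate n \<kappa>) y) \<longlonglongrightarrow> \<psi> y"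
  proof (rule LIMSEQ_I)
    fix \<epsilon> :: real assume \<epsilon>: "0 < \<epsilon>"
    define \<eta> where "\<eta> = \<epsilon> / (2 * M)"
    have \<eta>: "0 < \<eta>" using \<epsilon> M by (simp add: \<eta>_def)
    have "isCont \<psi> y"
      using smooth_continuous[of \<psi> UNIV] \<psi> by (simp add: compact_smooth_def continuous_on_eq_continuous_at)
    then obtain \<delta> where \<delta>: "0 < \<delta>" "\<And>x. dist x y < \<delta> \<Longrightarrow> dist (\<psi> x) (\<psi> y) < \<eta>"
      using \<eta> unfolding continuous_at_eps_delta by blast
    have "(\<lambda>n. real CARD('n) * L * (1 / 2) ^ n) \<longlonglongrightarrow> real CARD('n) * L * 0"
      by (intro tendsto_mult tendsto_const LIMSEQ_realpow_zero) auto
    then have "\<forall>\<^sub>F n in sequentially. real CARD('n) * L * (1 / 2) ^ n < \<delta>"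
      using \<delta>(1) by (intro order_tendstoD(2)) auto
    then obtain N where N: "\<And>n. N \<le> n \<Longrightarrow> real CARD('n) * L * (1 / 2) ^ n < \<delta>"
      by (auto simp: eventually_sequentially)
    show "\<exists>N. \<forall>n\<ge>N. norm (conv \<psi> (\<lambda>i::'n. dilate n \<kappa>) y - \<psi> y) < \<epsilon>"
    proof (intro exI allI impI)
      fix n assume n: "N \<le> n"
      have pi: "integrable lborel (\<lambda>x. \<psi> x * tensor (\<lambda>i::'n. dilate n \<kappa>) (y - x))"
        by (rule integrable_tensor_diff[OF d]) (use S in auto)
      have "conv \<psi> (\<lambda>i::'n. dilate n \<kappa>) y - \<psi> y =
        (\<integral>x. \<psi> x * tensor (\<lambda>i::'n. dilate n \<kappa>) (y - x) \<partial>lborel) -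
        (\<integral>x. \<psi> y * tensor (\<lambda>i::'n. dilate n \<kappa>) (y - x) \<partial>lborel)"
        by (simp add: conv_def integral_dilated_tensor[OF k])
      also have "\<dots> = (\<integral>x. (\<psi> x - \<psi> y) * tensor (\<lambda>i::'n. dilate n \<kappa>) (y - x) \<partial>lborel)"
        using pi ti by (subst Bochner_Integration.integral_diff[symmetric]) (auto simp: left_diff_distrib)
      finally have "norm (conv \<psi> (\<lambda>i::'n. dilate n \<kappa>) y - \<psi> y) =
        \<bar>\<integral>x. (\<psi> x - \<psi> y) * tensor (\<lambda>i::'n. dilate n \<kappa>) (y - x) \<partial>lborel\<bar>" by simp
      also have "\<dots> \<le> \<eta> * M"
      proof (rule bound)
        fix x assume x: "\<And>i. \<bar>(y - x) $ i\<bar> \<le> L / 2 ^ n"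
        have "dist x y \<le> (\<Sum>i\<in>UNIV. \<bar>(y - x) $ i\<bar>)"
          using norm_le_l1_cart[of "y - x"] by (simp add: dist_norm norm_minus_commute)
        also have "\<dots> \<le> (\<Sum>i\<in>(UNIV::'n set). L / 2 ^ n)" by (intro sum_mono x)
        also have "\<dots> = real CARD('n) * L * (1 / 2) ^ n" by (simp add: power_one_over)
        also have "\<dots> < \<delta>" by (rule N[OF n])
        finally show "\<bar>\<psi> x - \<psi> y\<bar> \<le> \<eta>" using \<delta>(2)[of x] by (simp add: dist_real_def less_imp_le)
      qed (use \<eta> in auto)
      also have "\<dots> < \<epsilon>" using \<epsilon> M by (simp add: \<eta>_def)
      finally show "norm (conv \<psi> (\<lambda>i::'n. dilate n \<kappa>) y - \<psi> y) < \<epsilon>" .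
    qed
  qed
qed

section \<open>Orlicz norms\<close>

text \<open>The elementary properties of Young functions. Strictness of the convexity enters only through
  positivity away from the origin.\<close>
lemma
  assumes "e \<in> young_class"
  shows young_even: "e (- s) = e s"
    and young_nonneg: "0 \<le> e s"
    and young_zero: "e 0 = 0"
    and young_convex: "convex_on UNIV e"
    and young_pos: "s \<noteq> 0 \<Longrightarrow> 0 < e s"
proof -
  have y: "\<And>s. e (- s) = e s" "\<And>s. 0 \<le> e s" "e 0 = 0"
    and conv: "\<And>x y t. x \<noteq> y \<Longrightarrow> 0 < t \<Longrightarrow> t < 1 \<Longrightarrow>
      e ((1 - t) * x + t * y) < (1 - t) * e x + t * e y"
    using assms unfolding young_class_def young_function_def by auto
  show "e (- s) = e s" "0 \<le> e s" "e 0 = 0" by (fact y)+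
  show "convex_on UNIV e"
  proof (rule convex_onI)
    fix t x y :: real assume "0 < t" "t < 1"
    then show "e ((1 - t) *\<^sub>R x + t *\<^sub>R y) \<le> (1 - t) * e x + t * e y"
      using conv[of x y t] by (cases "x = y") (auto simp: algebra_simps)
  qed simp
  show "0 < e s" if "s \<noteq> 0"
  proof -
    have "0 \<le> e ((1 - 1/2) * (- s) + 1/2 * s)" by (rule y)
    also have "\<dots> < (1 - 1/2) * e (- s) + 1/2 * e s"
      by (rule conv) (use that in auto)
    finally show ?thesis by (simp add: y)
  qed
qed

lemma young_continuous: "e \<in> young_class \<Longrightarrow> continuous_on A e"
  using convex_on_continuous[OF open_UNIV young_convex] continuous_on_subset by blast

lemma young_measurable [measurable]: "e \<in> young_class \<Longrightarrow> e \<in> borel_measurable borel"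
  by (intro borel_measurable_continuous_onI young_continuous)

lemma young_abs: "e \<in> young_class \<Longrightarrow> e \<bar>s\<bar> = e s"
  by (auto simp: abs_if young_even)

lemma young_scale_le:
  assumes e: "e \<in> young_class" and "0 \<le> t" "t \<le> 1"
  shows "e (t * s) \<le> t * e s"
  using convex_onD[OF young_convex[OF e], of t 0 s] assms by (simp add: young_zero[OF e])

lemma young_mono:
  assumes e: "e \<in> young_class" and "0 \<le> s" "s \<le> t"
  shows "e s \<le> e t"
proof (cases "t = 0")
  case False
  have "e (s / t * t) \<le> s / t * e t"
    by (rule young_scale_le[OF e]) (use assms False in auto)
  also have "\<dots> \<le> 1 * e t"
    by (rule mult_right_mono) (use assms False young_nonneg[OF e] in auto)
  finally show ?thesis using False by simp
qed (use assms in auto)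

lemma young_abs_mono: "e \<in> young_class \<Longrightarrow> \<bar>s\<bar> \<le> \<bar>t\<bar> \<Longrightarrow> e s \<le> e t"
  using young_mono[of e "\<bar>s\<bar>" "\<bar>t\<bar>"] by (simp add: young_abs)

text \<open>A Young function grows at least linearly. Hence Orlicz functions are locally integrable.\<close>
lemma young_lower_bound:
  assumes e: "e \<in> young_class"
  shows "\<bar>s\<bar> \<le> 1 + e s / e 1"
proof (cases "\<bar>s\<bar> \<le> 1")
  case True
  then show ?thesis using young_nonneg[OF e, of s] young_nonneg[OF e, of 1]
    by (smt (verit) divide_nonneg_nonneg)
next
  case False
  have "e (1 / \<bar>s\<bar> * \<bar>s\<bar>) \<le> 1 / \<bar>s\<bar> * e \<bar>s\<bar>"
    by (rule young_scale_le[OF e]) (use False in auto)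
  moreover have "1 / \<bar>s\<bar> * \<bar>s\<bar> = 1" using False by auto
  ultimately have "e 1 \<le> 1 / \<bar>s\<bar> * e \<bar>s\<bar>" by (simp only:)
  then have "\<bar>s\<bar> \<le> e s / e 1"
    using False young_pos[OF e, of 1] by (simp add: field_simps young_abs[OF e])
  then show ?thesis by simp
qed

lemma
  assumes e: "e \<in> young_class" and R: "0 < R"
  shows young_inv_pos: "0 < young_inv e R"
    and young_inv_le: "e (young_inv e R) \<le> R"
    and young_beta_pos: "0 < young_beta e R"
proof -
  let ?S = "{c. e c \<le> R}"
  have "e (min 1 (R / e 1) * 1) \<le> min 1 (R / e 1) * e 1"
    by (rule young_scale_le[OF e]) (use R young_nonneg[OF e, of 1] in auto)
  also have "\<dots> \<le> R / e 1 * e 1"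
    by (rule mult_right_mono) (use young_nonneg[OF e] in auto)
  also have "\<dots> = R" using young_pos[OF e, of 1] by simp
  finally have m: "min 1 (R / e 1) \<in> ?S" by simp
  have bdd: "bdd_above ?S"
  proof (rule bdd_aboveI)
    fix c assume "c \<in> ?S"
    then have "e c / e 1 \<le> R / e 1" using young_pos[OF e, of 1] by (intro divide_right_mono) auto
    then show "c \<le> 1 + R / e 1" using young_lower_bound[OF e, of c] by linarith
  qed
  have "closed ?S" by (intro closed_Collect_le young_continuous[OF e] continuous_on_const)
  then show "e (young_inv e R) \<le> R"
    unfolding young_inv_def using closed_contains_Sup[OF _ bdd] m by blast
  have "0 < min 1 (R / e 1)" using R young_pos[OF e, of 1] by simp
  also have "\<dots> \<le> young_inv e R" unfolding young_inv_def by (rule cSup_upper[OF m bdd])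
  finally show "0 < young_inv e R" .
  then show "0 < young_beta e R" unfolding young_beta_def using R by simp
qed

lemma orlicz_norm_le:
  "0 < c \<Longrightarrow> (\<integral>\<^sup>+x. ennreal (e (f x / c)) \<partial>lborel) \<le> 1 \<Longrightarrow> orlicz_norm e f \<le> ennreal c"
  unfolding orlicz_norm_def by (rule Inf_lower) auto

text \<open>Every constant above the norm is admissible in its definition.\<close>
lemma orlicz_normD:
  assumes e: "e \<in> young_class" and lt: "orlicz_norm e f < ennreal c"
  shows "0 < c" "(\<integral>\<^sup>+x. ennreal (e (f x / c)) \<partial>lborel) \<le> 1"
proof -
  obtain c' where c': "c' > 0" "(\<integral>\<^sup>+x. ennreal (e (f x / c')) \<partial>lborel) \<le> 1" "ennreal c' < ennreal c"
    using lt unfolding orlicz_norm_def Inf_less_iff by blast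
  then have "c' < c" by (simp add: ennreal_less_iff)
  then show "0 < c" using c' by simp
  have "(\<integral>\<^sup>+x. ennreal (e (f x / c)) \<partial>lborel) \<le> (\<integral>\<^sup>+x. ennreal (e (f x / c')) \<partial>lborel)"
    using \<open>c' < c\<close> \<open>0 < c'\<close>
    by (intro nn_integral_mono ennreal_leI young_abs_mono[OF e])
       (auto simp: abs_divide intro!: divide_left_mono)
  then show "(\<integral>\<^sup>+x. ennreal (e (f x / c)) \<partial>lborel) \<le> 1" using c' by simp
qed

lemma le_orlicz_normI:
  assumes "\<And>c. 0 < c \<Longrightarrow> (\<integral>\<^sup>+x. ennreal (e (f x / c)) \<partial>lborel) \<le> 1 \<Longrightarrow> X \<le> ennreal (k * c)"
    and k: "0 < k"
  shows "X \<le> ennreal k * orlicz_norm e f"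
proof -
  have "ennreal (1 / k) * X \<le> orlicz_norm e f"
    unfolding orlicz_norm_def
  proof (rule Inf_greatest, safe)
    fix c :: real assume c: "0 < c" "(\<integral>\<^sup>+x. ennreal (e (f x / c)) \<partial>lborel) \<le> 1"
    have "ennreal (1 / k) * X \<le> ennreal (1 / k) * ennreal (k * c)"
      by (intro mult_left_mono assms(1) c) auto
    also have "\<dots> = ennreal c" using k c by (simp add: ennreal_mult[symmetric])
    finally show "ennreal (1 / k) * X \<le> ennreal c" .
  qed
  then have "ennreal k * (ennreal (1 / k) * X) \<le> ennreal k * orlicz_norm e f"
    by (intro mult_left_mono) auto
  also have "ennreal k * (ennreal (1 / k) * X) = X"
    using k by (simp add: mult.assoc[symmetric] ennreal_mult[symmetric])
  finally show ?thesis .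
qed

lemma orlicz_norm_mono_AE:
  assumes e: "e \<in> young_class" and "AE x in lborel. \<bar>f x\<bar> \<le> \<bar>g x\<bar>"
  shows "orlicz_norm e f \<le> orlicz_norm e g"
proof -
  have "orlicz_norm e f \<le> ennreal 1 * orlicz_norm e g"
  proof (rule le_orlicz_normI)
    fix c :: real assume c: "0 < c" "(\<integral>\<^sup>+x. ennreal (e (g x / c)) \<partial>lborel) \<le> 1"
    have "(\<integral>\<^sup>+x. ennreal (e (f x / c)) \<partial>lborel) \<le> (\<integral>\<^sup>+x. ennreal (e (g x / c)) \<partial>lborel)"
      using assms(2)
      by (intro nn_integral_mono_AE, eventually_elim)
         (use c in \<open>auto intro!: ennreal_leI young_abs_mono[OF e] divide_right_mono simp: abs_divide\<close>)
    then have "orlicz_norm e f \<le> ennreal c" by (intro orlicz_norm_le) (use c in auto)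
    then show "orlicz_norm e f \<le> ennreal (1 * c)" by simp
  qed simp
  then show ?thesis by simp
qed

lemma orlicz_norm_cong_AE:
  "e \<in> young_class \<Longrightarrow> AE x in lborel. f x = g x \<Longrightarrow> orlicz_norm e f = orlicz_norm e g"
  by (intro antisym orlicz_norm_mono_AE) auto

lemma orlicz_norm_cmult:
  assumes e: "e \<in> young_class" and a: "0 < a"
  shows "orlicz_norm e (\<lambda>x. a * f x) \<le> ennreal a * orlicz_norm e f"
proof (rule le_orlicz_normI[OF _ a])
  fix c :: real assume c: "0 < c" "(\<integral>\<^sup>+x. ennreal (e (f x / c)) \<partial>lborel) \<le> 1"
  show "orlicz_norm e (\<lambda>x. a * f x) \<le> ennreal (a * c)"
    by (rule orlicz_norm_le) (use a c in auto)
qed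

text \<open>The Orlicz norm is countably subadditive, and a series that converges absolutely in norm
  converges absolutely almost everywhere. Both follow from convexity: if \<open>c n\<close> is admissible for \<open>h n\<close>
  and \<open>d\<close> is the sum of all \<open>c n\<close>, then \<open>(\<Sum>n. \<bar>h n\<bar>) / d\<close> is a convex combination of the functions
  \<open>\<bar>h n\<bar> / c n\<close>, so \<open>d\<close> is admissible for the sum.\<close>
lemma orlicz_norm_suminf:
  fixes h :: "nat \<Rightarrow> real ^ 'n \<Rightarrow> real"
  assumes e: "e \<in> young_class" and h [measurable]: "\<And>n. h n \<in> borel_measurable borel"
    and fin: "(\<Sum>n. orlicz_norm e (h n)) < top"
  shows "AE x in lborel. summable (\<lambda>n. \<bar>h n x\<bar>)"
    and "orlicz_norm e (\<lambda>x. \<Sum>n. \<bar>h n x\<bar>) \<le> (\<Sum>n. orlicz_norm e (h n))"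
proof -
  note [measurable] = young_measurable[OF e]
  define b where "b n = enn2real (orlicz_norm e (h n))" for n
  have "orlicz_norm e (h n) < top" for n using ennreal_suminf_lessD[OF fin] .
  then have b: "orlicz_norm e (h n) = ennreal (b n)" "0 \<le> b n" for n
    by (auto simp: b_def)
  have "summable b" using fin b by (auto intro!: summable_suminf_not_top)
  then have sb: "(\<Sum>n. orlicz_norm e (h n)) = ennreal (suminf b)"
    using b by (simp add: suminf_ennreal2)
  define S where "S N x = (\<Sum>n<N. \<bar>h n x\<bar>)" for N x
  have key: "AE x in lborel. \<exists>B. \<forall>N. e (S N x / (suminf b + \<epsilon>)) \<le> B"
    "(\<integral>\<^sup>+x. (SUP N. ennreal (e (S N x / (suminf b + \<epsilon>)))) \<partial>lborel) \<le> 1"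
    if \<epsilon>: "0 < \<epsilon>" for \<epsilon>
  proof -
    \<comment> \<open>constants slightly above the norms, so that they are admissible, with total excess \<open>\<epsilon>\<close>\<close>
    define c where "c n = b n + \<epsilon> * (1 / 2) ^ Suc n" for n
    have "(\<lambda>n. \<epsilon> * (1 / 2) ^ Suc n) sums (\<epsilon> * 1)"
      by (intro sums_mult power_half_series)
    with \<open>summable b\<close> have csums: "c sums (suminf b + \<epsilon>)"
      unfolding c_def by (auto intro!: sums_add)
    have cpos: "0 < c n" for n using b(2)[of n] \<epsilon> by (simp add: c_def add_nonneg_pos)
    define d where "d = suminf b + \<epsilon>"
    have csum: "(\<Sum>n<N. c n) \<le> d" for N
      using sum_le_suminf[OF sums_summable[OF csums], of "{..<N}"] cpos sums_unique[OF csums]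
      by (auto simp: d_def less_imp_le)
    have d: "0 < d" using csum[of 1] cpos[of 0] by simp
    have c: "(\<integral>\<^sup>+x. ennreal (e (h n x / c n)) \<partial>lborel) \<le> 1" for n
      by (rule orlicz_normD[OF e]) (use b \<epsilon> in \<open>auto simp: c_def ennreal_less_iff\<close>)
    have conv: "e (S N x / d) \<le> (\<Sum>n<N. c n / d * e (h n x / c n))" for N x
    proof -
      \<comment> \<open>the missing weight is put on the point \<open>0\<close>, where \<open>e\<close> vanishes\<close>
      define a where "a n = (if n = N then 1 - (\<Sum>n<N. c n) / d else c n / d)" for n
      define y where "y n = (if n = N then 0 else \<bar>h n x\<bar> / c n)" for n
      have "e (\<Sum>n\<in>{..N}. a n *\<^sub>R y n) \<le> (\<Sum>n\<in>{..N}. a n * e (y n))"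
      proof (rule convex_on_sum[OF _ _ young_convex[OF e]])
        show "(\<Sum>n\<le>N. a n) = 1"
          by (simp add: a_def lessThan_Suc_atMost[symmetric] sum_divide_distrib)
        show "0 \<le> a n" for n
          using csum[of N] d cpos[of n] by (simp add: a_def field_simps)
      qed auto
      also have "(\<Sum>n\<in>{..N}. a n *\<^sub>R y n) = S N x / d"
        using cpos by (simp add: a_def y_def S_def lessThan_Suc_atMost[symmetric] sum_divide_distrib less_imp_neq[symmetric])
      also have "(\<Sum>n\<in>{..N}. a n * e (y n)) = (\<Sum>n<N. c n / d * e (h n x / c n))"
      proof -
        have "e (\<bar>h n x\<bar> / c n) = e (h n x / c n)" for n
          using young_abs[OF e, of "h n x / c n"] cpos[of n] by (simp add: abs_divide)
        then show ?thesis
          by (simp add: a_def y_def young_zero[OF e] lessThan_Suc_atMost[symmetric])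
      qed
      finally show ?thesis .
    qed
    have le1: "(\<integral>\<^sup>+x. ennreal (e (S N x / d)) \<partial>lborel) \<le> 1" for N
    proof -
      have "(\<integral>\<^sup>+x. ennreal (e (S N x / d)) \<partial>lborel) \<le>
        (\<integral>\<^sup>+x. (\<Sum>n<N. ennreal (c n / d) * ennreal (e (h n x / c n))) \<partial>lborel)"
      proof (intro nn_integral_mono)
        fix x
        have "ennreal (e (S N x / d)) \<le> ennreal (\<Sum>n<N. c n / d * e (h n x / c n))"
          by (intro ennreal_leI conv)
        also have "\<dots> = (\<Sum>n<N. ennreal (c n / d) * ennreal (e (h n x / c n)))"
        proof -
          have nn: "0 \<le> c n / d" for n using cpos[of n] d by simp
          show ?thesis
            unfolding ennreal_mult[OF nn young_nonneg[OF e], symmetric]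
            by (rule sum_ennreal[symmetric]) (intro mult_nonneg_nonneg nn young_nonneg[OF e])
        qed
        finally show "ennreal (e (S N x / d)) \<le> \<dots>" .
      qed
      also have "\<dots> = (\<Sum>n<N. ennreal (c n / d) * (\<integral>\<^sup>+x. ennreal (e (h n x / c n)) \<partial>lborel))"
        by (subst nn_integral_sum) (auto simp: nn_integral_cmult)
      also have "\<dots> \<le> (\<Sum>n<N. ennreal (c n / d) * 1)"
        by (intro sum_mono mult_left_mono c) auto
      also have "\<dots> = ennreal ((\<Sum>n<N. c n) / d)"
        using cpos d by (simp add: sum_ennreal less_imp_le sum_divide_distrib)
      also have "\<dots> \<le> 1" using csum[of N] d by (simp add: ennreal_le_1)
      finally show ?thesis .
    qed
    have S0: "0 \<le> S N x" for N x by (simp add: S_def sum_nonneg)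
    have "incseq (\<lambda>N x. ennreal (e (S N x / d)))"
      using S0 d by (auto intro!: incseq_SucI le_funI ennreal_leI young_mono[OF e] divide_right_mono
          simp: S_def)
    moreover have [measurable]: "S N \<in> borel_measurable borel" for N unfolding S_def[abs_def] by measurable
    ultimately have "(\<integral>\<^sup>+x. (SUP N. ennreal (e (S N x / d))) \<partial>lborel) =
        (SUP N. (\<integral>\<^sup>+x. ennreal (e (S N x / d)) \<partial>lborel))"
      by (intro nn_integral_monotone_convergence_SUP) auto
    then show le: "(\<integral>\<^sup>+x. (SUP N. ennreal (e (S N x / (suminf b + \<epsilon>)))) \<partial>lborel) \<le> 1"
      unfolding d_def using le1 by (simp add: SUP_le_iff d_def)
    then have "AE x in lborel. (SUP N. ennreal (e (S N x / d))) \<noteq> \<infinity>"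
      unfolding d_def[symmetric] by (intro nn_integral_PInf_AE) (auto simp: top_unique)
    then show "AE x in lborel. \<exists>B. \<forall>N. e (S N x / (suminf b + \<epsilon>)) \<le> B"
    proof eventually_elim
      case (elim x)
      have "e (S N x / d) \<le> enn2real (SUP N. ennreal (e (S N x / d)))" for N
      proof -
        have "ennreal (e (S N x / d)) \<le> (SUP N. ennreal (e (S N x / d)))" by (rule SUP_upper) simp
        also have "\<dots> = ennreal (enn2real (SUP N. ennreal (e (S N x / d))))"
          using elim unfolding infinity_ennreal_def less_top by (rule ennreal_enn2real[symmetric])
        finally show ?thesis by (rule ennreal_le_iff[THEN iffD1, rotated]) simp
      qed
      then show ?case unfolding d_def by blast
    qed
  qed
  show summ: "AE x in lborel. summable (\<lambda>n. \<bar>h n x\<bar>)"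
    using key(1)[OF zero_less_one]
  proof eventually_elim
    case (elim x)
    then obtain B where B: "\<And>N. e (S N x / (suminf b + 1)) \<le> B" by blast
    have d: "0 < suminf b + 1" using suminf_nonneg[OF \<open>summable b\<close>] b by (simp add: add_nonneg_pos)
    have "(\<Sum>n<N. \<bar>h n x\<bar>) \<le> (1 + B / e 1) * (suminf b + 1)" for N
    proof -
      have "S N x / (suminf b + 1) \<le> 1 + e (S N x / (suminf b + 1)) / e 1"
        using young_lower_bound[OF e, of "S N x / (suminf b + 1)"] by linarith
      also have "\<dots> \<le> 1 + B / e 1"
        using B[of N] young_pos[OF e, of 1] by (intro add_left_mono divide_right_mono) auto
      finally show ?thesis using d by (simp add: field_simps S_def)
    qed
    then show ?case by (intro summableI_nonneg_bounded) auto
  qed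
  show "orlicz_norm e (\<lambda>x. \<Sum>n. \<bar>h n x\<bar>) \<le> (\<Sum>n. orlicz_norm e (h n))"
    unfolding sb
  proof (rule ennreal_le_epsilon)
    fix \<epsilon> :: real assume \<epsilon>: "0 < \<epsilon>"
    have s0: "0 \<le> suminf b" using suminf_nonneg[OF \<open>summable b\<close>] b by simp
    have "orlicz_norm e (\<lambda>x. \<Sum>n. \<bar>h n x\<bar>) \<le> ennreal (suminf b + \<epsilon>)"
    proof (rule orlicz_norm_le)
      have "(\<integral>\<^sup>+x. ennreal (e ((\<Sum>n. \<bar>h n x\<bar>) / (suminf b + \<epsilon>))) \<partial>lborel) \<le>
        (\<integral>\<^sup>+x. (SUP N. ennreal (e (S N x / (suminf b + \<epsilon>)))) \<partial>lborel)"
        using summ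
      proof (intro nn_integral_mono_AE, eventually_elim)
        case (elim x)
        have lim: "(\<lambda>N. e (S N x / (suminf b + \<epsilon>))) \<longlonglongrightarrow> e ((\<Sum>n. \<bar>h n x\<bar>) / (suminf b + \<epsilon>))"
          unfolding S_def using s0 \<epsilon>
          by (intro continuous_on_tendsto_compose[OF young_continuous[OF e, of UNIV]]
              tendsto_divide summable_LIMSEQ elim tendsto_const) auto
        show ?case
          by (rule LIMSEQ_le_const2[OF tendsto_ennrealI[OF lim]]) (intro exI[of _ 0] allI impI SUP_upper UNIV_I)
      qed
      also have "\<dots> \<le> 1" by (rule key(2)[OF \<epsilon>])
      finally show "(\<integral>\<^sup>+x. ennreal (e ((\<Sum>n. \<bar>h n x\<bar>) / (suminf b + \<epsilon>))) \<partial>lborel) \<le> 1" .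
    qed (use s0 \<epsilon> in auto)
    then show "orlicz_norm e (\<lambda>x. \<Sum>n. \<bar>h n x\<bar>) \<le> ennreal (suminf b) + ennreal \<epsilon>"
      using s0 \<epsilon> by simp
  qed
qed

lemma orlicz_norm_sum:
  fixes h :: "nat \<Rightarrow> real ^ 'n \<Rightarrow> real"
  assumes e: "e \<in> young_class" and h [measurable]: "\<And>n. n < N \<Longrightarrow> h n \<in> borel_measurable borel"
  shows "orlicz_norm e (\<lambda>x. \<Sum>n<N. h n x) \<le> (\<Sum>n<N. orlicz_norm e (h n))"
proof (cases "(\<Sum>n<N. orlicz_norm e (h n)) < top")
  case True
  define g where "g n = (if n < N then h n else (\<lambda>x. 0))" for n
  have z: "orlicz_norm e (\<lambda>x::real ^ 'n. 0) = 0"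
  proof -
    have "orlicz_norm e (\<lambda>x::real ^ 'n. 0) \<le> 0 + ennreal c" if "0 < c" for c
      using orlicz_norm_le[OF that, of e "\<lambda>x::real ^ 'n. 0"] young_zero[OF e] by simp
    then have "orlicz_norm e (\<lambda>x::real ^ 'n. 0) \<le> 0" by (rule ennreal_le_epsilon)
    then show ?thesis by simp
  qed
  have s: "(\<Sum>n. orlicz_norm e (g n)) = (\<Sum>n<N. orlicz_norm e (h n))"
  proof -
    have "(\<Sum>n. orlicz_norm e (g n)) = (\<Sum>n<N. orlicz_norm e (g n))"
      by (rule suminf_finite) (auto simp: g_def z)
    then show ?thesis by (simp add: g_def)
  qed
  have gm: "g n \<in> borel_measurable borel" for n unfolding g_def using h by auto
  have "orlicz_norm e (\<lambda>x. \<Sum>n<N. h n x) \<le> orlicz_norm e (\<lambda>x. \<Sum>n. \<bar>g n x\<bar>)"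
  proof (intro orlicz_norm_mono_AE[OF e] AE_I2)
    fix x
    have "(\<Sum>n. \<bar>g n x\<bar>) = (\<Sum>n<N. \<bar>g n x\<bar>)" by (rule suminf_finite) (auto simp: g_def)
    then have "(\<Sum>n. \<bar>g n x\<bar>) = (\<Sum>n<N. \<bar>h n x\<bar>)" by (simp add: g_def)
    then show "\<bar>\<Sum>n<N. h n x\<bar> \<le> \<bar>\<Sum>n. \<bar>g n x\<bar>\<bar>" by (simp add: sum_nonneg)
  qed
  also have "\<dots> \<le> (\<Sum>n. orlicz_norm e (g n))"
    by (rule orlicz_norm_suminf(2)[OF e gm]) (use True s in auto)
  finally show ?thesis using s by simp
next
  case False
  then have "(\<Sum>n<N. orlicz_norm e (h n)) = top" using less_top by blast
  then show ?thesis by (simp only: top_greatest)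
qed

lemma orlicz_norm_add:
  fixes f g :: "real ^ 'n \<Rightarrow> real"
  assumes e: "e \<in> young_class" and "f \<in> borel_measurable borel" "g \<in> borel_measurable borel"
  shows "orlicz_norm e (\<lambda>x. f x + g x) \<le> orlicz_norm e f + orlicz_norm e g"
  using orlicz_norm_sum[OF e, of 2 "\<lambda>n. if n = 0 then f else g"] assms
  by (simp add: numeral_2_eq_2)

lemma orlicz_integrable_compact:
  fixes f :: "real ^ 'n \<Rightarrow> real"
  assumes e: "e \<in> young_class" and f [measurable]: "f \<in> borel_measurable borel"
    and fin: "orlicz_norm e f < top" and K: "compact K"
  shows "set_integrable lborel K f"
proof -
  note [measurable] = young_measurable[OF e]
  have [measurable]: "K \<in> sets borel" using K by (intro borel_closed compact_imp_closed)
  obtain c where c: "orlicz_norm e f < ennreal c"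
    using ennreal_Ex_less_of_nat[OF fin] by (auto simp: ennreal_of_nat_eq_real_of_nat)
  note c = orlicz_normD[OF e c]
  have Kf: "emeasure lborel K < top" using emeasure_bounded_finite[OF compact_imp_bounded[OF K]] by simp
  have "(\<integral>\<^sup>+x. ennreal (norm (indicator K x *\<^sub>R f x)) \<partial>lborel) \<le>
     (\<integral>\<^sup>+x. ennreal c * indicator K x + ennreal (c / e 1) * ennreal (e (f x / c)) \<partial>lborel)"
  proof (intro nn_integral_mono)
    fix x
    have "\<bar>f x / c\<bar> \<le> 1 + e (f x / c) / e 1" by (rule young_lower_bound[OF e])
    then have "\<bar>f x\<bar> \<le> c + c / e 1 * e (f x / c)"
      using c by (simp add: abs_divide field_simps)
    then have "ennreal \<bar>f x\<bar> \<le> ennreal (c + c / e 1 * e (f x / c))" by (rule ennreal_leI)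
    also have "\<dots> = ennreal c + ennreal (c / e 1) * ennreal (e (f x / c))"
    proof -
      have nn: "0 \<le> c / e 1" using c young_nonneg[OF e, of 1] by simp
      show ?thesis
        unfolding ennreal_mult[OF nn young_nonneg[OF e], symmetric]
        by (rule ennreal_plus) (use c nn young_nonneg[OF e] in \<open>auto intro: mult_nonneg_nonneg\<close>)
    qed
    finally show "ennreal (norm (indicator K x *\<^sub>R f x)) \<le>
       ennreal c * indicator K x + ennreal (c / e 1) * ennreal (e (f x / c))"
      by (auto simp: indicator_def)
  qed
  also have "\<dots> = ennreal c * emeasure lborel K +
      ennreal (c / e 1) * (\<integral>\<^sup>+x. ennreal (e (f x / c)) \<partial>lborel)"
    by (simp add: nn_integral_add nn_integral_cmult)
  also have "\<dots> \<le> ennreal c * emeasure lborel K + ennreal (c / e 1) * 1"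
    by (intro add_left_mono mult_left_mono c) auto
  also have "\<dots> < top" using Kf by (simp add: ennreal_mult_less_top)
  finally show ?thesis unfolding set_integrable_def by (intro integrableI_bounded) auto
qed

text \<open>Interpolation between \<open>L\<^sup>1\<close> and \<open>L\<^sup>\<infinity>\<close>. With \<open>c = A \<beta>\<^sub>e(R)\<close> and \<open>y = e\<^sup>-\<^sup>1(R)\<close> one has
  \<open>\<bar>g\<bar> / c \<le> y\<close>, so convexity gives \<open>e (g / c) \<le> (\<bar>g\<bar> / (c y)) e y \<le> \<bar>g\<bar> / A\<close>.\<close>
lemma orlicz_norm_interpolation:
  fixes g :: "real ^ 'n \<Rightarrow> real"
  assumes e: "e \<in> young_class" and g [measurable]: "g \<in> borel_measurable borel"
    and A: "0 < A" and R: "0 < R"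
    and L1: "(\<integral>\<^sup>+x. ennreal \<bar>g x\<bar> \<partial>lborel) \<le> ennreal A" and Linf: "\<And>x. \<bar>g x\<bar> \<le> A * R"
  shows "orlicz_norm e g \<le> ennreal (A * young_beta e R)"
proof (rule orlicz_norm_le)
  define y where "y = young_inv e R"
  have y: "0 < y" "e y \<le> R" unfolding y_def using young_inv_pos[OF e R] young_inv_le[OF e R] by auto
  define c where "c = A * young_beta e R"
  have c: "c = A * R / y" by (simp add: c_def young_beta_def y_def)
  have c0: "0 < c" using c A R y by simp
  then show "0 < A * young_beta e R" by (simp add: c_def)
  have "e (g x / c) \<le> (1 / A) * \<bar>g x\<bar>" for x
  proof -
    have "e (g x / c) = e ((\<bar>g x\<bar> / c / y) * y)"
      using young_abs[OF e, of "g x / c"] c0 y by (simp add: abs_divide)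
    also have "\<dots> \<le> (\<bar>g x\<bar> / c / y) * e y"
      using Linf[of x] c0 y A R by (intro young_scale_le[OF e]) (auto simp: c field_simps)
    also have "\<dots> \<le> (\<bar>g x\<bar> / c / y) * R"
      using y c0 by (intro mult_left_mono) auto
    also have "\<dots> = (1 / A) * \<bar>g x\<bar>" using c y A R by simp
    finally show ?thesis .
  qed
  then have "(\<integral>\<^sup>+x. ennreal (e (g x / c)) \<partial>lborel) \<le> (\<integral>\<^sup>+x. ennreal ((1 / A) * \<bar>g x\<bar>) \<partial>lborel)"
    by (intro nn_integral_mono ennreal_leI)
  also have "\<dots> = ennreal (1 / A) * (\<integral>\<^sup>+x. ennreal \<bar>g x\<bar> \<partial>lborel)"
    using A by (subst ennreal_mult) (auto simp: nn_integral_cmult)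
  also have "\<dots> \<le> ennreal (1 / A) * ennreal A" by (intro mult_left_mono L1) auto
  also have "\<dots> = 1" using A by (simp add: ennreal_mult[symmetric])
  finally show "(\<integral>\<^sup>+x. ennreal (e (g x / (A * young_beta e R))) \<partial>lborel) \<le> 1"
    by (simp add: c_def)
qed

text \<open>Jensen's inequality for a density of total mass at most one, proved with a supporting line of
  \<open>e\<close> at the mean; the missing mass is harmless because \<open>e 0 = 0\<close>.\<close>
lemma young_jensen_subprobability:
  assumes e: "e \<in> young_class" and k: "integrable M k" "\<And>y. 0 \<le> k y" "(\<integral>y. k y \<partial>M) \<le> 1"
    and u [measurable]: "u \<in> borel_measurable M" and ku: "integrable M (\<lambda>y. k y * u y)"
  shows "ennreal (e (\<integral>y. k y * u y \<partial>M)) \<le> (\<integral>\<^sup>+y. ennreal (k y * e (u y)) \<partial>M)"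
proof -
  note [measurable] = young_measurable[OF e]
  have [measurable]: "k \<in> borel_measurable M" using k by auto
  define s where "s = (\<integral>y. k y * u y \<partial>M)"
  define a where "a = Inf ((\<lambda>t. (e s - e t) / (s - t)) ` ({s<..} \<inter> UNIV))"
  have slope: "e t \<ge> e s + a * (t - s)" for t
    unfolding a_def by (rule convex_le_Inf_differential[OF young_convex[OF e]]) auto
  define m where "m = (\<integral>y. k y \<partial>M)"
  have m: "0 \<le> m" "m \<le> 1" unfolding m_def using k by (auto intro: Bochner_Integration.integral_nonneg)
  define F where "F y = k y * (e s - a * s) + a * (k y * u y)" for y
  have Fint: "integrable M F" unfolding F_def using k ku by auto
  have Fle: "F y \<le> k y * e (u y)" for y
    using mult_left_mono[OF slope[of "u y"] k(2)[of y]] by (simp add: F_def algebra_simps)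
  have "e s \<le> a * s" using slope[of 0] young_zero[OF e] by simp
  then have "e s \<le> m * (e s - a * s) + a * s"
    using mult_right_mono_neg[of m 1 "e s - a * s"] m by simp
  also have "\<dots> = (\<integral>y. F y \<partial>M)"
    unfolding F_def m_def s_def using k ku by simp
  also have "\<dots> \<le> (\<integral>y. max 0 (F y) \<partial>M)"
    using Fint by (intro integral_mono) auto
  finally have "ennreal (e s) \<le> ennreal (\<integral>y. max 0 (F y) \<partial>M)" by (rule ennreal_leI)
  also have "\<dots> = (\<integral>\<^sup>+y. ennreal (max 0 (F y)) \<partial>M)"
    using Fint by (intro nn_integral_eq_integral[symmetric]) auto
  also have "\<dots> \<le> (\<integral>\<^sup>+y. ennreal (k y * e (u y)) \<partial>M)"
    using Fle k young_nonneg[OF e] by (intro nn_integral_mono ennreal_leI) auto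
  finally show ?thesis unfolding s_def .
qed

text \<open>Schur's test: an integral operator whose kernel has uniformly bounded rows and columns in \<open>L\<^sup>1\<close> is
  bounded on Orlicz spaces.\<close>
lemma orlicz_norm_schur:
  fixes v :: "real ^ 'n \<Rightarrow> real" and K :: "real ^ 'n \<Rightarrow> real ^ 'n \<Rightarrow> real"
  assumes e: "e \<in> young_class" and v [measurable]: "v \<in> borel_measurable borel"
    and K [measurable]: "(\<lambda>(x, y). K x y) \<in> borel_measurable (borel \<Otimes>\<^sub>M borel)"
    and M: "0 < M"
    and row: "\<And>x. (\<integral>\<^sup>+y. ennreal \<bar>K x y\<bar> \<partial>lborel) \<le> ennreal M"
    and col: "\<And>y. (\<integral>\<^sup>+x. ennreal \<bar>K x y\<bar> \<partial>lborel) \<le> ennreal M"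
    and int: "\<And>x. integrable lborel (\<lambda>y. K x y * v y)"
  shows "orlicz_norm e (\<lambda>x. \<integral>y. K x y * v y \<partial>lborel) \<le> ennreal M * orlicz_norm e v"
proof (rule le_orlicz_normI[OF _ M])
  note [measurable] = young_measurable[OF e]
  fix c :: real assume c: "0 < c" "(\<integral>\<^sup>+x. ennreal (e (v x / c)) \<partial>lborel) \<le> 1"
  have [measurable]: "K x \<in> borel_measurable borel" for x
    using measurable_compose[OF measurable_Pair1'[of x borel borel] K] by simp
  show "orlicz_norm e (\<lambda>x. \<integral>y. K x y * v y \<partial>lborel) \<le> ennreal (M * c)"
  proof (rule orlicz_norm_le)
    have pt: "ennreal (e ((\<integral>y. K x y * v y \<partial>lborel) / (M * c))) \<le>
       (\<integral>\<^sup>+y. ennreal (\<bar>K x y\<bar> / M * e (v y / c)) \<partial>lborel)" for x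
    proof -
      have Ki: "integrable lborel (K x)"
        using row[of x] by (intro integrableI_bounded) (auto simp: le_less_trans)
      have "(\<integral>\<^sup>+y. ennreal \<bar>K x y\<bar> \<partial>lborel) = ennreal (\<integral>y. \<bar>K x y\<bar> \<partial>lborel)"
        using Ki by (intro nn_integral_eq_integral) auto
      then have KM: "(\<integral>y. \<bar>K x y\<bar> \<partial>lborel) \<le> M"
        using row[of x] M by (simp add: ennreal_le_iff)
      have eq: "\<bar>K x y\<bar> / M * \<bar>v y / c\<bar> = \<bar>K x y * v y\<bar> / (M * c)" for y
        using c M by (simp add: abs_mult abs_divide)
      have "\<bar>(\<integral>y. K x y * v y \<partial>lborel)\<bar> \<le> (\<integral>y. \<bar>K x y * v y\<bar> \<partial>lborel)"
        by (rule integral_abs_bound)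
      then have "e ((\<integral>y. K x y * v y \<partial>lborel) / (M * c)) \<le> e (\<integral>y. \<bar>K x y\<bar> / M * \<bar>v y / c\<bar> \<partial>lborel)"
        unfolding eq using c M
        by (intro young_abs_mono[OF e]) (auto simp: abs_divide abs_mult divide_right_mono)
      then have "ennreal (e ((\<integral>y. K x y * v y \<partial>lborel) / (M * c))) \<le>
         ennreal (e (\<integral>y. \<bar>K x y\<bar> / M * \<bar>v y / c\<bar> \<partial>lborel))" by (rule ennreal_leI)
      also have "\<dots> \<le> (\<integral>\<^sup>+y. ennreal (\<bar>K x y\<bar> / M * e \<bar>v y / c\<bar>) \<partial>lborel)"
      proof (rule young_jensen_subprobability[OF e])
        show "integrable lborel (\<lambda>y. \<bar>K x y\<bar> / M * \<bar>v y / c\<bar>)"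
          unfolding eq using int[of x] by auto
      qed (use Ki KM M in auto)
      finally show ?thesis by (simp only: young_abs[OF e])
    qed
    have "(\<integral>\<^sup>+x. ennreal (e ((\<integral>y. K x y * v y \<partial>lborel) / (M * c))) \<partial>lborel) \<le>
       (\<integral>\<^sup>+x. \<integral>\<^sup>+y. ennreal (\<bar>K x y\<bar> / M * e (v y / c)) \<partial>lborel \<partial>lborel)"
      by (intro nn_integral_mono pt)
    also have "\<dots> = (\<integral>\<^sup>+y. \<integral>\<^sup>+x. ennreal (\<bar>K x y\<bar> / M * e (v y / c)) \<partial>lborel \<partial>lborel)"
      by (rule lborel_pair.Fubini') measurable
    also have "\<dots> = (\<integral>\<^sup>+y. (\<integral>\<^sup>+x. ennreal \<bar>K x y\<bar> \<partial>lborel) * ennreal (e (v y / c) / M) \<partial>lborel)"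
    proof (intro nn_integral_cong)
      fix y
      have [measurable]: "(\<lambda>x. K x y) \<in> borel_measurable borel"
        using measurable_compose[OF measurable_Pair2'[of y borel borel] K] by simp
      have "(\<integral>\<^sup>+x. ennreal (\<bar>K x y\<bar> / M * e (v y / c)) \<partial>lborel) =
        (\<integral>\<^sup>+x. ennreal \<bar>K x y\<bar> * ennreal (e (v y / c) / M) \<partial>lborel)"
        using M young_nonneg[OF e] by (intro nn_integral_cong) (simp add: ennreal_mult[symmetric])
      also have "\<dots> = (\<integral>\<^sup>+x. ennreal \<bar>K x y\<bar> \<partial>lborel) * ennreal (e (v y / c) / M)"
        by (rule nn_integral_multc) simp
      finally show "(\<integral>\<^sup>+x. ennreal (\<bar>K x y\<bar> / M * e (v y / c)) \<partial>lborel) = \<dots>" .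
    qed
    also have "\<dots> \<le> (\<integral>\<^sup>+y. ennreal M * ennreal (e (v y / c) / M) \<partial>lborel)"
      by (intro nn_integral_mono mult_right_mono col) auto
    also have "\<dots> = (\<integral>\<^sup>+y. ennreal (e (v y / c)) \<partial>lborel)"
      using M young_nonneg[OF e] by (intro nn_integral_cong) (simp add: ennreal_mult[symmetric])
    also have "\<dots> \<le> 1" by (rule c)
    finally show "(\<integral>\<^sup>+x. ennreal (e ((\<integral>y. K x y * v y \<partial>lborel) / (M * c))) \<partial>lborel) \<le> 1" .
  qed (use M c in simp)
qed

section \<open>Finite signed measures\<close>

lemma signed_measures_empty: "\<mu> \<in> signed_measures \<Longrightarrow> \<mu> {} = 0"
  by (simp add: signed_measures_def)

lemma signed_measures_sums:
  "\<mu> \<in> signed_measures \<Longrightarrow> (\<And>n. A n \<in> sets borel) \<Longrightarrow> disjoint_family A \<Longrightarrow>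
    (\<lambda>n. \<mu> (A n)) sums \<mu> (\<Union>n. A n)"
  by (auto simp: signed_measures_def)

lemma signed_measures_union:
  assumes "\<mu> \<in> signed_measures" "A \<in> sets borel" "B \<in> sets borel" "A \<inter> B = {}"
  shows "\<mu> (A \<union> B) = \<mu> A + \<mu> B"
proof -
  have "(\<lambda>n. \<mu> (binaryset A B n)) sums \<mu> (\<Union>n. binaryset A B n)"
    by (rule signed_measures_sums[OF assms(1)])
       (use assms in \<open>auto simp: binaryset_def disjoint_family_on_def\<close>)
  moreover have "(\<lambda>n. \<mu> (binaryset A B n)) sums (\<Sum>n\<in>{0, 1}. \<mu> (binaryset A B n))"
    by (rule sums_finite) (auto simp: binaryset_def signed_measures_empty[OF assms(1)])
  ultimately show ?thesis
    by (simp add: UN_binaryset_eq sums_unique2) (simp add: binaryset_def sums_iff)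
qed

lemma signed_measures_diff:
  assumes "\<mu> \<in> signed_measures" "A \<in> sets borel" "B \<in> sets borel" "B \<subseteq> A"
  shows "\<mu> (A - B) = \<mu> A - \<mu> B"
proof -
  have "\<mu> (B \<union> (A - B)) = \<mu> B + \<mu> (A - B)"
    by (rule signed_measures_union) (use assms in auto)
  moreover have "B \<union> (A - B) = A" using assms by auto
  ultimately show ?thesis by simp
qed

lemma signed_measures_uminus: "\<mu> \<in> signed_measures \<Longrightarrow> (\<lambda>A. - \<mu> A) \<in> signed_measures"
  by (auto simp: signed_measures_def intro: sums_minus)

text \<open>A real-valued countably additive set function is bounded. Otherwise one splits off again and
  again, from a set of infinite variation, a piece of absolute measure at least one while the rest
  keeps infinite variation. The pieces are disjoint, so their measures would have to tend to zero.\<close>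
lemma signed_measures_bounded:
  assumes \<mu>: "\<mu> \<in> signed_measures"
  obtains K where "\<And>B. B \<in> sets borel \<Longrightarrow> \<bar>\<mu> B\<bar> \<le> K"
proof -
  define V where "V A \<longleftrightarrow> A \<in> sets borel \<and> (\<forall>K. \<exists>B\<in>sets borel. B \<subseteq> A \<and> \<bar>\<mu> B\<bar> > K)" for A
  have step: "\<exists>A'. V A' \<and> A' \<subseteq> A \<and> 1 \<le> \<bar>\<mu> (A - A')\<bar>" if "V A" for A
  proof -
    have A: "A \<in> sets borel" using that by (simp add: V_def)
    obtain B where B: "B \<in> sets borel" "B \<subseteq> A" "\<bar>\<mu> B\<bar> > \<bar>\<mu> A\<bar> + 1"
      using \<open>V A\<close> unfolding V_def by blast
    have AB: "\<mu> (A - B) = \<mu> A - \<mu> B" by (rule signed_measures_diff[OF \<mu> A B(1,2)])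
    have "V B \<or> V (A - B)"
    proof (rule ccontr)
      assume "\<not> (V B \<or> V (A - B))"
      then have nV: "\<not> V B" "\<not> V (A - B)" by blast+
      obtain K1 where K1: "\<And>C. C \<in> sets borel \<Longrightarrow> C \<subseteq> B \<Longrightarrow> \<bar>\<mu> C\<bar> \<le> K1"
        using nV(1) B(1) unfolding V_def not_less[symmetric] by blast
      have "A - B \<in> sets borel" using A B by auto
      then obtain K2 where K2: "\<And>C. C \<in> sets borel \<Longrightarrow> C \<subseteq> A - B \<Longrightarrow> \<bar>\<mu> C\<bar> \<le> K2"
        using nV(2) unfolding V_def not_less[symmetric] by blast
      obtain C where C: "C \<in> sets borel" "C \<subseteq> A" "\<bar>\<mu> C\<bar> > K1 + K2"
        using \<open>V A\<close> unfolding V_def by blast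
      have "\<mu> ((C \<inter> B) \<union> (C - B)) = \<mu> (C \<inter> B) + \<mu> (C - B)"
        by (rule signed_measures_union[OF \<mu>]) (use C B in auto)
      moreover have "(C \<inter> B) \<union> (C - B) = C" by auto
      ultimately have "\<bar>\<mu> C\<bar> \<le> \<bar>\<mu> (C \<inter> B)\<bar> + \<bar>\<mu> (C - B)\<bar>" by simp
      also have "\<dots> \<le> K1 + K2" by (intro add_mono K1 K2) (use C B in auto)
      finally show False using C by simp
    qed
    then show ?thesis
    proof
      assume "V B"
      then show ?thesis using B AB by (intro exI[of _ B]) auto
    next
      assume "V (A - B)"
      moreover have "A - (A - B) = B" using B by auto
      ultimately show ?thesis using B AB by (intro exI[of _ "A - B"]) auto
    qed
  qed
  have "\<not> V UNIV"
  proof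
    assume "V UNIV"
    then obtain A where A: "\<And>n. V (A n)" "\<And>n. A (Suc n) \<subseteq> A n \<and> 1 \<le> \<bar>\<mu> (A n - A (Suc n))\<bar>"
      using dependent_nat_choice[of "\<lambda>_. V" "\<lambda>_ A A'. A' \<subseteq> A \<and> 1 \<le> \<bar>\<mu> (A - A')\<bar>"] step by blast
    have dec: "decseq A" using A(2) by (simp add: decseq_Suc_iff)
    have "disjoint_family (\<lambda>n. A n - A (Suc n))"
      unfolding disjoint_family_on_def
    proof (intro ballI impI)
      fix i j :: nat assume "i \<noteq> j"
      then consider "Suc i \<le> j" | "Suc j \<le> i" by linarith
      then show "(A i - A (Suc i)) \<inter> (A j - A (Suc j)) = {}"
        using decseqD[OF dec] by cases blast+
    qed
    then have "(\<lambda>n. \<mu> (A n - A (Suc n))) sums \<mu> (\<Union>n. A n - A (Suc n))"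
      by (intro signed_measures_sums[OF \<mu>]) (use A(1) V_def in auto)
    then have "(\<lambda>n. \<mu> (A n - A (Suc n))) \<longlonglongrightarrow> 0"
      using sums_summable summable_LIMSEQ_zero by blast
    then have "\<forall>\<^sub>F n in sequentially. \<bar>\<mu> (A n - A (Suc n))\<bar> < 1"
      by (drule_tac tendstoD[of _ 0 sequentially 1]) (simp_all add: dist_real_def)
    then show False using A(2) by (auto simp: eventually_sequentially not_less[symmetric])
  qed
  then show ?thesis unfolding V_def using that by (auto simp: not_less)
qed

text \<open>The set function defining \<open>pos_part\<close> is countably additive, so \<open>pos_part\<close> is a measure with the
  intended values.\<close>
lemma
  assumes \<mu>: "\<mu> \<in> (signed_measures :: ((real ^ 'n) set \<Rightarrow> real) set)"
  shows sets_pos_part [measurable_cong, simp]: "sets (pos_part \<mu>) = sets borel"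
    and space_pos_part [simp]: "space (pos_part \<mu>) = UNIV"
    and emeasure_pos_part: "A \<in> sets borel \<Longrightarrow>
      emeasure (pos_part \<mu>) A = (SUP B\<in>{B \<in> sets borel. B \<subseteq> A}. ennreal (\<mu> B))"
proof -
  define P0 where "P0 A = (SUP B\<in>{B \<in> sets borel. B \<subseteq> A}. ennreal (\<mu> B))" for A
  have sig: "sigma_sets UNIV (sets (borel :: (real ^ 'n) measure)) = sets borel"
    using sets.sigma_sets_eq[of "borel :: (real ^ 'n) measure"] by simp
  show "sets (pos_part \<mu>) = sets borel" "space (pos_part \<mu>) = UNIV"
    unfolding pos_part_def using sig by (simp_all add: sets_measure_of space_measure_of_conv)
  have mono: "P0 A \<le> P0 B" if "A \<subseteq> B" for A B
    unfolding P0_def by (rule SUP_subset_mono) (use that in auto)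
  have empty: "P0 {} = 0"
  proof -
    have "{B \<in> sets (borel :: (real ^ 'n) measure). B \<subseteq> {}} = {{}}" by auto
    then show ?thesis unfolding P0_def by (simp add: signed_measures_empty[OF \<mu>])
  qed
  have super: "P0 A + P0 B \<le> P0 (A \<union> B)" if "A \<inter> B = {}" for A B
  proof -
    have *: "ennreal (\<mu> A') + ennreal (\<mu> B') \<le> P0 (A \<union> B)"
      if "A' \<in> sets borel" "A' \<subseteq> A" "B' \<in> sets borel" "B' \<subseteq> B" for A' B'
    proof -
      define A2 where "A2 = (if \<mu> A' < 0 then {} else A')"
      define B2 where "B2 = (if \<mu> B' < 0 then {} else B')"
      have 2: "A2 \<in> sets borel" "A2 \<subseteq> A" "B2 \<in> sets borel" "B2 \<subseteq> B" "\<mu> A2 \<ge> 0" "\<mu> B2 \<ge> 0"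
        "ennreal (\<mu> A') = ennreal (\<mu> A2)" "ennreal (\<mu> B') = ennreal (\<mu> B2)"
        using that by (auto simp: A2_def B2_def signed_measures_empty[OF \<mu>] ennreal_neg)
      then have "ennreal (\<mu> A') + ennreal (\<mu> B') = ennreal (\<mu> (A2 \<union> B2))"
        using \<open>A \<inter> B = {}\<close> by (subst signed_measures_union[OF \<mu>]) auto
      also have "\<dots> \<le> P0 (A \<union> B)" unfolding P0_def by (rule SUP_upper) (use 2 in auto)
      finally show ?thesis .
    qed
    have ne: "{B' \<in> sets borel. B' \<subseteq> B} \<noteq> {}" for B :: "(real ^ 'n) set" by blast
    have "P0 A + ennreal (\<mu> B') \<le> P0 (A \<union> B)" if "B' \<in> sets borel" "B' \<subseteq> B" for B'
      unfolding P0_def[of A]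
      by (subst ennreal_SUP_add_left[symmetric, OF ne]) (use * that in \<open>auto intro!: SUP_least\<close>)
    then have "(SUP B'\<in>{B' \<in> sets borel. B' \<subseteq> B}. P0 A + ennreal (\<mu> B')) \<le> P0 (A \<union> B)"
      by (intro SUP_least) auto
    then show ?thesis
      by (subst (asm) ennreal_SUP_add_right[symmetric, OF ne]) (simp add: P0_def[of B])
  qed
  have add: "countably_additive (sets borel) P0"
    unfolding countably_additive_def
  proof (intro allI impI)
    fix A :: "nat \<Rightarrow> (real ^ 'n) set"
    assume A: "range A \<subseteq> sets borel" "disjoint_family A"
    show "(\<Sum>i. P0 (A i)) = P0 (\<Union>i. A i)"
    proof (rule antisym)
      have "(\<Sum>i<n. P0 (A i)) \<le> P0 (\<Union>i<n. A i)" for n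
      proof (induction n)
        case (Suc n)
        have "A i \<inter> A n = {}" if "i < n" for i
          by (rule disjoint_family_onD[OF A(2)]) (use that in auto)
        then have "(\<Union>i<n. A i) \<inter> A n = {}" by blast
        from super[OF this] Suc have "(\<Sum>i<Suc n. P0 (A i)) \<le> P0 ((\<Union>i<n. A i) \<union> A n)"
          by (auto intro: order_trans add_right_mono)
        also have "(\<Union>i<n. A i) \<union> A n = (\<Union>i<Suc n. A i)" by (auto simp: lessThan_Suc)
        finally show ?case .
      qed (simp add: empty)
      also have "P0 (\<Union>i<n. A i) \<le> P0 (\<Union>i. A i)" for n by (rule mono) auto
      finally show "(\<Sum>i. P0 (A i)) \<le> P0 (\<Union>i. A i)"
        by (intro suminf_le_const) auto
      show "P0 (\<Union>i. A i) \<le> (\<Sum>i. P0 (A i))"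
        unfolding P0_def[of "\<Union>i. A i"]
      proof (rule SUP_least)
        fix B assume "B \<in> {B \<in> sets borel. B \<subseteq> (\<Union>i. A i)}"
        then have B: "B \<in> sets borel" "B \<subseteq> (\<Union>i. A i)" by auto
        have "(\<lambda>i. \<mu> (B \<inter> A i)) sums \<mu> (\<Union>i. B \<inter> A i)"
          by (rule signed_measures_sums[OF \<mu>])
             (use A B in \<open>auto simp: disjoint_family_on_def\<close>)
        moreover have "(\<Union>i. B \<inter> A i) = B" using B by auto
        ultimately have "(\<lambda>n. \<Sum>i<n. \<mu> (B \<inter> A i)) \<longlonglongrightarrow> \<mu> B" by (simp add: sums_def)
        then have "(\<lambda>n. ennreal (\<Sum>i<n. \<mu> (B \<inter> A i))) \<longlonglongrightarrow> ennreal (\<mu> B)"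
          by (rule tendsto_ennrealI)
        moreover have "ennreal (\<Sum>i<n. \<mu> (B \<inter> A i)) \<le> (\<Sum>i. P0 (A i))" for n
        proof -
          have "ennreal (\<Sum>i<n. \<mu> (B \<inter> A i)) \<le> ennreal (\<Sum>i<n. max 0 (\<mu> (B \<inter> A i)))"
            by (intro ennreal_leI sum_mono) auto
          also have "\<dots> = (\<Sum>i<n. ennreal (max 0 (\<mu> (B \<inter> A i))))"
            by (rule sum_ennreal[symmetric]) auto
          also have "\<dots> \<le> (\<Sum>i<n. P0 (A i))"
            unfolding P0_def
          proof (intro sum_mono)
            fix i
            have "ennreal (max 0 (\<mu> (B \<inter> A i))) = ennreal (\<mu> (B \<inter> A i))"
              by (simp add: max_def ennreal_neg)
            also have "\<dots> \<le> (SUP B\<in>{B \<in> sets borel. B \<subseteq> A i}. ennreal (\<mu> B))"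
              by (rule SUP_upper) (use A B in auto)
            finally show "ennreal (max 0 (\<mu> (B \<inter> A i))) \<le>
              (SUP B\<in>{B \<in> sets borel. B \<subseteq> A i}. ennreal (\<mu> B))" .
          qed
          also have "\<dots> \<le> (\<Sum>i. P0 (A i))" by (intro sum_le_suminf) auto
          finally show ?thesis .
        qed
        ultimately show "ennreal (\<mu> B) \<le> (\<Sum>i. P0 (A i))"
          by (intro LIMSEQ_le_const2[of _ "ennreal (\<mu> B)"]) auto
      qed
    qed
  qed
  have pp: "pos_part \<mu> = measure_of UNIV (sets borel) P0"
    by (simp add: pos_part_def P0_def[abs_def])
  show "emeasure (pos_part \<mu>) A = (SUP B\<in>{B \<in> sets borel. B \<subseteq> A}. ennreal (\<mu> B))"
    if "A \<in> sets borel"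
  proof -
    have "emeasure (pos_part \<mu>) A = P0 A"
      by (rule emeasure_measure_of[OF pp])
         (use that empty add in \<open>auto simp: positive_def sig pp\<close>)
    then show ?thesis by (simp add: P0_def)
  qed
qed

lemma finite_measure_pos_part:
  assumes \<mu>: "\<mu> \<in> signed_measures"
  shows "finite_measure (pos_part \<mu>)"
proof
  obtain K where K: "\<And>B. B \<in> sets borel \<Longrightarrow> \<bar>\<mu> B\<bar> \<le> K"
    using signed_measures_bounded[OF \<mu>] by blast
  have "emeasure (pos_part \<mu>) UNIV \<le> ennreal K"
  proof (subst emeasure_pos_part[OF \<mu>])
    show "(SUP B\<in>{B \<in> sets borel. B \<subseteq> UNIV}. ennreal (\<mu> B)) \<le> ennreal K"
      by (intro SUP_least ennreal_leI abs_le_D1[OF K]) auto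
  qed simp
  then show "emeasure (pos_part \<mu>) (space (pos_part \<mu>)) \<noteq> \<infinity>"
    using \<mu> by (auto simp: top_unique)
qed

text \<open>The negative part of the Jordan decomposition.\<close>
abbreviation "neg_part \<mu> \<equiv> pos_part (\<lambda>A. - \<mu> A)"

text \<open>Half of the Jordan decomposition: for measurable \<open>B \<subseteq> A\<close> one has
  \<open>\<mu> B = \<mu> A - \<mu> (A - B)\<close>. The other half is the same statement for \<open>- \<mu>\<close>.\<close>
lemma jordan_le:
  assumes \<mu>: "\<mu> \<in> signed_measures" and A: "A \<in> sets borel"
  shows "measure (pos_part \<mu>) A \<le> \<mu> A + measure (neg_part \<mu>) A"
proof -
  note \<mu>' = signed_measures_uminus[OF \<mu>]
  have le: "- \<mu> B \<le> measure (neg_part \<mu>) A" if "B \<in> sets borel" "B \<subseteq> A" for B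
  proof -
    have "ennreal (- \<mu> B) \<le> emeasure (neg_part \<mu>) A"
      unfolding emeasure_pos_part[OF \<mu>' A] by (rule SUP_upper) (use that in auto)
    also have "\<dots> = ennreal (measure (neg_part \<mu>) A)"
      using finite_measure.emeasure_eq_measure[OF finite_measure_pos_part[OF \<mu>']] .
    finally show ?thesis by (simp add: ennreal_le_iff)
  qed
  have "emeasure (pos_part \<mu>) A \<le> ennreal (\<mu> A + measure (neg_part \<mu>) A)"
    unfolding emeasure_pos_part[OF \<mu> A]
  proof (intro SUP_least ennreal_leI)
    fix B assume "B \<in> {B \<in> sets borel. B \<subseteq> A}"
    then have B: "B \<in> sets borel" "B \<subseteq> A" by auto
    show "\<mu> B \<le> \<mu> A + measure (neg_part \<mu>) A"
      using le[of "A - B"] signed_measures_diff[OF \<mu> A B] A B by auto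
  qed
  moreover have "0 \<le> \<mu> A + measure (neg_part \<mu>) A" using le[OF A] by simp
  ultimately show ?thesis
    by (simp add: finite_measure.emeasure_eq_measure[OF finite_measure_pos_part[OF \<mu>]])
qed

lemma jordan_decomposition:
  assumes \<mu>: "\<mu> \<in> signed_measures" and A: "A \<in> sets borel"
  shows "\<mu> A = measure (pos_part \<mu>) A - measure (neg_part \<mu>) A"
  using jordan_le[OF \<mu> A] jordan_le[OF signed_measures_uminus[OF \<mu>] A] by simp

text \<open>A signed measure is determined by its values on open boxes.\<close>
lemma signed_measures_eq_0:
  fixes \<mu> :: "(real ^ 'n) set \<Rightarrow> real"
  assumes \<mu>: "\<mu> \<in> signed_measures" and box: "\<And>a b. \<mu> (box a b) = 0" and A: "A \<in> sets borel"
  shows "\<mu> A = 0"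
proof -
  note \<mu>' = signed_measures_uminus[OF \<mu>]
  note fin = finite_measure_pos_part[OF \<mu>] finite_measure_pos_part[OF \<mu>']
  have "pos_part \<mu> = neg_part \<mu>"
  proof (rule measure_eqI_generator_eq[where E = "range (\<lambda>(a, b). box a b)" and \<Omega> = UNIV
        and A = "\<lambda>n. box (- (real n *\<^sub>R One)) (real n *\<^sub>R One)"])
    show "Int_stable (range (\<lambda>(a, b). box a b :: (real ^ 'n) set))"
    proof (rule Int_stableI, clarify)
      fix a b c d :: "real ^ 'n"
      show "box a b \<inter> box c d \<in> range (\<lambda>(a, b). box a b)"
        unfolding box_Int_box by (rule range_eqI[of _ _ "(_, _)"]) simp
    qed
    show "emeasure (pos_part \<mu>) X = emeasure (neg_part \<mu>) X"
      if "X \<in> range (\<lambda>(a, b). box a b)" for X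
    proof -
      have "X \<in> sets borel" "\<mu> X = 0" using that box by auto
      then show ?thesis using jordan_decomposition[OF \<mu>, of X]
        by (simp add: finite_measure.emeasure_eq_measure[OF fin(1)]
            finite_measure.emeasure_eq_measure[OF fin(2)])
    qed
    show "sets (pos_part \<mu>) = sigma_sets UNIV (range (\<lambda>(a, b). box a b))"
      "sets (neg_part \<mu>) = sigma_sets UNIV (range (\<lambda>(a, b). box a b))"
      by (simp_all add: \<mu> \<mu>' borel_eq_box sets_measure_of)
    show "(\<Union>n. box (- (real n *\<^sub>R One)) (real n *\<^sub>R One) :: (real ^ 'n) set) = UNIV"
      by (rule UN_box_eq_UNIV)
    show "emeasure (pos_part \<mu>) (box (- (real n *\<^sub>R One)) (real n *\<^sub>R One)) \<noteq> \<infinity>" for n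
      using fin(1) by (simp add: finite_measure.emeasure_eq_measure)
  qed auto
  then show ?thesis using jordan_decomposition[OF \<mu> A] by simp
qed

lemma borel_measurable_pos_part [simp]:
  "\<mu> \<in> signed_measures \<Longrightarrow> borel_measurable (pos_part \<mu>) = borel_measurable borel"
  by (intro measurable_cong_sets) auto

lemma bounded_integrable_pos_part:
  fixes f :: "real ^ 'n \<Rightarrow> real"
  assumes "\<mu> \<in> signed_measures" "f \<in> borel_measurable borel" "\<And>x. \<bar>f x\<bar> \<le> B"
  shows "integrable (pos_part \<mu>) f"
  by (rule finite_measure.integrable_const_bound[OF finite_measure_pos_part[OF assms(1)], of _ B])
     (use assms in auto)

lemma signed_integral_indicator:
  assumes "\<mu> \<in> signed_measures" "A \<in> sets borel"
  shows "signed_integral \<mu> (indicator A) = \<mu> A"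
  unfolding signed_integral_def jordan_decomposition[OF assms]
  using assms signed_measures_uminus[OF assms(1)] by simp

text \<open>If \<open>P - N\<close> and \<open>P' - N'\<close> agree as set functions, they give the same integrals. The differences
  are written as sums to stay within positive measures.\<close>
lemma nn_integral_diff_cong:
  fixes f :: "real ^ 'n \<Rightarrow> ennreal"
  assumes [measurable_cong]: "sets P = sets borel" "sets N = sets borel" "sets P' = sets borel"
    "sets N' = sets borel"
    and eq: "\<And>A. A \<in> sets borel \<Longrightarrow> emeasure P A + emeasure N' A = emeasure N A + emeasure P' A"
    and f: "f \<in> borel_measurable borel"
  shows "(\<integral>\<^sup>+x. f x \<partial>P) + (\<integral>\<^sup>+x. f x \<partial>N') = (\<integral>\<^sup>+x. f x \<partial>N) + (\<integral>\<^sup>+x. f x \<partial>P')"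
  using f
proof (induction rule: borel_measurable_induct)
  case (cong f g)
  have fg: "f = g" by (intro ext cong(3)) simp
  show ?case unfolding fg by (rule cong(4))
next
  case (set A)
  then show ?case using eq assms(1-4) by simp
next
  case (mult u c)
  have "c * (\<integral>\<^sup>+x. u x \<partial>P) + c * (\<integral>\<^sup>+x. u x \<partial>N') = c * (\<integral>\<^sup>+x. u x \<partial>N) + c * (\<integral>\<^sup>+x. u x \<partial>P')"
    by (simp only: distrib_left[symmetric] mult)
  then show ?case using mult(2) by (simp add: nn_integral_cmult)
next
  case (add u v)
  have "((\<integral>\<^sup>+x. u x \<partial>P) + (\<integral>\<^sup>+x. u x \<partial>N')) + ((\<integral>\<^sup>+x. v x \<partial>P) + (\<integral>\<^sup>+x. v x \<partial>N')) =
      ((\<integral>\<^sup>+x. u x \<partial>N) + (\<integral>\<^sup>+x. u x \<partial>P')) + ((\<integral>\<^sup>+x. v x \<partial>N) + (\<integral>\<^sup>+x. v x \<partial>P'))"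
    by (simp only: add)
  moreover have "u \<in> borel_measurable M" "v \<in> borel_measurable M"
    if "sets M = sets borel" for M :: "(real ^ 'n) measure"
    using add(1,3) measurable_cong_sets[OF that refl] by auto
  ultimately show ?case using assms(1-4) by (simp add: nn_integral_add ac_simps)
next
  case (seq U)
  have inc: "incseq (\<lambda>i. \<integral>\<^sup>+x. U i x \<partial>M)" for M :: "(real ^ 'n) measure"
    using seq(3) by (auto intro!: incseq_SucI nn_integral_mono simp: incseq_Suc_iff le_fun_def)
  have *: "(\<integral>\<^sup>+x. (SUP i. U i) x \<partial>M) = (SUP i. \<integral>\<^sup>+x. U i x \<partial>M)" if "sets M = sets borel" for M
    unfolding SUP_apply
    by (rule nn_integral_monotone_convergence_SUP)
       (use seq in \<open>auto simp: measurable_cong_sets[OF that refl]\<close>)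
  show ?case
    unfolding *[OF assms(1)] *[OF assms(2)] *[OF assms(3)] *[OF assms(4)]
    by (simp only: ennreal_SUP_add[symmetric, OF inc inc] seq)
qed

lemma integral_diff_cong:
  fixes f :: "real ^ 'n \<Rightarrow> real"
  assumes sets: "sets P = sets borel" "sets N = sets borel" "sets P' = sets borel"
    "sets N' = sets borel"
    and eq: "\<And>A. A \<in> sets borel \<Longrightarrow> emeasure P A + emeasure N' A = emeasure N A + emeasure P' A"
    and f: "f \<in> borel_measurable borel"
    and int: "integrable P f" "integrable N f" "integrable P' f" "integrable N' f"
  shows "(\<integral>x. f x \<partial>P) - (\<integral>x. f x \<partial>N) = (\<integral>x. f x \<partial>P') - (\<integral>x. f x \<partial>N')"
proof -
  have *: "enn2real (\<integral>\<^sup>+x. ennreal (g x) \<partial>P) + enn2real (\<integral>\<^sup>+x. ennreal (g x) \<partial>N') =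
     enn2real (\<integral>\<^sup>+x. ennreal (g x) \<partial>N) + enn2real (\<integral>\<^sup>+x. ennreal (g x) \<partial>P')"
    if g: "g \<in> borel_measurable borel" and
      "integrable P g" "integrable N g" "integrable P' g" "integrable N' g" for g :: "real ^ 'n \<Rightarrow> real"
  proof -
    have "(\<integral>\<^sup>+x. ennreal (g x) \<partial>P) + (\<integral>\<^sup>+x. ennreal (g x) \<partial>N') =
     (\<integral>\<^sup>+x. ennreal (g x) \<partial>N) + (\<integral>\<^sup>+x. ennreal (g x) \<partial>P')"
      by (rule nn_integral_diff_cong[OF sets eq]) (use g in auto)
    moreover have "(\<integral>\<^sup>+x. ennreal (g x) \<partial>M) < top" if "integrable M g" for M
      using that by (simp add: real_integrable_def less_top)
    ultimately show ?thesis using that by (simp add: enn2real_plus[symmetric])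
  qed
  show ?thesis
    using *[OF f int] *[of "\<lambda>x. - f x"] f int by (simp add: real_lebesgue_integral_def)
qed

lemma ac_measures_signed: "\<mu> \<in> ac_measures \<Longrightarrow> \<mu> \<in> signed_measures"
  by (simp add: ac_measures_def)

lemma pos_part_density:
  fixes \<mu> :: "(real ^ 'n) set \<Rightarrow> real"
  assumes \<mu>: "\<mu> \<in> signed_measures"
    and ac: "\<And>A. A \<in> sets borel \<Longrightarrow> emeasure lborel A = 0 \<Longrightarrow> \<mu> A = 0"
  obtains D where "integrable lborel D"
    "\<And>A. A \<in> sets borel \<Longrightarrow> measure (pos_part \<mu>) A = (LINT x:A|lborel. D x)"
proof -
  interpret P: finite_measure "pos_part \<mu>" by (rule finite_measure_pos_part[OF \<mu>])
  have "emeasure (pos_part \<mu>) A = 0" if "A \<in> sets borel" "emeasure lborel A = 0" for A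
  proof -
    have "\<mu> B = 0" if "B \<in> sets borel" "B \<subseteq> A" for B
      by (rule ac) (use that \<open>A \<in> sets borel\<close> \<open>emeasure lborel A = 0\<close> emeasure_mono[of B A lborel] in auto)
    then show ?thesis unfolding emeasure_pos_part[OF \<mu> that(1)]
      by (auto intro!: antisym SUP_least)
  qed
  then have ac': "absolutely_continuous lborel (pos_part \<mu>)"
    using \<mu> by (auto simp: absolutely_continuous_def null_sets_def)
  have s: "sets (pos_part \<mu>) = sets lborel" using \<mu> by simp
  obtain D where D: "D \<in> borel_measurable (lborel :: (real ^ 'n) measure)"
    "AE x in lborel. RN_deriv lborel (pos_part \<mu>) x = ennreal (D x)" "\<And>x. 0 \<le> D x"
    using sigma_finite_measure.real_RN_deriv[OF lborel.sigma_finite_measure_axioms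
        P.finite_measure_axioms ac' s] by blast
  have dens: "density lborel (\<lambda>x. ennreal (D x)) = pos_part \<mu>"
    using sigma_finite_measure.density_RN_deriv[OF lborel.sigma_finite_measure_axioms ac'] \<mu> D
    by (subst density_cong[of _ _ "RN_deriv lborel (pos_part \<mu>)"]) auto
  have em: "emeasure (pos_part \<mu>) A = (\<integral>\<^sup>+x. ennreal (D x * indicator A x) \<partial>lborel)"
    if "A \<in> sets borel" for A
    unfolding dens[symmetric] using that D
    by (subst emeasure_density) (auto intro!: nn_integral_cong simp: indicator_def)
  have int: "integrable lborel (\<lambda>x. D x * indicator A x)" if "A \<in> sets borel" for A
    by (rule integrableI_nonneg)
       (use D that em[OF that, symmetric] P.emeasure_finite in \<open>auto simp: less_top[symmetric]\<close>)
  show ?thesis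
  proof
    show "integrable lborel D" using int[of UNIV] by simp
    show "measure (pos_part \<mu>) A = (LINT x:A|lborel. D x)" if "A \<in> sets borel" for A
    proof -
      have "ennreal (measure (pos_part \<mu>) A) = ennreal (\<integral>x. D x * indicator A x \<partial>lborel)"
        using em[OF that] nn_integral_eq_integral[OF int[OF that]] D P.emeasure_eq_measure by simp
      then show ?thesis
        using D by (subst (asm) ennreal_inj)
           (auto simp: set_lebesgue_integral_def mult.commute intro!: Bochner_Integration.integral_nonneg)
    qed
  qed
qed

text \<open>The density exists by Radon-Nikodym, applied to both parts of the Jordan decomposition.\<close>
lemma signed_density:
  fixes \<mu> :: "(real ^ 'n) set \<Rightarrow> real"
  assumes \<mu>: "\<mu> \<in> ac_measures"
  shows "integrable lborel (signed_density \<mu>)"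
    and "A \<in> sets borel \<Longrightarrow> \<mu> A = (LINT x:A|lborel. signed_density \<mu> x)"
proof -
  have sm: "\<mu> \<in> signed_measures" and ac: "\<And>A. A \<in> sets borel \<Longrightarrow> emeasure lborel A = 0 \<Longrightarrow> \<mu> A = 0"
    using \<mu> by (auto simp: ac_measures_def)
  obtain D where D: "integrable lborel D"
    "\<And>A. A \<in> sets borel \<Longrightarrow> measure (pos_part \<mu>) A = (LINT x:A|lborel. D x)"
    using pos_part_density[OF sm ac] by blast
  obtain D' where D': "integrable lborel D'"
    "\<And>A. A \<in> sets borel \<Longrightarrow> measure (neg_part \<mu>) A = (LINT x:A|lborel. D' x)"
    using pos_part_density[OF signed_measures_uminus[OF sm]] ac by auto
  have "\<mu> A = (LINT x:A|lborel. D x - D' x)" if "A \<in> sets borel" for A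
    using that D D' jordan_decomposition[OF sm that]
    by (subst set_integral_diff) (simp_all add: set_integrable_def integrable_mult_indicator del: real_scaleR_def)
  then have "\<exists>p. integrable lborel p \<and> (\<forall>A\<in>sets borel. \<mu> A = (LINT x:A|lborel. p x))"
    using D(1) D'(1) by (intro exI[of _ "\<lambda>x. D x - D' x"]) auto
  from someI_ex[OF this] show "integrable lborel (signed_density \<mu>)"
    "A \<in> sets borel \<Longrightarrow> \<mu> A = (LINT x:A|lborel. signed_density \<mu> x)"
    unfolding signed_density_def[symmetric] by auto
qed

lemma signed_integral_ac:
  fixes \<mu> :: "(real ^ 'n) set \<Rightarrow> real"
  assumes \<mu>: "\<mu> \<in> signed_measures" and p: "integrable lborel p"
    and eq: "\<And>A. A \<in> sets borel \<Longrightarrow> \<mu> A = (LINT x:A|lborel. p x)"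
    and f [measurable]: "f \<in> borel_measurable borel" and B: "\<And>x. \<bar>f x\<bar> \<le> B"
  shows "signed_integral \<mu> f = (\<integral>x. f x * p x \<partial>lborel)"
proof -
  note \<mu>' = signed_measures_uminus[OF \<mu>]
  have pm [measurable]: "p \<in> borel_measurable borel" using p by auto
  let ?P = "density lborel (\<lambda>x. ennreal (p x))" and ?N = "density lborel (\<lambda>x. ennreal (- p x))"
  have em: "emeasure (density lborel (\<lambda>x. ennreal (g x))) A = ennreal (\<integral>x. max 0 (g x) * indicator A x \<partial>lborel)"
    and ig: "integrable lborel (\<lambda>x. max 0 (g x) * indicator A x)"
    if g: "integrable lborel g" and A: "A \<in> sets borel" for g and A :: "(real ^ 'n) set"
  proof -
    have [measurable]: "g \<in> borel_measurable borel" using g by auto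
    have "integrable lborel (\<lambda>x. indicator A x *\<^sub>R max 0 (g x))"
      by (rule integrable_mult_indicator) (use A g in auto)
    then show int: "integrable lborel (\<lambda>x. max 0 (g x) * indicator A x)" by (simp add: mult.commute)
    have "emeasure (density lborel (\<lambda>x. ennreal (g x))) A =
        (\<integral>\<^sup>+x. ennreal (max 0 (g x) * indicator A x) \<partial>lborel)"
      using A by (subst emeasure_density) (auto intro!: nn_integral_cong simp: indicator_def max_def ennreal_neg)
    also have "\<dots> = ennreal (\<integral>x. max 0 (g x) * indicator A x \<partial>lborel)"
      by (rule nn_integral_eq_integral[OF int]) auto
    finally show "emeasure (density lborel (\<lambda>x. ennreal (g x))) A = \<dots>" .
  qed
  have fin: "finite_measure ?P" "finite_measure ?N"
    using em[OF p, of UNIV] em[of "\<lambda>x. - p x" UNIV] p by (auto intro!: finite_measureI)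
  have pi: "integrable lborel (\<lambda>x. f x * max 0 (g x))"
    if g: "integrable lborel g" for g
  proof (rule Bochner_Integration.integrable_bound)
    show "integrable lborel (\<lambda>x. B * g x)" using g by simp
    show "AE x in lborel. norm (f x * max 0 (g x)) \<le> norm (B * g x)"
    proof (intro AE_I2)
      fix x
      have "\<bar>f x\<bar> * \<bar>max 0 (g x)\<bar> \<le> \<bar>B\<bar> * \<bar>g x\<bar>"
        by (intro mult_mono order_trans[OF B abs_ge_self]) auto
      then show "norm (f x * max 0 (g x)) \<le> norm (B * g x)" by (simp add: abs_mult)
    qed
  qed (use g in auto)
  have ii: "(\<integral>x. f x \<partial>density lborel (\<lambda>x. ennreal (g x))) = (\<integral>x. f x * max 0 (g x) \<partial>lborel)"
    if g: "integrable lborel g" for g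
  proof -
    have [measurable]: "g \<in> borel_measurable borel" using g by auto
    have "density lborel (\<lambda>x. ennreal (g x)) = density lborel (\<lambda>x. ennreal (max 0 (g x)))"
      by (intro density_cong) (auto simp: max_def ennreal_neg)
    then show ?thesis by (simp add: integral_density mult.commute)
  qed
  have "signed_integral \<mu> f = (\<integral>x. f x \<partial>?P) - (\<integral>x. f x \<partial>?N)"
    unfolding signed_integral_def
  proof (rule integral_diff_cong)
    fix A :: "(real ^ 'n) set" assume A: "A \<in> sets borel"
    have "measure (pos_part \<mu>) A - measure (neg_part \<mu>) A = (\<integral>x. p x * indicator A x \<partial>lborel)"
      using jordan_decomposition[OF \<mu> A] eq[OF A]
      by (simp add: set_lebesgue_integral_def mult.commute)
    also have "\<dots> = (\<integral>x. max 0 (p x) * indicator A x - max 0 (- p x) * indicator A x \<partial>lborel)"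
      by (intro Bochner_Integration.integral_cong) (auto simp: max_def)
    also have "\<dots> = (\<integral>x. max 0 (p x) * indicator A x \<partial>lborel) - (\<integral>x. max 0 (- p x) * indicator A x \<partial>lborel)"
      by (rule Bochner_Integration.integral_diff) (use ig[OF _ A] p in auto)
    finally show "emeasure (pos_part \<mu>) A + emeasure ?N A = emeasure (neg_part \<mu>) A + emeasure ?P A"
      using em[OF p A] em[of "\<lambda>x. - p x", OF _ A] p
      by (simp add: finite_measure.emeasure_eq_measure[OF finite_measure_pos_part[OF \<mu>]]
          finite_measure.emeasure_eq_measure[OF finite_measure_pos_part[OF \<mu>']]
          ennreal_plus[symmetric] Bochner_Integration.integral_nonneg del: ennreal_plus)
  next
    show "integrable (pos_part \<mu>) f" "integrable (neg_part \<mu>) f"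
      by (rule bounded_integrable_pos_part[OF _ f B], fact)+
    show "integrable ?P f" "integrable ?N f"
      by (rule finite_measure.integrable_const_bound[where B = B]; use fin B in auto)+
  qed (use \<mu> \<mu>' in auto)
  also have "\<dots> = (\<integral>x. f x * max 0 (p x) - f x * max 0 (- p x) \<partial>lborel)"
    using ii[OF p] ii[of "\<lambda>x. - p x"] pi[OF p] pi[of "\<lambda>x. - p x"] p by simp
  also have "\<dots> = (\<integral>x. f x * p x \<partial>lborel)"
    by (intro Bochner_Integration.integral_cong) (auto simp: max_def)
  finally show ?thesis .
qed

section \<open>The interpolation inequality for a smoothed measure\<close>

lemma signed_integral_cmult: "signed_integral \<mu> (\<lambda>x. c * f x) = c * signed_integral \<mu> f"
  by (simp add: signed_integral_def algebra_simps)

lemma signed_integral_diff: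
  fixes f g :: "real ^ 'n \<Rightarrow> real"
  assumes \<mu>: "\<mu> \<in> signed_measures"
    and "f \<in> borel_measurable borel" "\<And>x. \<bar>f x\<bar> \<le> B" "g \<in> borel_measurable borel" "\<And>x. \<bar>g x\<bar> \<le> B'"
  shows "signed_integral \<mu> (\<lambda>x. f x - g x) = signed_integral \<mu> f - signed_integral \<mu> g"
  using bounded_integrable_pos_part[OF \<mu> assms(2,3)] bounded_integrable_pos_part[OF \<mu> assms(4,5)]
    bounded_integrable_pos_part[OF signed_measures_uminus[OF \<mu>] assms(2,3)]
    bounded_integrable_pos_part[OF signed_measures_uminus[OF \<mu>] assms(4,5)]
  by (simp add: signed_integral_def)

lemma signed_integral_sum:
  fixes f :: "'b \<Rightarrow> real ^ 'n \<Rightarrow> real"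
  assumes \<mu>: "\<mu> \<in> signed_measures"
    and "\<And>i. i \<in> I \<Longrightarrow> f i \<in> borel_measurable borel" "\<And>i x. i \<in> I \<Longrightarrow> \<bar>f i x\<bar> \<le> B i"
  shows "signed_integral \<mu> (\<lambda>x. \<Sum>i\<in>I. f i x) = (\<Sum>i\<in>I. signed_integral \<mu> (f i))"
  using bounded_integrable_pos_part[OF \<mu> assms(2,3)]
    bounded_integrable_pos_part[OF signed_measures_uminus[OF \<mu>] assms(2,3)]
  by (simp add: signed_integral_def sum_subtractf)

text \<open>The smoothing of a signed measure by a tensor kernel; the kernel is again evaluated at \<open>y - x\<close>,
  but here the integration variable is \<open>y\<close>.\<close>
definition sconv :: "((real ^ 'n) set \<Rightarrow> real) \<Rightarrow> ('n::finite \<Rightarrow> real \<Rightarrow> real) \<Rightarrow> real ^ 'n \<Rightarrow> real" where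
  "sconv \<mu> f x = signed_integral \<mu> (\<lambda>y. tensor f (y - x))"

lemma test_family_tensor_bounded:
  fixes f :: "'n::finite \<Rightarrow> real \<Rightarrow> real"
  assumes f: "\<And>i. test_function (f i)"
  obtains M where "0 < M" "\<And>z. \<bar>tensor f z\<bar> \<le> M"
    "\<And>y. (\<integral>\<^sup>+x. ennreal \<bar>tensor f (y - x)\<bar> \<partial>lborel) \<le> ennreal M"
proof (rule dilated_tensor_bounds[of f, OF f])
  fix M
  assume M: "0 < M" "\<And>n z. \<bar>tensor (\<lambda>i. dilate n (f i)) z\<bar> \<le> 2 ^ (n * CARD('n)) * M"
    "\<And>n y. (\<integral>\<^sup>+x. ennreal \<bar>tensor (\<lambda>i. dilate n (f i)) (y - x)\<bar> \<partial>lborel) \<le> ennreal M"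
  have d: "dilate 0 g = g" for g by (simp add: dilate_def fun_eq_iff)
  show thesis
    by (rule that[OF M(1)]) (use M(2)[of 0, unfolded d] M(3)[of 0, unfolded d] in simp_all)
qed

lemma finite_measure_fubini:
  fixes f :: "'n::finite \<Rightarrow> real \<Rightarrow> real"
  assumes P: "finite_measure P" and sets [measurable_cong]: "sets P = sets borel"
    and f: "\<And>i. test_function (f i)"
    and s [measurable]: "s \<in> borel_measurable borel" and S: "\<And>x. \<bar>s x\<bar> \<le> S"
  shows "integrable lborel (\<lambda>x. s x * (\<integral>y. tensor f (y - x) \<partial>P))"
    and "(\<integral>x. s x * (\<integral>y. tensor f (y - x) \<partial>P) \<partial>lborel) = (\<integral>y. conv s f y \<partial>P)"
proof -
  interpret P: finite_measure P by fact
  interpret pair_sigma_finite lborel P ..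
  obtain M where M: "0 < M" "\<And>y. (\<integral>\<^sup>+x. ennreal \<bar>tensor f (y - x)\<bar> \<partial>lborel) \<le> ennreal M"
    using test_family_tensor_bounded[of f, OF f] by metis
  note [measurable] = measurable_tensor_diff[OF f] borel_measurable_tensor[OF f]
  have S0: "0 \<le> S" using S[of undefined] by linarith
  have meas: "(\<lambda>(x, y). s x * tensor f (y - x)) \<in> borel_measurable (lborel \<Otimes>\<^sub>M P)"
    by measurable
  have "integrable (lborel \<Otimes>\<^sub>M P) (\<lambda>(x, y). s x * tensor f (y - x))"
  proof (rule integrableI_bounded[OF meas])
    have "(\<integral>\<^sup>+z. ennreal (norm (case z of (x, y) \<Rightarrow> s x * tensor f (y - x))) \<partial>(lborel \<Otimes>\<^sub>M P)) =
      (\<integral>\<^sup>+y. \<integral>\<^sup>+x. ennreal (norm (s x * tensor f (y - x))) \<partial>lborel \<partial>P)"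
      using meas by (subst nn_integral_snd[symmetric]) auto
    also have "\<dots> \<le> (\<integral>\<^sup>+y. ennreal S * ennreal M \<partial>P)"
    proof (intro nn_integral_mono)
      fix y
      have "(\<integral>\<^sup>+x. ennreal (norm (s x * tensor f (y - x))) \<partial>lborel) \<le>
         (\<integral>\<^sup>+x. ennreal S * ennreal \<bar>tensor f (y - x)\<bar> \<partial>lborel)"
        using S S0 by (intro nn_integral_mono)
          (auto simp: abs_mult ennreal_mult[symmetric] intro!: ennreal_leI mult_right_mono)
      also have "\<dots> = ennreal S * (\<integral>\<^sup>+x. ennreal \<bar>tensor f (y - x)\<bar> \<partial>lborel)"
        by (rule nn_integral_cmult) measurable
      also have "\<dots> \<le> ennreal S * ennreal M" by (intro mult_left_mono M) auto
      finally show "(\<integral>\<^sup>+x. ennreal (norm (s x * tensor f (y - x))) \<partial>lborel) \<le> \<dots>" .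
    qed
    also have "\<dots> < \<infinity>"
      by (simp add: ennreal_mult_less_top P.emeasure_eq_measure)
    finally show "(\<integral>\<^sup>+z. ennreal (norm (case z of (x, y) \<Rightarrow> s x * tensor f (y - x))) \<partial>(lborel \<Otimes>\<^sub>M P)) < \<infinity>" .
  qed
  from integrable_fst[OF this] Fubini_integral[OF this]
  show "integrable lborel (\<lambda>x. s x * (\<integral>y. tensor f (y - x) \<partial>P))"
    "(\<integral>x. s x * (\<integral>y. tensor f (y - x) \<partial>P) \<partial>lborel) = (\<integral>y. conv s f y \<partial>P)"
    by (simp_all add: conv_def)
qed

lemma
  fixes f :: "'n::finite \<Rightarrow> real \<Rightarrow> real"
  assumes \<mu>: "\<mu> \<in> signed_measures" and f: "\<And>i. test_function (f i)"
    and s: "s \<in> borel_measurable borel" and S: "\<And>x. \<bar>s x\<bar> \<le> S"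
  shows integrable_sconv_mult: "integrable lborel (\<lambda>x. s x * sconv \<mu> f x)"
    and sconv_fubini: "(\<integral>x. s x * sconv \<mu> f x \<partial>lborel) = signed_integral \<mu> (conv s f)"
proof -
  note \<mu>' = signed_measures_uminus[OF \<mu>]
  note F = finite_measure_fubini[OF finite_measure_pos_part sets_pos_part, OF _ _ f s S]
  show "integrable lborel (\<lambda>x. s x * sconv \<mu> f x)"
    using F(1)[OF \<mu> \<mu>] F(1)[OF \<mu>' \<mu>'] by (simp add: sconv_def signed_integral_def right_diff_distrib)
  show "(\<integral>x. s x * sconv \<mu> f x \<partial>lborel) = signed_integral \<mu> (conv s f)"
    using F[OF \<mu> \<mu>] F[OF \<mu>' \<mu>']
    by (simp add: sconv_def signed_integral_def right_diff_distrib)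
qed

lemma integrable_sconv:
  fixes f :: "'n::finite \<Rightarrow> real \<Rightarrow> real"
  assumes "\<mu> \<in> signed_measures" "\<And>i. test_function (f i)"
  shows "integrable lborel (sconv \<mu> f)"
  using integrable_sconv_mult[OF assms, of "\<lambda>_. 1" 1] by simp

lemma borel_measurable_sconv:
  fixes f :: "'n::finite \<Rightarrow> real \<Rightarrow> real"
  assumes "\<mu> \<in> signed_measures" "\<And>i. test_function (f i)"
  shows "sconv \<mu> f \<in> borel_measurable borel"
  using borel_measurable_integrable[OF integrable_sconv[OF assms]] by simp

lemma iter_partial_cmult:
  assumes "smooth h"
  shows "iter_partial is (\<lambda>x. c * h x) = (\<lambda>x. c * iter_partial is h x)"
proof (induction "is")
  case (Cons i "is")
  have "((\<lambda>t. iter_partial is h (x + t *\<^sub>R axis i 1)) has_real_derivative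
     partial_deriv i (iter_partial is h) x) (at 0)" for x
    using smooth_has_partial[OF smooth_partial_deriv[OF assms], of "is" x i 0] by simp
  from DERIV_cmult[OF this, of c] have "partial_deriv i (\<lambda>x. c * iter_partial is h x) =
      (\<lambda>x. c * partial_deriv i (iter_partial is h) x)"
    unfolding partial_deriv_def[of i "\<lambda>x. c * iter_partial is h x"]
    by (intro ext DERIV_imp_deriv)
  then show ?case by (simp add: Cons)
qed simp

lemma smooth_cmult:
  assumes "smooth h"
  shows "smooth (\<lambda>x. c * h x)"
  unfolding smooth_def iter_partial_cmult[OF assms]
proof (intro allI conjI)
  show "continuous_on UNIV (\<lambda>x. c * iter_partial is h x)" for "is"
    by (intro continuous_on_mult_left smooth_continuous smooth_partial_deriv assms)
  show "(\<lambda>t. c * iter_partial is h (x + t *\<^sub>R axis i 1)) field_differentiable at 0" for "is" i x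
    unfolding field_differentiable_def
    by (rule exI, rule DERIV_cmult, rule smooth_has_partial[OF smooth_partial_deriv[OF assms]])
qed

text \<open>The defining inequality of the distance \<open>d\<^sub>k\<close> for a test function that is not normalised.\<close>
lemma dist_k_bound:
  fixes h :: "real ^ 'n::finite \<Rightarrow> real"
  assumes h: "smooth h" and b: "\<And>\<alpha> x. \<alpha> \<in> mi_upto k \<Longrightarrow> \<bar>multi_deriv \<alpha> h x\<bar> \<le> b \<alpha>"
    and N: "(\<Sum>\<alpha>\<in>mi_upto k. b \<alpha>) \<le> N" "0 < N" and d: "dist_k k \<mu> \<nu> \<le> ennreal \<delta>" "0 \<le> \<delta>"
  shows "\<bar>signed_integral \<mu> h - signed_integral \<nu> h\<bar> \<le> N * \<delta>"
proof -
  let ?h = "\<lambda>x. (1 / N) * h x"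
  have b0: "0 \<le> b \<alpha>" if "\<alpha> \<in> mi_upto k" for \<alpha>
    using b[OF that, of undefined] by linarith
  have "sup_norm k ?h \<le> (\<Sum>\<alpha>\<in>mi_upto k. ennreal (b \<alpha> / N))"
    unfolding sup_norm_def
  proof (intro sum_mono SUP_least ennreal_leI)
    fix \<alpha> :: "'n \<Rightarrow> nat" and x :: "real ^ 'n" assume "\<alpha> \<in> mi_upto k"
    from b[OF this, of x] have "\<bar>multi_deriv \<alpha> h x\<bar> / N \<le> b \<alpha> / N"
      using N(2) by (intro divide_right_mono) auto
    moreover have "multi_deriv \<alpha> ?h x = (1 / N) * multi_deriv \<alpha> h x"
      unfolding multi_deriv_mi_list iter_partial_cmult[OF h] ..
    ultimately show "\<bar>multi_deriv \<alpha> ?h x\<bar> \<le> b \<alpha> / N"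
      using N(2) by (simp add: abs_mult)
  qed
  also have "\<dots> = ennreal ((\<Sum>\<alpha>\<in>mi_upto k. b \<alpha>) / N)"
    using b0 N by (subst sum_ennreal) (auto simp: sum_divide_distrib)
  also have "\<dots> \<le> 1" using N by (simp add: ennreal_le_1)
  finally have "ennreal \<bar>signed_integral \<mu> ?h - signed_integral \<nu> ?h\<bar> \<le> dist_k k \<mu> \<nu>"
    unfolding dist_k_def using smooth_cmult[OF h, of "1 / N"]
    by (intro SUP_upper CollectI conjI)
  also note d(1)
  finally have "\<bar>signed_integral \<mu> ?h - signed_integral \<nu> ?h\<bar> \<le> \<delta>" using d(2) by (simp add: ennreal_le_iff)
  moreover have "signed_integral \<mu> ?h - signed_integral \<nu> ?h = (1 / N) * (signed_integral \<mu> h - signed_integral \<nu> h)"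
    unfolding signed_integral_cmult by (simp add: right_diff_distrib)
  ultimately have "\<bar>(1 / N) * (signed_integral \<mu> h - signed_integral \<nu> h)\<bar> \<le> \<delta>" by (simp only:)
  then have "\<bar>signed_integral \<mu> h - signed_integral \<nu> h\<bar> / N \<le> \<delta>" using N by (simp add: abs_mult)
  then show ?thesis using N by (simp add: pos_divide_le_eq mult.commute)
qed

lemma tensor_deriv_test: "(\<And>i. test_function (f i)) \<Longrightarrow> test_function (tensor_deriv \<alpha> f i)"
  unfolding tensor_deriv_def by (rule test_function_iter_deriv)

lemma tensor_tensor_deriv_dilate:
  fixes f :: "'n::finite \<Rightarrow> real \<Rightarrow> real"
  assumes "\<And>i. smooth_real (f i)"
  shows "tensor (tensor_deriv \<alpha> (\<lambda>i. dilate n (f i))) z =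
    2 ^ (n * mi_order \<alpha>) * tensor (\<lambda>i. dilate n (tensor_deriv \<alpha> f i)) z"
proof -
  have "tensor (tensor_deriv \<alpha> (\<lambda>i. dilate n (f i))) z =
     (\<Prod>i\<in>UNIV. 2 ^ (n * \<alpha> i) * dilate n (tensor_deriv \<alpha> f i) (z $ i))"
    unfolding tensor_def tensor_deriv_def using iter_deriv_dilate[OF assms]
    by (intro prod.cong refl) (metis (no_types))
  also have "\<dots> = 2 ^ (n * mi_order \<alpha>) * tensor (\<lambda>i. dilate n (tensor_deriv \<alpha> f i)) z"
    by (simp add: prod.distrib tensor_def power_sum[symmetric] sum_distrib_left[symmetric] mi_order_def)
  finally show ?thesis .
qed

lemma
  fixes f :: "'n::finite \<Rightarrow> real \<Rightarrow> real"
  assumes f: "\<And>i. test_function (f i)"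
  shows smooth_tensor_diff: "smooth (\<lambda>y. tensor f (y - x))"
    and multi_deriv_tensor_diff: "multi_deriv \<alpha> (\<lambda>y. tensor f (y - x)) y = tensor (tensor_deriv \<alpha> f) (y - x)"
proof -
  let ?g = "\<lambda>i t. f i (1 * t + (- x $ i))"
  have eq: "(\<lambda>y. tensor f (y - x)) = tensor ?g" by (simp add: tensor_def fun_eq_iff)
  have g: "\<And>i. smooth_real (?g i)" by (intro smooth_real_affine test_function_smooth f)
  show "smooth (\<lambda>y. tensor f (y - x))" unfolding eq by (rule smooth_tensor[OF g])
  show "multi_deriv \<alpha> (\<lambda>y. tensor f (y - x)) y = tensor (tensor_deriv \<alpha> f) (y - x)"
    unfolding eq multi_deriv_tensor[OF g]
    by (simp only: tensor_def tensor_deriv_def iter_deriv_affine[OF test_function_smooth[OF f]])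
       simp
qed

lemma compact_smooth_tensor_diff:
  fixes f :: "'n::finite \<Rightarrow> real \<Rightarrow> real"
  assumes f: "\<And>i. test_function (f i)"
  shows "compact_smooth (\<lambda>y. tensor f (y - x))"
proof -
  obtain L B where L: "0 < L" "0 < B" "\<And>i t. L < \<bar>t\<bar> \<Longrightarrow> f i t = 0" "\<And>i t. \<bar>f i t\<bar> \<le> B"
    using test_family_bounds[of f, OF f] by metis
  let ?c = "\<chi> i. L :: real ^ 'n"
  have "tensor f (y - x) = 0" if "y \<notin> cbox (x - ?c) (x + ?c)" for y
    using tensor_le[of L B f "y - x"] L that by (simp add: cbox_diff_iff(2))
  then have "closure {y. tensor f (y - x) \<noteq> 0} \<subseteq> cbox (x - ?c) (x + ?c)"
    by (intro closure_minimal closed_cbox) auto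
  then have "compact (closure {y. tensor f (y - x) \<noteq> 0})"
    by (meson bounded_cbox bounded_subset closed_closure compact_eq_bounded_closed)
  then show ?thesis using smooth_tensor_diff[OF f] by (simp add: compact_smooth_def)
qed

text \<open>An inequality with a factor in \<open>[0, \<infinity>]\<close> may be checked for all real numbers above that factor.
  This also covers the degenerate cases of factors \<open>0\<close> and \<open>\<infinity>\<close>.\<close>
lemma le_mult_if_less:
  assumes "\<And>\<delta>. 0 < \<delta> \<Longrightarrow> d < ennreal \<delta> \<Longrightarrow> X \<le> ennreal (c * \<delta>)" and c: "0 < c"
  shows "X \<le> ennreal c * d"
proof -
  have "ennreal (1 / c) * X \<le> d"
  proof (rule ccontr)
    assume "\<not> ennreal (1 / c) * X \<le> d"
    then obtain z where z: "d < z" "z < ennreal (1 / c) * X" using dense by (auto simp: not_le)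
    then obtain \<delta> where \<delta>: "z = ennreal \<delta>" "0 \<le> \<delta>" by (cases z) auto
    have "0 < \<delta>" using z(1) \<delta> by (metis ennreal_eq_0_iff leI not_less_zero order.antisym)
    then have "X \<le> ennreal (c * \<delta>)" using assms(1) z \<delta> by auto
    then have "ennreal (1 / c) * X \<le> ennreal (1 / c) * ennreal (c * \<delta>)" by (intro mult_left_mono) auto
    also have "\<dots> = z" using c \<delta> by (simp add: ennreal_mult[symmetric])
    finally show False using z(2) by simp
  qed
  then have "ennreal c * (ennreal (1 / c) * X) \<le> ennreal c * d" by (intro mult_left_mono) auto
  also have "ennreal c * (ennreal (1 / c) * X) = X"
    using c by (simp add: mult.assoc[symmetric] ennreal_mult[symmetric])
  finally show ?thesis .
qed

text \<open>The contribution of \<open>\<mu> - \<nu>\<close>: its smoothing is bounded in sup norm and in \<open>L\<^sup>1\<close> through \<open>d\<^sub>k\<close>, and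
  the two bounds are interpolated.\<close>
lemma sconv_dist_bound:
  fixes f :: "'n::finite \<Rightarrow> real \<Rightarrow> real"
  assumes e: "e \<in> young_class" and f: "\<And>i. test_function (f i)"
  obtains C where "0 < C"
    "\<And>n \<mu> \<nu>. \<mu> \<in> signed_measures \<Longrightarrow> \<nu> \<in> signed_measures \<Longrightarrow>
      orlicz_norm e (\<lambda>x. sconv \<mu> (\<lambda>i. dilate n (f i)) x - sconv \<nu> (\<lambda>i. dilate n (f i)) x) \<le>
      ennreal (C * (2 ^ (n * k) * young_beta e (2 ^ (n * CARD('n))))) * dist_k k \<mu> \<nu>"
proof -
  have "\<exists>M>0. (\<forall>n z. \<bar>tensor (\<lambda>i. dilate n (tensor_deriv \<alpha> f i)) z\<bar> \<le> 2 ^ (n * CARD('n)) * M) \<and>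
     (\<forall>n y. (\<integral>\<^sup>+x. ennreal \<bar>tensor (\<lambda>i. dilate n (tensor_deriv \<alpha> f i)) (y - x)\<bar> \<partial>lborel) \<le> ennreal M)" for \<alpha>
    using dilated_tensor_bounds[of "tensor_deriv \<alpha> f", OF tensor_deriv_test[OF f]] by metis
  then obtain M where M: "\<And>\<alpha>. 0 < M \<alpha>"
    "\<And>\<alpha> n z. \<bar>tensor (\<lambda>i. dilate n (tensor_deriv \<alpha> f i)) z\<bar> \<le> 2 ^ (n * CARD('n)) * M \<alpha>"
    "\<And>\<alpha> n y. (\<integral>\<^sup>+x. ennreal \<bar>tensor (\<lambda>i. dilate n (tensor_deriv \<alpha> f i)) (y - x)\<bar> \<partial>lborel) \<le> ennreal (M \<alpha>)"
    by metis
  define C where "C = (\<Sum>\<alpha>\<in>(mi_upto k :: ('n \<Rightarrow> nat) set). M \<alpha>)"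
  have z: "(\<lambda>_. 0) \<in> (mi_upto k :: ('n \<Rightarrow> nat) set)" by (simp add: mi_upto_def mi_order_def)
  have C: "0 < C" unfolding C_def using M(1) z by (intro sum_pos) auto
  show ?thesis
  proof (rule that[OF C])
    fix n and \<mu> \<nu> :: "(real ^ 'n) set \<Rightarrow> real"
    assume \<mu>: "\<mu> \<in> signed_measures" and \<nu>: "\<nu> \<in> signed_measures"
    let ?F = "\<lambda>i. dilate n (f i)"
    have F: "\<And>i. test_function (?F i)" by (intro test_function_dilate f)
    define g where "g x = sconv \<mu> ?F x - sconv \<nu> ?F x" for x
    have gi: "integrable lborel g" unfolding g_def[abs_def]
      using integrable_sconv[OF \<mu> F] integrable_sconv[OF \<nu> F] by simp
    then have gm [measurable]: "g \<in> borel_measurable borel" by auto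
    have D: "tensor (tensor_deriv \<alpha> ?F) z = 2 ^ (n * mi_order \<alpha>) * tensor (\<lambda>i. dilate n (tensor_deriv \<alpha> f i)) z" for \<alpha> z
      by (rule tensor_tensor_deriv_dilate) (intro test_function_smooth f)
    have pk: "(2::real) ^ (n * mi_order \<alpha>) \<le> 2 ^ (n * k)" if "\<alpha> \<in> mi_upto k" for \<alpha> :: "'n \<Rightarrow> nat"
      using that by (intro power_increasing mult_left_mono) (auto simp: mi_upto_def)
    have "orlicz_norm e g \<le> ennreal (C * (2 ^ (n * k) * young_beta e (2 ^ (n * CARD('n))))) * dist_k k \<mu> \<nu>"
    proof (rule le_mult_if_less)
      fix \<delta> assume \<delta>: "0 < \<delta>" "dist_k k \<mu> \<nu> < ennreal \<delta>"
      define A where "A = C * 2 ^ (n * k) * \<delta>"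
      have A: "0 < A" using C \<delta> by (simp add: A_def)
      \<comment> \<open>sup norm: the translated kernel itself is admissible in \<open>d\<^sub>k\<close> up to normalisation\<close>
      have inf: "\<bar>g x\<bar> \<le> A * 2 ^ (n * CARD('n))" for x
      proof -
        have "\<bar>signed_integral \<mu> (\<lambda>y. tensor ?F (y - x)) - signed_integral \<nu> (\<lambda>y. tensor ?F (y - x))\<bar> \<le>
            (C * 2 ^ (n * k) * 2 ^ (n * CARD('n))) * \<delta>"
        proof (rule dist_k_bound[OF smooth_tensor_diff[OF F]])
          show "\<bar>multi_deriv \<alpha> (\<lambda>y. tensor ?F (y - x)) y\<bar> \<le> M \<alpha> * 2 ^ (n * k) * 2 ^ (n * CARD('n))"
            if "\<alpha> \<in> mi_upto k" for \<alpha> y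
          proof -
            have "\<bar>multi_deriv \<alpha> (\<lambda>y. tensor ?F (y - x)) y\<bar> \<le> 2 ^ (n * k) * (2 ^ (n * CARD('n)) * M \<alpha>)"
              unfolding multi_deriv_tensor_diff[OF F] D abs_mult
              by (intro mult_mono M) (use pk[OF that] in auto)
            then show ?thesis by (simp add: mult_ac)
          qed
          show "(\<Sum>\<alpha>\<in>(mi_upto k :: ('n \<Rightarrow> nat) set). M \<alpha> * 2 ^ (n * k) * 2 ^ (n * CARD('n))) \<le>
              C * 2 ^ (n * k) * 2 ^ (n * CARD('n))"
            by (simp add: C_def sum_distrib_right)
        qed (use \<delta> C in auto)
        then show ?thesis by (simp add: g_def sconv_def A_def mult_ac)
      qed
      have L1: "(\<integral>\<^sup>+x. ennreal \<bar>g x\<bar> \<partial>lborel) \<le> ennreal A"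
      proof -
        \<comment> \<open>\<open>L\<^sup>1\<close> norm: the smoothing of the sign of \<open>g\<close> by the kernel is admissible in \<open>d\<^sub>k\<close> up to normalisation\<close>
        define s where "s x = sgn (g x)" for x
        have sm [measurable]: "s \<in> borel_measurable borel" unfolding s_def[abs_def] by measurable
        have s1: "\<bar>s x\<bar> \<le> 1" for x by (auto simp: s_def sgn_real_def)
        have "(\<integral>x. \<bar>g x\<bar> \<partial>lborel) = (\<integral>x. s x * sconv \<mu> ?F x - s x * sconv \<nu> ?F x \<partial>lborel)"
          unfolding right_diff_distrib[symmetric] g_def[symmetric]
          by (simp add: s_def abs_sgn mult.commute)
        also have "\<dots> = signed_integral \<mu> (conv s ?F) - signed_integral \<nu> (conv s ?F)"
          using integrable_sconv_mult[OF \<mu> F sm s1] integrable_sconv_mult[OF \<nu> F sm s1]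
          by (simp add: sconv_fubini[OF \<mu> F sm s1] sconv_fubini[OF \<nu> F sm s1])
        also have "\<dots> \<le> \<bar>signed_integral \<mu> (conv s ?F) - signed_integral \<nu> (conv s ?F)\<bar>" by simp
        also have "\<dots> \<le> (C * 2 ^ (n * k)) * \<delta>"
        proof (rule dist_k_bound[OF smooth_conv[OF F s1 sm]])
          show "\<bar>multi_deriv \<alpha> (conv s ?F) y\<bar> \<le> M \<alpha> * 2 ^ (n * k)" if "\<alpha> \<in> mi_upto k" for \<alpha> y
          proof -
            let ?G = "\<lambda>i. dilate n (tensor_deriv \<alpha> f i)"
            have G: "\<And>i. test_function (?G i)" by (intro test_function_dilate tensor_deriv_test f)
            have Gi: "integrable lborel (\<lambda>x. tensor ?G (y - x))"
              using integrable_tensor_diff[OF G, where s = "\<lambda>_. 1" and S = 1 and y = y] by simp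
            have GM: "(\<integral>x. \<bar>tensor ?G (y - x)\<bar> \<partial>lborel) \<le> M \<alpha>"
            proof -
              have "(\<integral>\<^sup>+x. ennreal \<bar>tensor ?G (y - x)\<bar> \<partial>lborel) = ennreal (\<integral>x. \<bar>tensor ?G (y - x)\<bar> \<partial>lborel)"
                by (intro nn_integral_eq_integral integrable_abs Gi) auto
              with M(3)[of n \<alpha> y] M(1)[of \<alpha>] show ?thesis by (simp add: ennreal_le_iff)
            qed
            have "multi_deriv \<alpha> (conv s ?F) y = 2 ^ (n * mi_order \<alpha>) * (\<integral>x. s x * tensor ?G (y - x) \<partial>lborel)"
              unfolding multi_deriv_conv[OF F s1 sm] conv_def D
              by (subst integral_mult_right_zero[symmetric]) (simp add: mult_ac)
            also have "\<bar>\<dots>\<bar> \<le> 2 ^ (n * k) * M \<alpha>"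
              unfolding abs_mult
            proof (intro mult_mono)
              have "\<bar>\<integral>x. s x * tensor ?G (y - x) \<partial>lborel\<bar> \<le> (\<integral>x. \<bar>s x * tensor ?G (y - x)\<bar> \<partial>lborel)"
                by (rule integral_abs_bound)
              also have "\<dots> \<le> (\<integral>x. \<bar>tensor ?G (y - x)\<bar> \<partial>lborel)"
                by (intro integral_mono' integrable_abs Gi)
                   (use s1 in \<open>auto simp: abs_mult intro!: mult_left_le_one_le\<close>)
              also note GM
              finally show "\<bar>\<integral>x. s x * tensor ?G (y - x) \<partial>lborel\<bar> \<le> M \<alpha>" .
            qed (use pk[OF that] in auto)
            finally show ?thesis by (simp add: mult_ac)
          qed
          show "(\<Sum>\<alpha>\<in>(mi_upto k :: ('n \<Rightarrow> nat) set). M \<alpha> * 2 ^ (n * k)) \<le> C * 2 ^ (n * k)"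
            by (simp add: C_def sum_distrib_right)
        qed (use \<delta> C in auto)
        finally have "(\<integral>x. \<bar>g x\<bar> \<partial>lborel) \<le> A" by (simp add: A_def)
        moreover have "(\<integral>\<^sup>+x. ennreal \<bar>g x\<bar> \<partial>lborel) = ennreal (\<integral>x. \<bar>g x\<bar> \<partial>lborel)"
          by (intro nn_integral_eq_integral integrable_abs gi) auto
        ultimately show ?thesis by (simp add: ennreal_leI)
      qed
      have "orlicz_norm e g \<le> ennreal (A * young_beta e (2 ^ (n * CARD('n))))"
        by (rule orlicz_norm_interpolation[OF e gm A _ L1 inf]) simp
      then show "orlicz_norm e g \<le> ennreal (C * (2 ^ (n * k) * young_beta e (2 ^ (n * CARD('n)))) * \<delta>)"
        by (simp add: A_def mult_ac)
    next
      show "0 < C * (2 ^ (n * k) * young_beta e (2 ^ (n * CARD('n))))"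
        using C young_beta_pos[OF e, of "2 ^ (n * CARD('n))"] by simp
    qed
    then show "orlicz_norm e (\<lambda>x. sconv \<mu> ?F x - sconv \<nu> ?F x) \<le>
      ennreal (C * (2 ^ (n * k) * young_beta e (2 ^ (n * CARD('n))))) * dist_k k \<mu> \<nu>"
      by (simp add: g_def[abs_def])
  qed
qed

lemma locally_integrable_measurable:
  fixes v :: "real ^ 'n::finite \<Rightarrow> real"
  assumes "locally_integrable v"
  shows "v \<in> borel_measurable borel"
proof -
  have "(\<lambda>x. indicator (cball 0 (real n)) x *\<^sub>R v x) \<in> borel_measurable borel" for n
  proof -
    have "integrable lborel (\<lambda>x. indicator (cball 0 (real n)) x *\<^sub>R v x)"
      using assms unfolding locally_integrable_def set_integrable_def by simp
    then show ?thesis using borel_measurable_integrable by force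
  qed
  moreover have "(\<lambda>n. indicator (cball 0 (real n)) x *\<^sub>R v x) \<longlonglongrightarrow> v x" for x
  proof -
    obtain N where N: "norm x \<le> real N" using real_arch_simple by blast
    have "indicator (cball 0 (real n)) x *\<^sub>R v x = v x" if "N \<le> n" for n
      using that N by (auto simp: indicator_def)
    then show ?thesis by (intro tendsto_eventually) (auto simp: eventually_sequentially)
  qed
  ultimately show ?thesis by (rule borel_measurable_LIMSEQ_real[rotated])
qed

lemma locally_integrable_mult:
  fixes v :: "real ^ 'n::finite \<Rightarrow> real"
  assumes v: "locally_integrable v" and \<psi>: "compact_smooth \<psi>"
  shows "integrable lborel (\<lambda>x. v x * \<psi> x)"
proof -
  note [measurable] = locally_integrable_measurable[OF v] compact_smooth_measurable[OF \<psi>]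
  obtain B R where B: "0 < B" "\<And>x. \<bar>\<psi> x\<bar> \<le> B" "\<And>x. R < norm x \<Longrightarrow> \<psi> x = 0"
    using compact_smooth_bounds[OF \<psi>] by metis
  have "integrable lborel (\<lambda>x. indicator (cball 0 R) x *\<^sub>R v x)"
    using v unfolding locally_integrable_def set_integrable_def by auto
  then have "integrable lborel (\<lambda>x. B * (indicator (cball 0 R) x *\<^sub>R v x))" by simp
  then show ?thesis
  proof (rule Bochner_Integration.integrable_bound)
    show "AE x in lborel. norm (v x * \<psi> x) \<le> norm (B * (indicator (cball 0 R) x *\<^sub>R v x))"
    proof (intro AE_I2)
      fix x
      show "norm (v x * \<psi> x) \<le> norm (B * (indicator (cball 0 R) x *\<^sub>R v x))"
      proof (cases "R < norm x")
        case False
        then show ?thesis using B(2)[of x] B(1)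
          by (simp add: abs_mult mult.commute mult_right_mono)
      qed (simp add: B)
    qed
  qed measurable
qed

text \<open>The contribution of \<open>\<nu>\<close>: the derivatives of the kernel are moved onto the density of \<open>\<nu>\<close>, and
  each of them gains a factor \<open>2\<^sup>-\<^sup>n\<close>.\<close>
lemma sconv_weak_deriv_bound:
  fixes f :: "'n::finite \<Rightarrow> real \<Rightarrow> real"
  assumes e: "e \<in> young_class" and f: "\<And>i. test_function (f i)"
  obtains C where "0 < C"
    "\<And>n \<nu> v. \<nu> \<in> ac_measures \<Longrightarrow> has_weak_deriv \<theta> (signed_density \<nu>) v \<Longrightarrow>
      orlicz_norm e (sconv \<nu> (\<lambda>i. dilate n (tensor_deriv \<theta> f i))) \<le>
      ennreal (C * (1 / 2 ^ (n * mi_order \<theta>))) * orlicz_norm e v"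
proof -
  obtain M where M: "0 < M"
    "\<And>n y. (\<integral>\<^sup>+x. ennreal \<bar>tensor (\<lambda>i. dilate n (f i)) (y - x)\<bar> \<partial>lborel) \<le> ennreal M"
    "\<And>n x. (\<integral>\<^sup>+y. ennreal \<bar>tensor (\<lambda>i. dilate n (f i)) (y - x)\<bar> \<partial>lborel) \<le> ennreal M"
    by (rule dilated_tensor_bounds[of f, OF f]) (rule that)
  show ?thesis
  proof (rule that[OF M(1)])
    fix n and \<nu> :: "(real ^ 'n) set \<Rightarrow> real" and v
    assume \<nu>: "\<nu> \<in> ac_measures" and wd: "has_weak_deriv \<theta> (signed_density \<nu>) v"
    let ?F = "\<lambda>i. dilate n (f i)" and ?G = "\<lambda>i. dilate n (tensor_deriv \<theta> f i)"
    have F: "\<And>i. test_function (?F i)" by (intro test_function_dilate f)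
    have G: "\<And>i. test_function (?G i)" by (intro test_function_dilate tensor_deriv_test f)
    have v: "locally_integrable v" using wd by (simp add: has_weak_deriv_def)
    note vm = locally_integrable_measurable[OF v]
    define c where "c = 1 / 2 ^ (n * mi_order \<theta>) * (- 1 :: real) ^ mi_order \<theta>"
    have eq: "sconv \<nu> ?G x = c * (\<integral>y. tensor ?F (y - x) * v y \<partial>lborel)" for x
    proof -
      obtain B where B: "\<And>z. \<bar>tensor ?G z\<bar> \<le> B"
        using test_family_tensor_bounded[of ?G, OF G] by metis
      note [measurable] = borel_measurable_tensor[OF G]
      have "sconv \<nu> ?G x = (\<integral>y. tensor ?G (y - x) * signed_density \<nu> y \<partial>lborel)"
        unfolding sconv_def
        by (rule signed_integral_ac[OF ac_measures_signed[OF \<nu>] signed_density[OF \<nu>]])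
           (use B in auto)
      also have "\<dots> = 1 / 2 ^ (n * mi_order \<theta>) *
         (\<integral>y. signed_density \<nu> y * multi_deriv \<theta> (\<lambda>y. tensor ?F (y - x)) y \<partial>lborel)"
        unfolding multi_deriv_tensor_diff[OF F]
          tensor_tensor_deriv_dilate[of f, OF test_function_smooth[OF f]]
        by (subst integral_mult_right_zero[symmetric]) (simp add: mult_ac)
      also have "(\<integral>y. signed_density \<nu> y * multi_deriv \<theta> (\<lambda>y. tensor ?F (y - x)) y \<partial>lborel) =
         (- 1) ^ mi_order \<theta> * (\<integral>y. v y * tensor ?F (y - x) \<partial>lborel)"
        using wd compact_smooth_tensor_diff[OF F, where x = x]
        by (simp add: has_weak_deriv_def compact_smooth_def)
      finally show ?thesis by (simp add: c_def mult_ac)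
    qed
    have ac: "\<bar>c\<bar> = 1 / 2 ^ (n * mi_order \<theta>)" by (simp add: c_def abs_mult power_abs)
    have "orlicz_norm e (sconv \<nu> ?G) \<le>
      orlicz_norm e (\<lambda>x. 1 / 2 ^ (n * mi_order \<theta>) * (\<integral>y. tensor ?F (y - x) * v y \<partial>lborel))"
      by (intro orlicz_norm_mono_AE[OF e] AE_I2) (simp add: eq abs_mult ac)
    also have "\<dots> \<le> ennreal (1 / 2 ^ (n * mi_order \<theta>)) * orlicz_norm e (\<lambda>x. \<integral>y. tensor ?F (y - x) * v y \<partial>lborel)"
      by (rule orlicz_norm_cmult[OF e]) simp
    also have "\<dots> \<le> ennreal (1 / 2 ^ (n * mi_order \<theta>)) * (ennreal M * orlicz_norm e v)"
    proof (intro mult_left_mono orlicz_norm_schur[OF e vm _ M(1)])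
      show "(\<lambda>(x, y). tensor ?F (y - x)) \<in> borel_measurable (borel \<Otimes>\<^sub>M borel)"
        by (rule measurable_tensor_diff[OF F])
      show "integrable lborel (\<lambda>y. tensor ?F (y - x) * v y)" for x
        using locally_integrable_mult[OF v compact_smooth_tensor_diff[OF F, where x = x]]
        by (simp add: mult.commute)
    qed (use M in auto)
    also have "\<dots> = ennreal (M * (1 / 2 ^ (n * mi_order \<theta>))) * orlicz_norm e v"
      using M(1) by (subst ennreal_mult) (auto simp: mult_ac)
    finally show "orlicz_norm e (sconv \<nu> ?G) \<le> ennreal (M * (1 / 2 ^ (n * mi_order \<theta>))) * orlicz_norm e v" .
  qed
qed

text \<open>The two contributions together. The auxiliary measure \<open>\<nu>\<close> may be chosen depending on the scale \<open>n\<close>.\<close>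
lemma sconv_interpolation:
  fixes f :: "'n::finite \<Rightarrow> real \<Rightarrow> real"
  assumes e: "e \<in> young_class" and f: "\<And>i. test_function (f i)"
  obtains C where "0 < C"
    "\<And>n \<mu> \<nu> v. \<mu> \<in> signed_measures \<Longrightarrow> \<nu> \<in> ac_measures \<Longrightarrow> has_weak_deriv \<theta> (signed_density \<nu>) v \<Longrightarrow>
      orlicz_norm e (sconv \<mu> (\<lambda>i. dilate n (tensor_deriv \<theta> f i))) \<le>
      ennreal C * (ennreal (2 ^ (n * k) * young_beta e (2 ^ (n * CARD('n)))) * dist_k k \<mu> \<nu> +
        ennreal (1 / 2 ^ (n * mi_order \<theta>)) * orlicz_norm e v)"
proof -
  obtain C1 where C1: "0 < C1" "\<And>n \<mu> \<nu>. \<mu> \<in> signed_measures \<Longrightarrow> \<nu> \<in> signed_measures \<Longrightarrow>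
      orlicz_norm e (\<lambda>x. sconv \<mu> (\<lambda>i. dilate n (tensor_deriv \<theta> f i)) x - sconv \<nu> (\<lambda>i. dilate n (tensor_deriv \<theta> f i)) x) \<le>
      ennreal (C1 * (2 ^ (n * k) * young_beta e (2 ^ (n * CARD('n))))) * dist_k k \<mu> \<nu>"
    by (rule sconv_dist_bound[OF e, of "tensor_deriv \<theta> f" k, OF tensor_deriv_test[OF f]]) (rule that; blast)
  obtain C2 where C2: "0 < C2"
    "\<And>n \<nu> v. \<nu> \<in> ac_measures \<Longrightarrow> has_weak_deriv \<theta> (signed_density \<nu>) v \<Longrightarrow>
      orlicz_norm e (sconv \<nu> (\<lambda>i. dilate n (tensor_deriv \<theta> f i))) \<le>
      ennreal (C2 * (1 / 2 ^ (n * mi_order \<theta>))) * orlicz_norm e v"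
    by (rule sconv_weak_deriv_bound[OF e, of f \<theta>, OF f]) (rule that; blast)
  show ?thesis
  proof (rule that[of "max C1 C2"])
    fix n and \<mu> \<nu> :: "(real ^ 'n) set \<Rightarrow> real" and v
    assume \<mu>: "\<mu> \<in> signed_measures" and \<nu>: "\<nu> \<in> ac_measures"
      and wd: "has_weak_deriv \<theta> (signed_density \<nu>) v"
    note \<nu>' = ac_measures_signed[OF \<nu>]
    let ?G = "\<lambda>i. dilate n (tensor_deriv \<theta> f i)"
    have G: "\<And>i. test_function (?G i)" by (intro test_function_dilate tensor_deriv_test f)
    note [measurable] = borel_measurable_sconv[OF \<mu> G] borel_measurable_sconv[OF \<nu>' G]
    have be: "0 \<le> 2 ^ (n * k) * young_beta e (2 ^ (n * CARD('n)))"
      using young_beta_pos[OF e, of "2 ^ (n * CARD('n))"] by simp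
    have "orlicz_norm e (sconv \<mu> ?G) \<le>
        orlicz_norm e (\<lambda>x. sconv \<mu> ?G x - sconv \<nu> ?G x) + orlicz_norm e (sconv \<nu> ?G)"
      using orlicz_norm_add[OF e, of "\<lambda>x. sconv \<mu> ?G x - sconv \<nu> ?G x" "sconv \<nu> ?G"] by simp
    also have "\<dots> \<le> ennreal (C1 * (2 ^ (n * k) * young_beta e (2 ^ (n * CARD('n))))) * dist_k k \<mu> \<nu> +
        ennreal (C2 * (1 / 2 ^ (n * mi_order \<theta>))) * orlicz_norm e v"
      by (intro add_mono C1(2) C2(2) \<mu> \<nu> \<nu>' wd)
    also have "\<dots> \<le> ennreal (max C1 C2 * (2 ^ (n * k) * young_beta e (2 ^ (n * CARD('n))))) * dist_k k \<mu> \<nu> +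
        ennreal (max C1 C2 * (1 / 2 ^ (n * mi_order \<theta>))) * orlicz_norm e v"
      using be by (intro add_mono mult_right_mono ennreal_leI) auto
    also have "\<dots> = ennreal (max C1 C2) * (ennreal (2 ^ (n * k) * young_beta e (2 ^ (n * CARD('n)))) * dist_k k \<mu> \<nu> +
        ennreal (1 / 2 ^ (n * mi_order \<theta>)) * orlicz_norm e v)"
      using be C1(1) by (simp add: ennreal_mult' distrib_left mult.assoc less_max_iff_disj del: times_divide_eq_right mult_1_right)
    finally show "orlicz_norm e (sconv \<mu> ?G) \<le> \<dots>" .
  qed (use C1 in simp)
qed

section \<open>Convergence of the smoothed measures\<close>

text \<open>A difference of two products is a telescoping sum in which the factors are exchanged one
  coordinate at a time, in the order given by \<open>coords\<close>.\<close>
lemma prod_telescope: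
  fixes a b :: "'n::finite \<Rightarrow> real"
  shows "(\<Prod>j\<in>UNIV. a j) - (\<Prod>j\<in>UNIV. b j) =
    (\<Sum>l<CARD('n). \<Prod>j\<in>UNIV. if j = coords ! l then a j - b j
      else if j \<in> set (take l coords) then b j else a j)"
proof -
  define c where "c = (coords :: 'n list)"
  have dc: "distinct c" and sc: "set c = UNIV" unfolding c_def by (rule coords)+
  have len: "length c = CARD('n)" using distinct_card[OF dc] sc by simp
  define P where "P l = (\<Prod>j\<in>UNIV. if j \<in> set (take l c) then b j else a j)" for l
  have step: "P l - P (Suc l) = (\<Prod>j\<in>UNIV. if j = c ! l then a j - b j
      else if j \<in> set (take l c) then b j else a j)" if "l < length c" for l
  proof -
    have tk: "set (take (Suc l) c) = insert (c ! l) (set (take l c))"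
      using that by (simp add: take_Suc_conv_app_nth)
    have nin: "c ! l \<notin> set (take l c)"
      using dc that distinct_take[OF dc, of "Suc l"] by (simp add: take_Suc_conv_app_nth)
    let ?R = "\<Prod>j\<in>UNIV - {c ! l}. if j \<in> set (take l c) then b j else a j"
    have "P l = a (c ! l) * ?R"
      unfolding P_def using nin by (subst prod.remove[of _ "c ! l"]) auto
    moreover have "P (Suc l) = b (c ! l) * ?R"
      unfolding P_def tk
      by (subst prod.remove[of _ "c ! l"]) (auto intro!: arg_cong2[where f = "(*)"] prod.cong)
    moreover have "(\<Prod>j\<in>UNIV. if j = c ! l then a j - b j
      else if j \<in> set (take l c) then b j else a j) = (a (c ! l) - b (c ! l)) * ?R"
      by (subst prod.remove[of _ "c ! l"]) (auto intro!: arg_cong2[where f = "(*)"] prod.cong)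
    ultimately show ?thesis by (simp add: left_diff_distrib)
  qed
  have "(\<Sum>l<length c. P l - P (Suc l)) = P 0 - P (length c)"
    by (rule sum_lessThan_telescope')
  then have "P 0 - P (length c) = (\<Sum>l<length c. \<Prod>j\<in>UNIV. if j = c ! l then a j - b j
      else if j \<in> set (take l c) then b j else a j)"
    using step by simp
  moreover have "P 0 = (\<Prod>j\<in>UNIV. a j)" "P (length c) = (\<Prod>j\<in>UNIV. b j)"
    by (simp_all add: P_def sc)
  ultimately show ?thesis by (simp only: len[symmetric] c_def)
qed

text \<open>The terms of the telescoping sum for \<open>\<phi>\<^sub>n - \<phi>\<^sub>n\<^sub>+\<^sub>1\<close>. In the term with index \<open>l\<close>, the coordinates
  before position \<open>l\<close> of \<open>coords\<close> carry the finer kernel and those after it the coarser one. The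
  coordinate at position \<open>l\<close> carries \<open>\<kappa> - dilate 1 \<kappa>\<close>, written as the derivative of order \<open>r\<close> of \<open>\<rho>\<close>.
  The multi-index of the term is \<open>\<beta>\<close> raised by \<open>r\<close> in that coordinate.\<close>
definition layer_order :: "('n::finite \<Rightarrow> nat) \<Rightarrow> nat \<Rightarrow> nat \<Rightarrow> 'n \<Rightarrow> nat" where
  "layer_order \<beta> r l = (\<lambda>j. \<beta> j + (if j = coords ! l then r else 0))"

definition layer :: "(real \<Rightarrow> real) \<Rightarrow> (real \<Rightarrow> real) \<Rightarrow> nat \<Rightarrow> 'n::finite \<Rightarrow> real \<Rightarrow> real" where
  "layer \<kappa> \<rho> l = (\<lambda>j. if j = coords ! l then \<rho> else if j \<in> set (take l coords) then dilate 1 \<kappa> else \<kappa>)"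

lemma layer_test:
  "test_function \<kappa> \<Longrightarrow> test_function \<rho> \<Longrightarrow> test_function (layer \<kappa> \<rho> l i)"
  by (simp add: layer_def test_function_dilate)

lemma mi_order_layer: "mi_order (layer_order \<beta> r l) = mi_order \<beta> + r"
  by (simp add: layer_order_def mi_order_def sum.distrib)

lemma kernel_telescope:
  fixes z :: "real ^ 'n::finite"
  assumes k: "test_function \<kappa>" and r: "test_function \<rho>"
    and eq: "\<And>t. \<kappa> t - dilate 1 \<kappa> t = (deriv ^^ r) \<rho> t"
  shows "tensor (tensor_deriv \<beta> (\<lambda>i. dilate n \<kappa>)) z - tensor (tensor_deriv \<beta> (\<lambda>i. dilate (Suc n) \<kappa>)) z =
    (\<Sum>l<CARD('n). 2 ^ (n * mi_order \<beta>) *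
      tensor (\<lambda>i. dilate n (tensor_deriv (layer_order \<beta> r l) (layer \<kappa> \<rho> l) i)) z)"
proof -
  define a where "a j = 2 ^ (n * \<beta> j) * dilate n ((deriv ^^ \<beta> j) \<kappa>) (z $ j)" for j
  define b where "b j = 2 ^ (n * \<beta> j) * dilate n ((deriv ^^ \<beta> j) (dilate 1 \<kappa>)) (z $ j)" for j
  note ks = test_function_smooth[OF k] test_function_smooth[OF test_function_dilate[OF k]]
    test_function_smooth[OF r]
  have A: "tensor (tensor_deriv \<beta> (\<lambda>i. dilate n \<kappa>)) z = (\<Prod>j\<in>UNIV. a j)"
    by (simp add: tensor_def tensor_deriv_def iter_deriv_dilate ks a_def)
  have "dilate (Suc n) \<kappa> = dilate n (dilate 1 \<kappa>)" by (simp add: dilate_dilate)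
  then have B: "tensor (tensor_deriv \<beta> (\<lambda>i. dilate (Suc n) \<kappa>)) z = (\<Prod>j\<in>UNIV. b j)"
    by (simp add: tensor_def tensor_deriv_def iter_deriv_dilate ks b_def)
  have D: "(deriv ^^ i) \<kappa> t - (deriv ^^ i) (dilate 1 \<kappa>) t = (deriv ^^ (i + r)) \<rho> t" for i t
  proof -
    have "(\<lambda>t. \<kappa> t + (-1) * dilate 1 \<kappa> t) = (deriv ^^ r) \<rho>"
      using eq by (auto simp: fun_eq_iff)
    then have "(deriv ^^ i) (\<lambda>t. \<kappa> t + (-1) * dilate 1 \<kappa> t) = (deriv ^^ (i + r)) \<rho>"
      by (simp add: funpow_add)
    moreover have "(deriv ^^ i) (\<lambda>t. \<kappa> t + (-1) * dilate 1 \<kappa> t) =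
        (\<lambda>t. (deriv ^^ i) \<kappa> t + (-1) * (deriv ^^ i) (dilate 1 \<kappa>) t)"
      by (simp only: iter_deriv_add[OF ks(1) smooth_real_cmult[OF ks(2)]] iter_deriv_cmult[OF ks(2)])
    ultimately show ?thesis by (metis add_uminus_conv_diff mult_minus1)
  qed
  have ab: "a j - b j = 2 ^ (n * \<beta> j) * dilate n ((deriv ^^ (\<beta> j + r)) \<rho>) (z $ j)" for j
  proof -
    have "a j - b j = 2 ^ (n * \<beta> j) * (2 ^ n * ((deriv ^^ \<beta> j) \<kappa> (2 ^ n * z $ j) -
        (deriv ^^ \<beta> j) (dilate 1 \<kappa>) (2 ^ n * z $ j)))"
      by (simp add: a_def b_def dilate_def[of n] right_diff_distrib)
    then show ?thesis unfolding D by (simp add: dilate_def)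
  qed
  have "(\<Prod>j\<in>UNIV. if j = coords ! l then a j - b j else if j \<in> set (take l coords) then b j else a j) =
    2 ^ (n * mi_order \<beta>) * tensor (\<lambda>i. dilate n (tensor_deriv (layer_order \<beta> r l) (layer \<kappa> \<rho> l) i)) z" for l
  proof -
    have "(\<Prod>j\<in>UNIV. if j = coords ! l then a j - b j else if j \<in> set (take l coords) then b j else a j) =
      (\<Prod>j\<in>UNIV. 2 ^ (n * \<beta> j) * dilate n (tensor_deriv (layer_order \<beta> r l) (layer \<kappa> \<rho> l) j) (z $ j))"
      by (intro prod.cong refl) (simp add: ab tensor_deriv_def layer_order_def layer_def, simp add: a_def b_def)
    also have "\<dots> = 2 ^ (n * mi_order \<beta>) * tensor (\<lambda>i. dilate n (tensor_deriv (layer_order \<beta> r l) (layer \<kappa> \<rho> l) i)) z"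
      by (simp add: prod.distrib tensor_def power_sum[symmetric] sum_distrib_left[symmetric] mi_order_def)
    finally show ?thesis .
  qed
  then show ?thesis unfolding A B prod_telescope by simp
qed

lemma sconv_telescope:
  fixes \<mu> :: "(real ^ 'n::finite) set \<Rightarrow> real"
  assumes \<mu>: "\<mu> \<in> signed_measures" and k: "test_function \<kappa>" and r: "test_function \<rho>"
    and eq: "\<And>t. \<kappa> t - dilate 1 \<kappa> t = (deriv ^^ r) \<rho> t"
  shows "sconv \<mu> (tensor_deriv \<beta> (\<lambda>i. dilate n \<kappa>)) x - sconv \<mu> (tensor_deriv \<beta> (\<lambda>i. dilate (Suc n) \<kappa>)) x =
    (\<Sum>l<CARD('n). 2 ^ (n * mi_order \<beta>) *
      sconv \<mu> (\<lambda>i. dilate n (tensor_deriv (layer_order \<beta> r l) (layer \<kappa> \<rho> l) i)) x)"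
proof -
  have bd: "(\<lambda>y. tensor f (y - x)) \<in> borel_measurable borel \<and> (\<exists>B. \<forall>y. \<bar>tensor f (y - x)\<bar> \<le> B)"
    if f: "\<And>i. test_function (f i)" for f :: "'n \<Rightarrow> real \<Rightarrow> real"
  proof -
    note [measurable] = borel_measurable_tensor[OF f]
    obtain M where "\<And>z. \<bar>tensor f z\<bar> \<le> M" using test_family_tensor_bounded[of f, OF f] by metis
    then show ?thesis by (intro conjI exI[of _ M]) auto
  qed
  have K: "test_function (tensor_deriv \<beta> (\<lambda>i. dilate n \<kappa>) i)" for n and i :: 'n
    by (intro tensor_deriv_test test_function_dilate k)
  let ?G = "\<lambda>l i. dilate n (tensor_deriv (layer_order \<beta> r l) (layer \<kappa> \<rho> l) i)"
  have G: "test_function (?G l i)" for l and i :: 'n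
    by (intro test_function_dilate tensor_deriv_test layer_test k r)
  obtain B1 where B1: "\<And>y. \<bar>tensor (tensor_deriv \<beta> (\<lambda>i. dilate n \<kappa>)) (y - x)\<bar> \<le> B1" using bd[of "tensor_deriv \<beta> (\<lambda>i. dilate n \<kappa>)", OF K] by blast
  obtain B2 where B2: "\<And>y. \<bar>tensor (tensor_deriv \<beta> (\<lambda>i. dilate (Suc n) \<kappa>)) (y - x)\<bar> \<le> B2" using bd[of "tensor_deriv \<beta> (\<lambda>i. dilate (Suc n) \<kappa>)", OF K] by blast
  have "\<exists>B. \<forall>y. \<bar>tensor (?G l) (y - x)\<bar> \<le> B" for l using bd[of "?G l", OF G] by blast
  then obtain B3 where B3: "\<And>l y. \<bar>tensor (?G l) (y - x)\<bar> \<le> B3 l" by metis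
  have "sconv \<mu> (tensor_deriv \<beta> (\<lambda>i. dilate n \<kappa>)) x - sconv \<mu> (tensor_deriv \<beta> (\<lambda>i. dilate (Suc n) \<kappa>)) x =
    signed_integral \<mu> (\<lambda>y. tensor (tensor_deriv \<beta> (\<lambda>i. dilate n \<kappa>)) (y - x) - tensor (tensor_deriv \<beta> (\<lambda>i. dilate (Suc n) \<kappa>)) (y - x))"
    unfolding sconv_def
    by (rule signed_integral_diff[OF \<mu> _ B1 _ B2, symmetric]) (use bd[of "tensor_deriv \<beta> (\<lambda>i. dilate n \<kappa>)" for n, OF K] in blast)+
  also have "\<dots> = signed_integral \<mu> (\<lambda>y. \<Sum>l<CARD('n). 2 ^ (n * mi_order \<beta>) * tensor (?G l) (y - x))"
    unfolding kernel_telescope[OF k r eq] ..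
  also have "\<dots> = (\<Sum>l<CARD('n). signed_integral \<mu> (\<lambda>y. 2 ^ (n * mi_order \<beta>) * tensor (?G l) (y - x)))"
  proof (rule signed_integral_sum[OF \<mu>])
    show "(\<lambda>y. 2 ^ (n * mi_order \<beta>) * tensor (?G l) (y - x)) \<in> borel_measurable borel" for l
      using bd[of "?G l", OF G] by auto
    show "\<bar>2 ^ (n * mi_order \<beta>) * tensor (?G l) (y - x)\<bar> \<le> 2 ^ (n * mi_order \<beta>) * B3 l" for l y
      using B3[of l y] by (simp add: abs_mult)
  qed
  finally show ?thesis by (simp only: signed_integral_cmult sconv_def)
qed

lemma weak_deriv_le_weighted:
  fixes f :: "real ^ 'n::finite \<Rightarrow> real"
  assumes wd: "weakly_differentiable k f" and \<theta>: "\<theta> \<in> mi_upto k"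
  shows "orlicz_norm e (weak_deriv \<theta> f) \<le> weighted_sobolev_norm k l e f"
proof -
  have z: "(\<lambda>_. 0) \<in> (mi_upto l :: ('n \<Rightarrow> nat) set)" by (simp add: mi_upto_def mi_order_def)
  have "orlicz_norm e (weak_deriv \<theta> f) = orlicz_norm e (\<lambda>x. monomial (\<lambda>_. 0) x * weak_deriv \<theta> f x)"
    by (simp add: monomial_def)
  also have "\<dots> \<le> (\<Sum>\<gamma>\<in>mi_upto l. orlicz_norm e (\<lambda>x. monomial \<gamma> x * weak_deriv \<theta> f x))"
    by (rule member_le_sum[OF z]) auto
  also have "\<dots> \<le> (\<Sum>\<alpha>\<in>mi_upto k. \<Sum>\<gamma>\<in>mi_upto l. orlicz_norm e (\<lambda>x. monomial \<gamma> x * weak_deriv \<alpha> f x))"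
    by (rule member_le_sum[OF \<theta>]) auto
  finally show ?thesis using wd by (simp add: weighted_sobolev_norm_def)
qed

lemma has_weak_deriv_weak_deriv:
  "weakly_differentiable k f \<Longrightarrow> \<theta> \<in> mi_upto k \<Longrightarrow> has_weak_deriv \<theta> f (weak_deriv \<theta> f)"
  unfolding weakly_differentiable_def weak_deriv_def by (rule someI_ex[of "has_weak_deriv \<theta> f"]) blast

text \<open>The terms of the series \<open>interp_pi\<close>.\<close>
definition pi_term :: "nat \<Rightarrow> nat \<Rightarrow> nat \<Rightarrow> (real \<Rightarrow> real) \<Rightarrow> ((real ^ 'n::finite) set \<Rightarrow> real) \<Rightarrow>
    ((real ^ 'n) set \<Rightarrow> real) \<Rightarrow> nat \<Rightarrow> ennreal" where
  "pi_term q k m e \<mu> \<nu> n =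
     ennreal (2 ^ (n * (q + k)) * young_beta e (2 ^ (n * CARD('n)))) * dist_k k \<mu> \<nu> +
     ennreal (1 / 2 ^ (2 * n * m)) * weighted_sobolev_norm (2 * m + q) (2 * m) e (signed_density \<nu>)"

text \<open>Arithmetic of the scales: the factor \<open>2\<^sup>n\<^sup>b\<close> from the derivatives of the kernel turns \<open>2\<^sup>n\<^sup>k\<close> into at
  most \<open>2\<^sup>n\<^sup>(\<^sup>q\<^sup>+\<^sup>k\<^sup>)\<close>, and turns \<open>2\<^sup>-\<^sup>n\<^sup>(\<^sup>b\<^sup>+\<^sup>2\<^sup>m\<^sup>)\<close> into \<open>2\<^sup>-\<^sup>2\<^sup>n\<^sup>m\<close>.\<close>
lemma scale_step:
  assumes e: "e \<in> young_class" and le: "b \<le> q" and X: "X \<le> W"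
  shows "ennreal (2 ^ (n * b)) * (ennreal C * (ennreal (2 ^ (n * k) * young_beta e (2 ^ (n * d))) * D +
      ennreal (1 / 2 ^ (n * (b + 2 * m))) * X)) \<le>
    ennreal C * (ennreal (2 ^ (n * (q + k)) * young_beta e (2 ^ (n * d))) * D + ennreal (1 / 2 ^ (2 * n * m)) * W)"
proof -
  have be: "0 < young_beta e (2 ^ (n * d))" by (rule young_beta_pos[OF e]) simp
  have 1: "ennreal (2 ^ (n * b)) * ennreal (2 ^ (n * k) * young_beta e (2 ^ (n * d))) \<le>
      ennreal (2 ^ (n * (q + k)) * young_beta e (2 ^ (n * d)))"
  proof -
    have "ennreal (2 ^ (n * b)) * ennreal (2 ^ (n * k) * young_beta e (2 ^ (n * d))) =
        ennreal (2 ^ (n * (b + k)) * young_beta e (2 ^ (n * d)))"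
      using be by (simp add: ennreal_mult[symmetric] power_add distrib_left mult.assoc)
    also have "\<dots> \<le> ennreal (2 ^ (n * (q + k)) * young_beta e (2 ^ (n * d)))"
      using be le by (intro ennreal_leI mult_right_mono power_increasing) auto
    finally show ?thesis .
  qed
  have 2: "ennreal (2 ^ (n * b)) * ennreal (1 / 2 ^ (n * (b + 2 * m))) = ennreal (1 / 2 ^ (2 * n * m))"
    by (subst ennreal_mult[symmetric]) (auto simp: power_add distrib_left mult_ac)
  have "ennreal (2 ^ (n * b)) * (ennreal C * (ennreal (2 ^ (n * k) * young_beta e (2 ^ (n * d))) * D +
      ennreal (1 / 2 ^ (n * (b + 2 * m))) * X)) =
    ennreal C * ((ennreal (2 ^ (n * b)) * ennreal (2 ^ (n * k) * young_beta e (2 ^ (n * d)))) * D +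
      (ennreal (2 ^ (n * b)) * ennreal (1 / 2 ^ (n * (b + 2 * m)))) * X)"
    by (simp only: distrib_left mult.left_commute mult.assoc)
  also have "\<dots> \<le> ennreal C * (ennreal (2 ^ (n * (q + k)) * young_beta e (2 ^ (n * d))) * D + ennreal (1 / 2 ^ (2 * n * m)) * W)"
    unfolding 2 by (intro mult_left_mono add_mono mult_right_mono 1 X) auto
  finally show ?thesis .
qed

text \<open>The increments between consecutive scales, and the smoothing at scale one, are bounded by the terms
  of \<open>interp_pi\<close>. The smoothing at scale one needs no cancellation in the kernel.\<close>
lemma smoothing_increments:
  fixes \<beta> :: "'n::finite \<Rightarrow> nat"
  assumes e: "e \<in> young_class" and m: "1 \<le> m" and \<beta>: "\<beta> \<in> mi_upto q"
  obtains \<kappa> C where "test_function \<kappa>" "(\<integral>t. \<kappa> t \<partial>lborel) = 1" "0 < C"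
    "\<And>\<mu> \<nu> n. \<mu> \<in> signed_measures \<Longrightarrow> \<nu> \<in> ac_measures \<Longrightarrow>
      weakly_differentiable (2 * m + q) (signed_density \<nu>) \<Longrightarrow>
      orlicz_norm e (\<lambda>x. sconv \<mu> (tensor_deriv \<beta> (\<lambda>i. dilate (Suc n) \<kappa>)) x -
        sconv \<mu> (tensor_deriv \<beta> (\<lambda>i. dilate n \<kappa>)) x) \<le> ennreal C * pi_term q k m e \<mu> \<nu> n"
    "\<And>\<mu> \<nu>. \<mu> \<in> signed_measures \<Longrightarrow> \<nu> \<in> ac_measures \<Longrightarrow>
      weakly_differentiable (2 * m + q) (signed_density \<nu>) \<Longrightarrow>
      orlicz_norm e (sconv \<mu> (tensor_deriv \<beta> (\<lambda>i. dilate 0 \<kappa>))) \<le> ennreal C * pi_term q k m e \<mu> \<nu> 0"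
proof -
  obtain \<kappa> \<rho> where k: "test_function \<kappa>" and r: "test_function \<rho>" and ki: "(\<integral>t. \<kappa> t \<partial>lborel) = 1"
    and eq: "\<And>t. \<kappa> t - dilate 1 \<kappa> t = (deriv ^^ (2 * m)) \<rho> t"
    using exists_moment_kernel[of "2 * m"] m by (metis le_trans mult_2 le_add1)
  let ?\<theta> = "layer_order \<beta> (2 * m)" and ?f = "layer \<kappa> \<rho>"
  have f: "test_function (?f l i)" for l and i :: 'n by (rule layer_test[OF k r])
  have "\<exists>C>0. \<forall>n \<mu> \<nu> v. \<mu> \<in> signed_measures \<longrightarrow> \<nu> \<in> ac_measures \<longrightarrow> has_weak_deriv (?\<theta> l) (signed_density \<nu>) v \<longrightarrow>
      orlicz_norm e (sconv \<mu> (\<lambda>i. dilate n (tensor_deriv (?\<theta> l) (?f l) i))) \<le>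
      ennreal C * (ennreal (2 ^ (n * k) * young_beta e (2 ^ (n * CARD('n)))) * dist_k k \<mu> \<nu> +
        ennreal (1 / 2 ^ (n * mi_order (?\<theta> l))) * orlicz_norm e v)" for l
    by (rule sconv_interpolation[OF e, of "?f l" "?\<theta> l" k, OF f]) blast
  then obtain C where C: "\<And>l. 0 < C l" "\<And>l n \<mu> \<nu> v. \<mu> \<in> signed_measures \<Longrightarrow> \<nu> \<in> ac_measures \<Longrightarrow> has_weak_deriv (?\<theta> l) (signed_density \<nu>) v \<Longrightarrow>
      orlicz_norm e (sconv \<mu> (\<lambda>i. dilate n (tensor_deriv (?\<theta> l) (?f l) i))) \<le>
      ennreal (C l) * (ennreal (2 ^ (n * k) * young_beta e (2 ^ (n * CARD('n)))) * dist_k k \<mu> \<nu> +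
        ennreal (1 / 2 ^ (n * mi_order (?\<theta> l))) * orlicz_norm e v)"
    by metis
  obtain C0 where C0: "0 < C0" "\<And>n \<mu> \<nu> v. \<mu> \<in> signed_measures \<Longrightarrow> \<nu> \<in> ac_measures \<Longrightarrow> has_weak_deriv \<beta> (signed_density \<nu>) v \<Longrightarrow>
      orlicz_norm e (sconv \<mu> (\<lambda>i. dilate n (tensor_deriv \<beta> (\<lambda>_. \<kappa>) i))) \<le>
      ennreal C0 * (ennreal (2 ^ (n * k) * young_beta e (2 ^ (n * CARD('n)))) * dist_k k \<mu> \<nu> +
        ennreal (1 / 2 ^ (n * mi_order \<beta>)) * orlicz_norm e v)"
    by (rule sconv_interpolation[OF e, of "\<lambda>_. \<kappa>" \<beta> k, OF k]) (rule that; blast)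
  define C' where "C' = C0 + (\<Sum>l<CARD('n). C l)"
  have sC: "0 \<le> (\<Sum>l<CARD('n). C l)" using C(1) by (simp add: sum_nonneg less_imp_le)
  have ob: "mi_order \<beta> \<le> q" using \<beta> by (simp add: mi_upto_def)
  show ?thesis
  proof (rule that[OF k ki, of C'])
    show "0 < C'" using C0 sC by (simp add: C'_def)
    fix \<mu> \<nu> :: "(real ^ 'n) set \<Rightarrow> real"
    assume \<mu>: "\<mu> \<in> signed_measures" and \<nu>: "\<nu> \<in> ac_measures"
      and wd: "weakly_differentiable (2 * m + q) (signed_density \<nu>)"
    let ?W = "weighted_sobolev_norm (2 * m + q) (2 * m) e (signed_density \<nu>)"
    have \<theta>in: "?\<theta> l \<in> mi_upto (2 * m + q)" for l
      using \<beta> by (simp add: mi_upto_def mi_order_layer)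
    have \<beta>in: "\<beta> \<in> mi_upto (2 * m + q)" using \<beta> by (simp add: mi_upto_def)
    {
      fix n
      let ?g = "\<lambda>l. sconv \<mu> (\<lambda>i. dilate n (tensor_deriv (?\<theta> l) (?f l) i))"
      have gm: "?g l \<in> borel_measurable borel" for l
        by (intro borel_measurable_sconv \<mu> test_function_dilate tensor_deriv_test f)
      have gl: "orlicz_norm e (\<lambda>x. 2 ^ (n * mi_order \<beta>) * ?g l x) \<le> ennreal (C l) * pi_term q k m e \<mu> \<nu> n" for l
      proof -
        have "orlicz_norm e (\<lambda>x. 2 ^ (n * mi_order \<beta>) * ?g l x) \<le> ennreal (2 ^ (n * mi_order \<beta>)) * orlicz_norm e (?g l)"
          by (rule orlicz_norm_cmult[OF e]) simp
        also have "\<dots> \<le> ennreal (2 ^ (n * mi_order \<beta>)) * (ennreal (C l) * (ennreal (2 ^ (n * k) * young_beta e (2 ^ (n * CARD('n)))) * dist_k k \<mu> \<nu> +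
          ennreal (1 / 2 ^ (n * (mi_order \<beta> + 2 * m))) * orlicz_norm e (weak_deriv (?\<theta> l) (signed_density \<nu>))))"
          using C(2)[OF \<mu> \<nu> has_weak_deriv_weak_deriv[OF wd \<theta>in[of l]], of n]
          by (intro mult_left_mono) (auto simp: mi_order_layer)
        also have "\<dots> \<le> ennreal (C l) * pi_term q k m e \<mu> \<nu> n"
          unfolding pi_term_def
          by (rule scale_step[OF e ob weak_deriv_le_weighted[OF wd \<theta>in]])
        finally show ?thesis .
      qed
      have "orlicz_norm e (\<lambda>x. sconv \<mu> (tensor_deriv \<beta> (\<lambda>i. dilate (Suc n) \<kappa>)) x -
          sconv \<mu> (tensor_deriv \<beta> (\<lambda>i. dilate n \<kappa>)) x) \<le>
        orlicz_norm e (\<lambda>x. \<Sum>l<CARD('n). 2 ^ (n * mi_order \<beta>) * ?g l x)"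
        unfolding sconv_telescope[OF \<mu> k r eq, symmetric]
        by (intro orlicz_norm_mono_AE[OF e] AE_I2) (simp add: abs_minus_commute)
      also have "\<dots> \<le> (\<Sum>l<CARD('n). orlicz_norm e (\<lambda>x. 2 ^ (n * mi_order \<beta>) * ?g l x))"
        by (rule orlicz_norm_sum[OF e]) (use gm in auto)
      also have "\<dots> \<le> (\<Sum>l<CARD('n). ennreal (C l) * pi_term q k m e \<mu> \<nu> n)"
        by (intro sum_mono gl)
      also have "\<dots> = ennreal (\<Sum>l<CARD('n). C l) * pi_term q k m e \<mu> \<nu> n"
        using C(1) by (simp add: sum_distrib_right[symmetric] sum_ennreal less_imp_le)
      also have "\<dots> \<le> ennreal C' * pi_term q k m e \<mu> \<nu> n"
        using C0 by (intro mult_right_mono ennreal_leI) (auto simp: C'_def)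
      finally show "orlicz_norm e (\<lambda>x. sconv \<mu> (tensor_deriv \<beta> (\<lambda>i. dilate (Suc n) \<kappa>)) x -
          sconv \<mu> (tensor_deriv \<beta> (\<lambda>i. dilate n \<kappa>)) x) \<le> ennreal C' * pi_term q k m e \<mu> \<nu> n" .
    }
    have d0: "dilate 0 g = g" for g by (simp add: dilate_def fun_eq_iff)
    have "orlicz_norm e (sconv \<mu> (tensor_deriv \<beta> (\<lambda>i. dilate 0 \<kappa>))) =
        orlicz_norm e (sconv \<mu> (\<lambda>i. dilate 0 (tensor_deriv \<beta> (\<lambda>_. \<kappa>) i)))"
      by (simp only: tensor_deriv_def d0)
    also have "\<dots> \<le> ennreal C0 * (ennreal (2 ^ (0 * k) * young_beta e (2 ^ (0 * CARD('n)))) * dist_k k \<mu> \<nu> +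
        ennreal (1 / 2 ^ (0 * mi_order \<beta>)) * orlicz_norm e (weak_deriv \<beta> (signed_density \<nu>)))"
      by (rule C0(2)[OF \<mu> \<nu> has_weak_deriv_weak_deriv[OF wd \<beta>in]])
    also have "\<dots> \<le> ennreal C' * (ennreal (2 ^ (0 * k) * young_beta e (2 ^ (0 * CARD('n)))) * dist_k k \<mu> \<nu> +
        ennreal (1 / 2 ^ (0 * mi_order \<beta>)) * ?W)"
      using sC young_beta_pos[OF e zero_less_one]
      by (intro mult_mono add_mono ennreal_leI weak_deriv_le_weighted[OF wd \<beta>in]) (auto simp: C'_def)
    finally show "orlicz_norm e (sconv \<mu> (tensor_deriv \<beta> (\<lambda>i. dilate 0 \<kappa>))) \<le> ennreal C' * pi_term q k m e \<mu> \<nu> 0"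
      by (simp add: pi_term_def)
  qed
qed

lemma compact_smooth_multi_deriv: "compact_smooth \<psi> \<Longrightarrow> compact_smooth (multi_deriv \<alpha> \<psi>)"
  by (simp add: multi_deriv_mi_list compact_smooth_iter_partial)

lemma signed_integral_approximation:
  fixes \<psi> :: "real ^ 'n::finite \<Rightarrow> real"
  assumes \<mu>: "\<mu> \<in> signed_measures" and k: "test_function \<kappa>" "(\<integral>t. \<kappa> t \<partial>lborel) = 1"
    and \<psi>: "compact_smooth \<psi>"
  shows "(\<lambda>n. signed_integral \<mu> (conv \<psi> (\<lambda>i. dilate n \<kappa>))) \<longlonglongrightarrow> signed_integral \<mu> \<psi>"
proof -
  obtain B where B: "\<And>n y. \<bar>conv \<psi> (\<lambda>i. dilate n \<kappa>) y\<bar> \<le> B"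
    using approximate_identity(1)[OF k \<psi>] by blast
  obtain S where S: "\<And>x. \<bar>\<psi> x\<bar> \<le> S" using compact_smooth_bounds[OF \<psi>] by metis
  have cm: "conv \<psi> (\<lambda>i. dilate n \<kappa>) \<in> borel_measurable borel" for n
    by (intro borel_measurable_continuous_onI continuous_conv[OF _ S] test_function_dilate k
        compact_smooth_measurable \<psi>)
  have *: "(\<lambda>n. \<integral>y. conv \<psi> (\<lambda>i. dilate n \<kappa>) y \<partial>pos_part \<mu>) \<longlonglongrightarrow> (\<integral>y. \<psi> y \<partial>pos_part \<mu>)"
    if \<mu>: "\<mu> \<in> signed_measures" for \<mu> :: "(real ^ 'n) set \<Rightarrow> real"
  proof (rule integral_dominated_convergence[where w = "\<lambda>_. B"])
    interpret finite_measure "pos_part \<mu>" by (rule finite_measure_pos_part[OF \<mu>])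
    show "integrable (pos_part \<mu>) (\<lambda>_. B)" by simp
  qed (use \<mu> cm B compact_smooth_measurable[OF \<psi>] approximate_identity(2)[OF k \<psi>] in auto)
  show ?thesis unfolding signed_integral_def
    by (intro tendsto_diff * \<mu> signed_measures_uminus)
qed

lemma interp_pi_eq: "interp_pi q k m e \<mu> \<mu>s = (\<Sum>n. pi_term q k m e \<mu> (\<mu>s n) n)"
  unfolding interp_pi_def pi_term_def by (subst suminf_add) auto

text \<open>The smoothed measures converge almost everywhere to a function \<open>G\<close> that represents \<open>\<partial>\<^sub>\<beta> \<mu>\<close> up to
  the sign \<open>(-1)\<^sup>|\<^sup>\<beta>\<^sup>|\<close>, with a constant independent of \<open>\<mu>\<close> and of the approximating sequence.\<close>
lemma limit_derivative:
  fixes \<beta> :: "'n::finite \<Rightarrow> nat"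
  assumes e: "e \<in> young_class" and m: "1 \<le> m" and \<beta>: "\<beta> \<in> mi_upto q"
  obtains C where "0 < C"
    "\<And>\<mu> \<mu>s. \<mu> \<in> signed_measures \<Longrightarrow> (\<And>n. \<mu>s n \<in> ac_measures) \<Longrightarrow> interp_pi q k m e \<mu> \<mu>s < top \<Longrightarrow>
      \<exists>G. locally_integrable G \<and> orlicz_norm e G \<le> ennreal C * interp_pi q k m e \<mu> \<mu>s \<and>
        (\<forall>\<psi>. compact_smooth \<psi> \<longrightarrow> (\<integral>x. G x * \<psi> x \<partial>lborel) = signed_integral \<mu> (multi_deriv \<beta> \<psi>))"
proof -
  obtain \<kappa> C where k: "test_function \<kappa>" "(\<integral>t. \<kappa> t \<partial>lborel) = 1" and C: "0 < C"
    and inc: "\<And>\<mu> \<nu> n. \<mu> \<in> signed_measures \<Longrightarrow> \<nu> \<in> ac_measures \<Longrightarrow>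
      weakly_differentiable (2 * m + q) (signed_density \<nu>) \<Longrightarrow>
      orlicz_norm e (\<lambda>x. sconv \<mu> (tensor_deriv \<beta> (\<lambda>i. dilate (Suc n) \<kappa>)) x -
        sconv \<mu> (tensor_deriv \<beta> (\<lambda>i. dilate n \<kappa>)) x) \<le> ennreal C * pi_term q k m e \<mu> \<nu> n"
    and init: "\<And>\<mu> \<nu>. \<mu> \<in> signed_measures \<Longrightarrow> \<nu> \<in> ac_measures \<Longrightarrow>
      weakly_differentiable (2 * m + q) (signed_density \<nu>) \<Longrightarrow>
      orlicz_norm e (sconv \<mu> (tensor_deriv \<beta> (\<lambda>i. dilate 0 \<kappa>))) \<le> ennreal C * pi_term q k m e \<mu> \<nu> 0"
    by (rule smoothing_increments[OF e m \<beta>, of k]) (rule that; blast)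
  show ?thesis
  proof (rule that[of "2 * C"])
    show "0 < 2 * C" using C by simp
    fix \<mu> and \<mu>s :: "nat \<Rightarrow> (real ^ 'n) set \<Rightarrow> real"
    assume \<mu>: "\<mu> \<in> signed_measures" and \<mu>s: "\<And>n. \<mu>s n \<in> ac_measures"
      and fin: "interp_pi q k m e \<mu> \<mu>s < top"
    let ?a = "\<lambda>n. pi_term q k m e \<mu> (\<mu>s n) n"
    \<comment> \<open>otherwise the weighted Sobolev norm, hence the whole series, would be infinite\<close>
    have wd: "weakly_differentiable (2 * m + q) (signed_density (\<mu>s n))" for n
    proof (rule ccontr)
      assume "\<not> ?thesis"
      then have "?a n = top"
        by (simp add: pi_term_def weighted_sobolev_norm_def ennreal_mult_top)
      then show False using ennreal_suminf_lessD[OF fin[unfolded interp_pi_eq], of n] by simp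
    qed
    define T where "T n = sconv \<mu> (tensor_deriv \<beta> (\<lambda>i. dilate n \<kappa>))" for n
    have K: "test_function (tensor_deriv \<beta> (\<lambda>i. dilate n \<kappa>) i)" for n and i :: 'n
      by (intro tensor_deriv_test test_function_dilate k)
    have Tm [measurable]: "T n \<in> borel_measurable borel" for n
      unfolding T_def by (rule borel_measurable_sconv[OF \<mu> K])
    define h where "h n = (case n of 0 \<Rightarrow> T 0 | Suc n \<Rightarrow> (\<lambda>x. T (Suc n) x - T n x))" for n
    have hm [measurable]: "h n \<in> borel_measurable borel" for n
      unfolding h_def by (cases n) auto
    have T: "T n x = (\<Sum>j<Suc n. h j x)" for n x
      by (induction n) (simp_all add: h_def)
    have h0: "orlicz_norm e (h 0) \<le> ennreal C * ?a 0"
      using init[OF \<mu> \<mu>s wd, of 0] by (simp add: h_def T_def)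
    have hS: "orlicz_norm e (h (Suc n)) \<le> ennreal C * ?a n" for n
      using inc[OF \<mu> \<mu>s wd, of n n] by (simp add: h_def T_def)
    have hsum: "(\<Sum>n. orlicz_norm e (h n)) \<le> ennreal (2 * C) * interp_pi q k m e \<mu> \<mu>s"
    proof (rule suminf_le_const)
      fix N
      have part: "(\<Sum>n<N. ?a n) \<le> interp_pi q k m e \<mu> \<mu>s" for N
        unfolding interp_pi_eq by (intro sum_le_suminf) auto
      have "(\<Sum>n<N. orlicz_norm e (h n)) \<le> (\<Sum>n<Suc N. orlicz_norm e (h n))"
        by (intro sum_mono2) auto
      also have "\<dots> = orlicz_norm e (h 0) + (\<Sum>n<N. orlicz_norm e (h (Suc n)))"
        by (rule sum.lessThan_Suc_shift)
      also have "\<dots> \<le> ennreal C * (\<Sum>n<1. ?a n) + ennreal C * (\<Sum>n<N. ?a n)"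
        unfolding sum_distrib_left by (intro add_mono sum_mono hS) (use h0 in simp)
      also have "\<dots> \<le> ennreal C * interp_pi q k m e \<mu> \<mu>s + ennreal C * interp_pi q k m e \<mu> \<mu>s"
        by (intro add_mono mult_left_mono part) auto
      also have "\<dots> = ennreal (2 * C) * interp_pi q k m e \<mu> \<mu>s"
        using C by (simp add: distrib_right[symmetric] ennreal_plus[symmetric] del: ennreal_plus)
      finally show "(\<Sum>n<N. orlicz_norm e (h n)) \<le> ennreal (2 * C) * interp_pi q k m e \<mu> \<mu>s" .
    qed simp
    also have top: "ennreal (2 * C) * interp_pi q k m e \<mu> \<mu>s < top"
      using fin by (simp add: ennreal_mult_less_top)
    finally have hfin: "(\<Sum>n. orlicz_norm e (h n)) < top" .
    define H where "H x = (\<Sum>n. \<bar>h n x\<bar>)" for x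
    define G where "G x = (\<Sum>n. h n x)" for x
    have [measurable]: "H \<in> borel_measurable borel" "G \<in> borel_measurable borel"
      unfolding H_def[abs_def] G_def[abs_def] by measurable
    note summ = orlicz_norm_suminf(1)[OF e hm hfin]
    have Hn: "orlicz_norm e H \<le> (\<Sum>n. orlicz_norm e (h n))"
      unfolding H_def[abs_def] by (rule orlicz_norm_suminf(2)[OF e hm hfin])
    have "orlicz_norm e G \<le> orlicz_norm e H"
    proof (rule orlicz_norm_mono_AE[OF e])
      show "AE x in lborel. \<bar>G x\<bar> \<le> \<bar>H x\<bar>"
        using summ
      proof eventually_elim
        case (elim x)
        then show ?case unfolding G_def H_def
          using summable_rabs[OF elim] by linarith
      qed
    qed
    then have Gn: "orlicz_norm e G \<le> ennreal (2 * C) * interp_pi q k m e \<mu> \<mu>s"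
      using Hn hsum by (meson order_trans)
    have Gl: "locally_integrable G"
      unfolding locally_integrable_def
      by (intro allI impI orlicz_integrable_compact[OF e]) (use le_less_trans[OF Gn top] in auto)
    have Hl: "locally_integrable H"
      unfolding locally_integrable_def
      by (intro allI impI orlicz_integrable_compact[OF e]) (use le_less_trans[OF Hn hfin] in auto)
    have "(\<integral>x. G x * \<psi> x \<partial>lborel) = signed_integral \<mu> (multi_deriv \<beta> \<psi>)" if \<psi>: "compact_smooth \<psi>" for \<psi>
    proof -
      note [measurable] = compact_smooth_measurable[OF \<psi>]
      obtain S where S: "\<And>x. \<bar>\<psi> x\<bar> \<le> S" using compact_smooth_bounds[OF \<psi>] by metis
      have "(\<lambda>n. \<integral>x. T n x * \<psi> x \<partial>lborel) \<longlonglongrightarrow> (\<integral>x. G x * \<psi> x \<partial>lborel)"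
      proof (rule integral_dominated_convergence[where w = "\<lambda>x. \<bar>H x * \<psi> x\<bar>"])
        show "integrable lborel (\<lambda>x. \<bar>H x * \<psi> x\<bar>)"
          by (intro integrable_abs locally_integrable_mult Hl \<psi>)
        show "AE x in lborel. (\<lambda>n. T n x * \<psi> x) \<longlonglongrightarrow> G x * \<psi> x"
          using summ
        proof eventually_elim
          case (elim x)
          have "(\<lambda>n. \<Sum>j<Suc n. h j x) \<longlonglongrightarrow> G x"
            unfolding G_def
            by (rule LIMSEQ_Suc[OF summable_LIMSEQ[OF summable_rabs_cancel[OF elim]]])
          then show ?case unfolding T by (intro tendsto_mult tendsto_const)
        qed
        show "AE x in lborel. norm (T n x * \<psi> x) \<le> \<bar>H x * \<psi> x\<bar>" for n
          using summ
        proof eventually_elim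
          case (elim x)
          have "\<bar>T n x\<bar> \<le> (\<Sum>j<Suc n. \<bar>h j x\<bar>)" unfolding T by (rule sum_abs)
          also have "\<dots> \<le> H x" unfolding H_def by (intro sum_le_suminf elim) auto
          finally show ?case by (auto simp: abs_mult intro!: mult_right_mono)
        qed
      qed measurable
      moreover have "(\<integral>x. T n x * \<psi> x \<partial>lborel) = signed_integral \<mu> (conv (multi_deriv \<beta> \<psi>) (\<lambda>i. dilate n \<kappa>))" for n
      proof -
        have "(\<integral>x. T n x * \<psi> x \<partial>lborel) = (\<integral>x. \<psi> x * sconv \<mu> (tensor_deriv \<beta> (\<lambda>i. dilate n \<kappa>)) x \<partial>lborel)"
          by (simp add: T_def mult.commute)
        also have "\<dots> = signed_integral \<mu> (conv \<psi> (tensor_deriv \<beta> (\<lambda>i. dilate n \<kappa>)))"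
          by (rule sconv_fubini[OF \<mu> K _ S]) measurable
        also have "conv \<psi> (tensor_deriv \<beta> (\<lambda>i. dilate n \<kappa>)) = conv (multi_deriv \<beta> \<psi>) (\<lambda>i. dilate n \<kappa>)"
          by (rule conv_by_parts[OF _ \<psi>, symmetric]) (intro test_function_dilate k)
        finally show ?thesis .
      qed
      ultimately have "(\<lambda>n. signed_integral \<mu> (conv (multi_deriv \<beta> \<psi>) (\<lambda>i. dilate n \<kappa>))) \<longlonglongrightarrow> (\<integral>x. G x * \<psi> x \<partial>lborel)"
        by simp
      moreover have "(\<lambda>n. signed_integral \<mu> (conv (multi_deriv \<beta> \<psi>) (\<lambda>i. dilate n \<kappa>))) \<longlonglongrightarrow> signed_integral \<mu> (multi_deriv \<beta> \<psi>)"
        by (rule signed_integral_approximation[OF \<mu> k compact_smooth_multi_deriv[OF \<psi>]])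
      ultimately show ?thesis by (rule LIMSEQ_unique)
    qed
    then show "\<exists>G. locally_integrable G \<and> orlicz_norm e G \<le> ennreal (2 * C) * interp_pi q k m e \<mu> \<mu>s \<and>
        (\<forall>\<psi>. compact_smooth \<psi> \<longrightarrow> (\<integral>x. G x * \<psi> x \<partial>lborel) = signed_integral \<mu> (multi_deriv \<beta> \<psi>))"
      using Gl Gn by blast
  qed
qed

section \<open>Recovering the density and its weak derivatives\<close>

lemma integrable_signed_measure:
  fixes g :: "real ^ 'n \<Rightarrow> real"
  assumes g: "integrable lborel g"
  shows "(\<lambda>A. LINT x:A|lborel. g x) \<in> signed_measures"
  unfolding signed_measures_def
proof (intro CollectI conjI allI impI)
  show "(LINT x:{}|lborel. g x) = 0" by (simp add: set_lebesgue_integral_def)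
  fix A :: "nat \<Rightarrow> (real ^ 'n) set"
  assume A: "range A \<subseteq> sets borel" "disjoint_family A"
  then have [measurable]: "A n \<in> sets borel" for n by auto
  have [measurable]: "g \<in> borel_measurable borel" using g by auto
  have int: "integrable lborel (\<lambda>x. indicator B x * g x)" if "B \<in> sets borel" for B
    using integrable_mult_indicator[of B lborel g] that g by simp
  have part: "(\<Sum>i<n. LINT x:A i|lborel. g x) = (\<integral>x. indicator (\<Union>i<n. A i) x * g x \<partial>lborel)" for n
  proof -
    have "(\<Sum>i<n. LINT x:A i|lborel. g x) = (\<integral>x. (\<Sum>i<n. indicator (A i) x * g x) \<partial>lborel)"
      unfolding set_lebesgue_integral_def
      by (subst Bochner_Integration.integral_sum) (auto intro!: int)
    also have "\<dots> = (\<integral>x. indicator (\<Union>i<n. A i) x * g x \<partial>lborel)"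
    proof (intro Bochner_Integration.integral_cong refl)
      fix x
      have "disjoint_family_on A {..<n}" by (rule disjoint_family_on_mono[OF _ A(2)]) simp
      then have "indicator (\<Union>i<n. A i) x = (\<Sum>i<n. indicator (A i) x :: real)"
        by (intro indicator_UN_disjoint) simp
      then show "(\<Sum>i<n. indicator (A i) x * g x) = indicator (\<Union>i<n. A i) x * g x"
        by (simp only: sum_distrib_right)
    qed
    finally show ?thesis .
  qed
  have "(\<lambda>n. \<integral>x. indicator (\<Union>i<n. A i) x * g x \<partial>lborel) \<longlonglongrightarrow> (\<integral>x. indicator (\<Union>i. A i) x * g x \<partial>lborel)"
  proof (rule integral_dominated_convergence[where w = "\<lambda>x. \<bar>g x\<bar>"])
    show "AE x in lborel. (\<lambda>n. indicator (\<Union>i<n. A i) x * g x) \<longlonglongrightarrow> indicator (\<Union>i. A i) x * g x"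
      by (intro AE_I2 tendsto_mult tendsto_const LIMSEQ_indicator_UN)
  qed (use g in \<open>auto simp: indicator_def\<close>)
  then show "(\<lambda>n. LINT x:A n|lborel. g x) sums (LINT x:(\<Union>n. A n)|lborel. g x)"
    unfolding sums_def part by (simp add: set_lebesgue_integral_def)
qed

text \<open>Test functions that converge to the indicator function of an open box.\<close>
definition box_bump :: "real ^ 'n::finite \<Rightarrow> real ^ 'n \<Rightarrow> nat \<Rightarrow> real ^ 'n \<Rightarrow> real" where
  "box_bump a b j = tensor (\<lambda>i. bump j (a $ i) (b $ i))"

lemma compact_smooth_box_bump: "compact_smooth (box_bump a b j)"
  using compact_smooth_tensor_diff[of "\<lambda>i. bump j (a $ i) (b $ i)" 0]
  by (simp add: box_bump_def test_function_bump)

lemma box_bump_le: "\<bar>box_bump a b j x\<bar> \<le> indicator (box a b) x"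
proof (cases "x \<in> box a b")
  case True
  have "\<bar>box_bump a b j x\<bar> \<le> 1"
    unfolding box_bump_def tensor_def abs_prod by (intro prod_le_1) (simp add: bump_range)
  then show ?thesis using True by simp
next
  case False
  then obtain i where "x $ i \<le> a $ i \<or> b $ i \<le> x $ i" by (auto simp: mem_box_cart not_less)
  then have "box_bump a b j x = 0"
    unfolding box_bump_def tensor_def by (intro prod_zero) (auto intro!: bexI[of _ i] bump_eq_0)
  then show ?thesis by simp
qed

lemma box_bump_tendsto: "(\<lambda>j. box_bump a b j x) \<longlonglongrightarrow> indicator (box a b) x"
proof -
  have "(\<lambda>j. box_bump a b j x) \<longlonglongrightarrow> (\<Prod>i\<in>UNIV. indicator {a $ i<..<b $ i} (x $ i))"
    unfolding box_bump_def tensor_def by (intro tendsto_prod bump_tendsto)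
  also have "(\<Prod>i\<in>UNIV. indicator {a $ i<..<b $ i} (x $ i)) = (indicator (box a b) x :: real)"
    by (auto simp: indicator_def mem_box_cart prod.neutral intro!: prod_zero)
  finally show ?thesis .
qed

lemma locally_integrable_box:
  fixes G :: "real ^ 'n::finite \<Rightarrow> real"
  assumes G: "locally_integrable G"
  shows "integrable lborel (\<lambda>x. indicator (box a b) x * G x)"
proof -
  note [measurable] = locally_integrable_measurable[OF G]
  have "integrable lborel (\<lambda>x. indicator (cbox a b) x *\<^sub>R G x)"
    using G unfolding locally_integrable_def set_integrable_def by simp
  then show ?thesis
    by (rule Bochner_Integration.integrable_bound)
       (use box_subset_cbox[of a b] in \<open>auto simp: indicator_def\<close>)
qed

lemma signed_integral_box:
  fixes G :: "real ^ 'n::finite \<Rightarrow> real"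
  assumes \<mu>: "\<mu> \<in> signed_measures" and G: "locally_integrable G"
    and eq: "\<And>\<psi>. compact_smooth \<psi> \<Longrightarrow> (\<integral>x. G x * \<psi> x \<partial>lborel) = signed_integral \<mu> \<psi>"
  shows "\<mu> (box a b) = (\<integral>x. indicator (box a b) x * G x \<partial>lborel)"
proof -
  note [measurable] = locally_integrable_measurable[OF G]
    compact_smooth_measurable[OF compact_smooth_box_bump]
  have le1: "\<bar>box_bump a b j x\<bar> \<le> 1" for j x
    by (rule order_trans[OF box_bump_le]) (simp add: indicator_def)
  have *: "(\<lambda>j. \<integral>x. box_bump a b j x \<partial>pos_part \<mu>) \<longlonglongrightarrow> (\<integral>x. indicator (box a b) x \<partial>pos_part \<mu>)"
    if \<mu>: "\<mu> \<in> signed_measures" for \<mu> :: "(real ^ 'n) set \<Rightarrow> real"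
  proof (rule integral_dominated_convergence[where w = "\<lambda>_. 1"])
    interpret finite_measure "pos_part \<mu>" by (rule finite_measure_pos_part[OF \<mu>])
    show "integrable (pos_part \<mu>) (\<lambda>_. 1 :: real)" by simp
    show "AE x in pos_part \<mu>. (\<lambda>j. box_bump a b j x) \<longlonglongrightarrow> indicator (box a b) x"
      by (intro AE_I2 box_bump_tendsto)
  qed (use \<mu> le1 in auto)
  have "(\<lambda>j. signed_integral \<mu> (box_bump a b j)) \<longlonglongrightarrow> signed_integral \<mu> (indicator (box a b))"
    unfolding signed_integral_def by (intro tendsto_diff * \<mu> signed_measures_uminus)
  then have 1: "(\<lambda>j. \<integral>x. G x * box_bump a b j x \<partial>lborel) \<longlonglongrightarrow> \<mu> (box a b)"
    by (simp add: eq[OF compact_smooth_box_bump] signed_integral_indicator[OF \<mu>])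
  have "(\<lambda>j. \<integral>x. G x * box_bump a b j x \<partial>lborel) \<longlonglongrightarrow> (\<integral>x. G x * indicator (box a b) x \<partial>lborel)"
  proof (rule integral_dominated_convergence[where w = "\<lambda>x. \<bar>indicator (box a b) x * G x\<bar>"])
    show "integrable lborel (\<lambda>x. \<bar>indicator (box a b) x * G x\<bar>)"
      by (intro integrable_abs locally_integrable_box G)
    show "AE x in lborel. (\<lambda>j. G x * box_bump a b j x) \<longlonglongrightarrow> G x * indicator (box a b) x"
      by (intro AE_I2 tendsto_mult tendsto_const box_bump_tendsto)
    show "AE x in lborel. norm (G x * box_bump a b j x) \<le> \<bar>indicator (box a b) x * G x\<bar>" for j
      using box_bump_le[of a b j] by (intro AE_I2) (simp add: abs_mult mult.commute mult_left_mono)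
  qed measurable
  from LIMSEQ_unique[OF 1 this] show ?thesis by (simp add: mult.commute)
qed

lemma signed_measures_restrict_diff:
  fixes \<mu> \<nu> :: "(real ^ 'n) set \<Rightarrow> real"
  assumes \<mu>: "\<mu> \<in> signed_measures" and \<nu>: "\<nu> \<in> signed_measures" and B: "B \<in> sets borel"
  shows "(\<lambda>A. \<mu> (A \<inter> B) - \<nu> A) \<in> signed_measures"
  unfolding signed_measures_def
proof (intro CollectI conjI allI impI)
  show "\<mu> ({} \<inter> B) - \<nu> {} = 0" using \<mu> \<nu> by (simp add: signed_measures_empty)
  fix A :: "nat \<Rightarrow> (real ^ 'n) set" assume A: "range A \<subseteq> sets borel" "disjoint_family A"
  have "(\<lambda>n. \<mu> (A n \<inter> B)) sums \<mu> (\<Union>n. A n \<inter> B)"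
    by (rule signed_measures_sums[OF \<mu>]) (use A B in \<open>auto simp: disjoint_family_on_def\<close>)
  moreover have "(\<lambda>n. \<nu> (A n)) sums \<nu> (\<Union>n. A n)"
    by (rule signed_measures_sums[OF \<nu>]) (use A in auto)
  ultimately show "(\<lambda>n. \<mu> (A n \<inter> B) - \<nu> (A n)) sums (\<mu> ((\<Union>n. A n) \<inter> B) - \<nu> (\<Union>n. A n))"
    by (auto intro: sums_diff)
qed

text \<open>If a locally integrable function \<open>G\<close> and a finite signed measure agree on test functions, then \<open>G\<close> is
  integrable and is the density of the measure. On bounded sets the two agree because they agree on
  boxes; the measure is bounded, so the integrals of \<open>\<bar>G\<bar>\<close> over bounded sets are bounded as well.\<close>
lemma signed_measure_density_of_distribution:
  fixes G :: "real ^ 'n::finite \<Rightarrow> real"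
  assumes \<mu>: "\<mu> \<in> signed_measures" and G: "locally_integrable G"
    and eq: "\<And>\<psi>. compact_smooth \<psi> \<Longrightarrow> (\<integral>x. G x * \<psi> x \<partial>lborel) = signed_integral \<mu> \<psi>"
  shows "integrable lborel G" and "A \<in> sets borel \<Longrightarrow> \<mu> A = (LINT x:A|lborel. G x)"
proof -
  note Gm [measurable] = locally_integrable_measurable[OF G]
  define B where "B n = box (- (real n *\<^sub>R One)) (real n *\<^sub>R One :: real ^ 'n)" for n
  have Bm [measurable]: "B n \<in> sets borel" for n by (simp add: B_def)
  have GB: "integrable lborel (\<lambda>x. indicator (B n) x * G x)" for n
    unfolding B_def by (rule locally_integrable_box[OF G])
  have loc: "\<mu> (A \<inter> B n) = (\<integral>x. indicator (A \<inter> B n) x * G x \<partial>lborel)" if A: "A \<in> sets borel" for A n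
  proof -
    have "\<mu> (A \<inter> B n) - (LINT x:A|lborel. indicator (B n) x * G x) = 0"
    proof (rule signed_measures_eq_0[OF _ _ A])
      show "(\<lambda>A. \<mu> (A \<inter> B n) - (LINT x:A|lborel. indicator (B n) x * G x)) \<in> signed_measures"
        by (rule signed_measures_restrict_diff[OF \<mu> integrable_signed_measure[OF GB] Bm])
      fix a b :: "real ^ 'n"
      obtain c d where cd: "box a b \<inter> B n = box c d" unfolding B_def box_Int_box by blast
      have "(LINT x:box a b|lborel. indicator (B n) x * G x) = (\<integral>x. indicator (box a b \<inter> B n) x * G x \<partial>lborel)"
        unfolding set_lebesgue_integral_def
        by (intro Bochner_Integration.integral_cong) (auto simp: indicator_def)
      also have "\<dots> = \<mu> (box a b \<inter> B n)" unfolding cd by (rule signed_integral_box[OF \<mu> G eq, symmetric])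
      finally show "\<mu> (box a b \<inter> B n) - (LINT x:box a b|lborel. indicator (B n) x * G x) = 0" by simp
    qed
    moreover have "(LINT x:A|lborel. indicator (B n) x * G x) = (\<integral>x. indicator (A \<inter> B n) x * G x \<partial>lborel)"
      unfolding set_lebesgue_integral_def
      by (intro Bochner_Integration.integral_cong) (auto simp: indicator_def)
    ultimately show ?thesis by simp
  qed
  obtain K where K: "\<And>A. A \<in> sets borel \<Longrightarrow> \<bar>\<mu> A\<bar> \<le> K" using signed_measures_bounded[OF \<mu>] by blast
  have incB: "incseq B"
  proof (rule monoI)
    fix i j :: nat assume "i \<le> j"
    then show "B i \<subseteq> B j" unfolding B_def by (intro subset_box_imp) (auto simp: mem_box inner_simps)
  qed
  have UB: "(\<Union>n. B n) = UNIV" unfolding B_def by (rule UN_box_eq_UNIV)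
  have indB: "(\<lambda>n. indicator (B n) x * c) \<longlonglongrightarrow> c" for x :: "real ^ 'n" and c :: real
  proof -
    have "(\<lambda>n. indicator (B n) x :: real) \<longlonglongrightarrow> indicator (\<Union>n. B n) x"
      by (rule LIMSEQ_indicator_incseq[OF incB])
    then have "(\<lambda>n. indicator (B n) x * c) \<longlonglongrightarrow> 1 * c"
      unfolding UB by (intro tendsto_mult tendsto_const) simp
    then show ?thesis by simp
  qed
  have absint: "(\<integral>x. indicator (B n) x * \<bar>G x\<bar> \<partial>lborel) \<le> 2 * K" for n
  proof -
    let ?P = "{x. 0 \<le> G x}" and ?N = "{x. G x < 0}"
    have PN [measurable]: "?P \<in> sets borel" "?N \<in> sets borel" by measurable
    have i: "integrable lborel (\<lambda>x. indicator (A \<inter> B n) x * G x)" if [measurable]: "A \<in> sets borel" for A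
      using integrable_mult_indicator[of A lborel, OF _ GB[of n]]
      by (simp add: indicator_inter_arith mult.assoc)
    have "(\<integral>x. indicator (B n) x * \<bar>G x\<bar> \<partial>lborel) =
      (\<integral>x. indicator (?P \<inter> B n) x * G x - indicator (?N \<inter> B n) x * G x \<partial>lborel)"
      by (intro Bochner_Integration.integral_cong) (auto simp: indicator_def)
    also have "\<dots> = \<mu> (?P \<inter> B n) - \<mu> (?N \<inter> B n)"
      using i[OF PN(1)] i[OF PN(2)] by (simp add: loc[OF PN(1)] loc[OF PN(2)])
    also have "\<dots> \<le> 2 * K" using K[of "?P \<inter> B n"] K[of "?N \<inter> B n"] by (auto simp: abs_le_iff)
    finally show ?thesis .
  qed
  show Gi: "integrable lborel G"
  proof (rule integrableI_bounded)
    have "(\<integral>\<^sup>+x. ennreal \<bar>G x\<bar> \<partial>lborel) = (\<integral>\<^sup>+x. liminf (\<lambda>n. ennreal (indicator (B n) x * \<bar>G x\<bar>)) \<partial>lborel)"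
    proof (intro nn_integral_cong)
      fix x
      have "(\<lambda>n. ennreal (indicator (B n) x * \<bar>G x\<bar>)) \<longlonglongrightarrow> ennreal \<bar>G x\<bar>"
        by (intro tendsto_ennrealI indB)
      then show "ennreal \<bar>G x\<bar> = liminf (\<lambda>n. ennreal (indicator (B n) x * \<bar>G x\<bar>))"
        using lim_imp_Liminf[OF sequentially_bot] by metis
    qed
    also have "\<dots> \<le> liminf (\<lambda>n. \<integral>\<^sup>+x. ennreal (indicator (B n) x * \<bar>G x\<bar>) \<partial>lborel)"
      by (rule nn_integral_liminf) measurable
    also have "\<dots> \<le> ennreal (2 * K)"
    proof (rule Liminf_le)
      have "(\<integral>\<^sup>+x. ennreal (indicator (B n) x * \<bar>G x\<bar>) \<partial>lborel) \<le> ennreal (2 * K)" for n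
      proof -
        have "integrable lborel (\<lambda>x. indicator (B n) x * \<bar>G x\<bar>)"
          using integrable_abs[OF GB[of n]] by (simp add: abs_mult)
        then show ?thesis using absint[of n]
          by (subst nn_integral_eq_integral) (auto intro: ennreal_leI)
      qed
      then show "\<forall>\<^sub>F n in sequentially. (\<integral>\<^sup>+x. ennreal (indicator (B n) x * \<bar>G x\<bar>) \<partial>lborel) \<le> ennreal (2 * K)"
        by simp
    qed simp
    also have "\<dots> < \<infinity>" by simp
    finally show "(\<integral>\<^sup>+x. ennreal (norm (G x)) \<partial>lborel) < \<infinity>" by simp
  qed measurable
  show "\<mu> A = (LINT x:A|lborel. G x)" if A: "A \<in> sets borel"
  proof -
    note [measurable] = A
    have "(\<lambda>n. \<integral>x. indicator (A \<inter> B n) x * G x \<partial>lborel) \<longlonglongrightarrow> (\<integral>x. indicator A x * G x \<partial>lborel)"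
    proof (rule integral_dominated_convergence[where w = "\<lambda>x. \<bar>G x\<bar>"])
      show "AE x in lborel. (\<lambda>n. indicator (A \<inter> B n) x * G x) \<longlonglongrightarrow> indicator A x * G x"
        using indB by (intro AE_I2) (auto simp: indicator_inter_arith mult.assoc intro!: tendsto_mult)
    qed (use Gi in \<open>auto simp: indicator_def\<close>)
    then have 1: "(\<lambda>n. \<mu> (A \<inter> B n)) \<longlonglongrightarrow> (LINT x:A|lborel. G x)"
      by (simp add: loc[OF A] set_lebesgue_integral_def)
    have *: "(\<lambda>n. measure (pos_part \<mu>) (A \<inter> B n)) \<longlonglongrightarrow> measure (pos_part \<mu>) A"
      if \<mu>: "\<mu> \<in> signed_measures" for \<mu> :: "(real ^ 'n) set \<Rightarrow> real"
    proof -
      interpret finite_measure "pos_part \<mu>" by (rule finite_measure_pos_part[OF \<mu>])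
      have "(\<lambda>n. measure (pos_part \<mu>) (A \<inter> B n)) \<longlonglongrightarrow> measure (pos_part \<mu>) (\<Union>n. A \<inter> B n)"
        by (rule finite_Lim_measure_incseq)
           (use \<mu> incB in \<open>auto simp: incseq_def\<close>)
      moreover have "(\<Union>n. A \<inter> B n) = A" using UB by blast
      ultimately show ?thesis by simp
    qed
    have "(\<lambda>n. \<mu> (A \<inter> B n)) \<longlonglongrightarrow> \<mu> A"
      unfolding jordan_decomposition[OF \<mu> A]
      by (subst jordan_decomposition[OF \<mu>]) (auto intro!: tendsto_diff * \<mu> signed_measures_uminus)
    from LIMSEQ_unique[OF this 1] show ?thesis .
  qed
qed

lemma locally_integrable_diff:
  assumes "locally_integrable f" "locally_integrable g"
  shows "locally_integrable (\<lambda>x. f x - g x)"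
  using assms unfolding locally_integrable_def by (auto intro: set_integral_diff)

lemma locally_integrable_cmult:
  "locally_integrable f \<Longrightarrow> locally_integrable (\<lambda>x. c * f x)"
  unfolding locally_integrable_def by (auto intro: set_integrable_mult_right)

lemma fundamental_lemma_calculus_of_variations:
  fixes u v :: "real ^ 'n::finite \<Rightarrow> real"
  assumes u: "locally_integrable u" and v: "locally_integrable v"
    and eq: "\<And>\<psi>. compact_smooth \<psi> \<Longrightarrow> (\<integral>x. u x * \<psi> x \<partial>lborel) = (\<integral>x. v x * \<psi> x \<partial>lborel)"
  shows "AE x in lborel. u x = v x"
proof -
  let ?G = "\<lambda>x. u x - v x"
  have z: "(\<lambda>_. 0) \<in> (signed_measures :: ((real ^ 'n) set \<Rightarrow> real) set)"
    by (simp add: signed_measures_def)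
  have G0: "(\<integral>x. ?G x * \<psi> x \<partial>lborel) = signed_integral (\<lambda>_. 0) \<psi>" if "compact_smooth \<psi>" for \<psi>
  proof -
    have "(\<integral>x. ?G x * \<psi> x \<partial>lborel) = (\<integral>x. u x * \<psi> x \<partial>lborel) - (\<integral>x. v x * \<psi> x \<partial>lborel)"
      using locally_integrable_mult[OF u that] locally_integrable_mult[OF v that]
      by (simp add: left_diff_distrib)
    then show ?thesis using eq[OF that] by (simp add: signed_integral_def)
  qed
  have D: "integrable lborel ?G" "\<And>A. A \<in> sets borel \<Longrightarrow> 0 = (LINT x:A|lborel. ?G x)"
    by (rule signed_measure_density_of_distribution[OF z locally_integrable_diff[OF u v]]; use G0 in blast)+
  have "AE x in lborel. ?G x = 0"
    by (rule density_unique_real[OF D(1)]) (use D(2) in \<open>auto simp: set_lebesgue_integral_def\<close>)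
  then show ?thesis by eventually_elim simp
qed

lemma multi_deriv_zero: "multi_deriv (\<lambda>_::'a::finite. 0) \<psi> = \<psi>"
proof -
  have "mi_list (\<lambda>_. 0) = ([] :: 'a list)"
    using length_mi_list[of "\<lambda>_::'a. 0"] by (simp add: mi_order_def)
  then show ?thesis by (simp add: multi_deriv_mi_list)
qed

lemma integrable_locally_integrable: "integrable lborel f \<Longrightarrow> locally_integrable f"
  unfolding locally_integrable_def set_integrable_def
  by (auto intro!: integrable_mult_indicator borel_closed compact_imp_closed simp del: real_scaleR_def)

lemma interp_space_finite_pi:
  assumes "\<mu> \<in> interp_space q k m e"
  obtains \<mu>s where "\<And>n. \<mu>s n \<in> ac_measures" "interp_pi q k m e \<mu> \<mu>s < top"
  using assms unfolding interp_space_def interp_rho_def by (auto simp: INF_less_iff)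

text \<open>Passing to the infimum over all approximating sequences; sequences for which \<open>interp_pi\<close> is
  infinite may be ignored.\<close>
lemma le_mult_interp_rho:
  assumes "\<And>\<mu>s. (\<And>n. \<mu>s n \<in> ac_measures) \<Longrightarrow> interp_pi q k m e \<mu> \<mu>s < top \<Longrightarrow>
      X \<le> ennreal C * interp_pi q k m e \<mu> \<mu>s" and C: "0 < C"
  shows "X \<le> ennreal C * interp_rho q k m e \<mu>"
proof (rule le_mult_if_less[OF _ C])
  fix \<delta> assume "interp_rho q k m e \<mu> < ennreal \<delta>"
  then obtain \<mu>s where \<mu>s: "\<And>n. \<mu>s n \<in> ac_measures" "interp_pi q k m e \<mu> \<mu>s < ennreal \<delta>"
    unfolding interp_rho_def by (auto simp: INF_less_iff)
  have "X \<le> ennreal C * interp_pi q k m e \<mu> \<mu>s"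
    by (rule assms(1)[OF \<mu>s(1)]) (use \<mu>s(2) in \<open>auto intro: less_trans\<close>)
  also have "\<dots> \<le> ennreal C * ennreal \<delta>" using \<mu>s(2) by (intro mult_left_mono) auto
  also have "\<dots> = ennreal (C * \<delta>)" using C by (simp add: ennreal_mult')
  finally show "X \<le> ennreal (C * \<delta>)" .
qed

lemma
  assumes e: "e \<in> young_class" and m: "1 \<le> m" and \<mu>: "\<mu> \<in> (interp_space q k m e :: ((real ^ 'n::finite) set \<Rightarrow> real) set)"
  shows interp_space_ac: "\<mu> \<in> ac_measures"
    and interp_space_signed: "\<mu> \<in> signed_measures"
proof -
  show sm: "\<mu> \<in> signed_measures" using \<mu> by (simp add: interp_space_def)
  obtain \<mu>s where \<mu>s: "\<And>n. \<mu>s n \<in> ac_measures" "interp_pi q k m e \<mu> \<mu>s < top"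
    using interp_space_finite_pi[OF \<mu>] by blast
  have z: "(\<lambda>_. 0) \<in> (mi_upto q :: ('n \<Rightarrow> nat) set)" by (simp add: mi_upto_def mi_order_def)
  have "\<exists>G. locally_integrable G \<and>
    (\<forall>\<psi>. compact_smooth \<psi> \<longrightarrow> (\<integral>x. G x * \<psi> x \<partial>lborel) = signed_integral \<mu> (multi_deriv (\<lambda>_. 0) \<psi>))"
  proof (rule limit_derivative[OF e m z, of k], goal_cases)
    case (1 C)
    show ?case using 1(2)[OF sm \<mu>s] by blast
  qed
  then obtain G where G: "locally_integrable G"
    "\<And>\<psi>. compact_smooth \<psi> \<Longrightarrow> (\<integral>x. G x * \<psi> x \<partial>lborel) = signed_integral \<mu> \<psi>"
    unfolding multi_deriv_zero by blast
  have D: "\<mu> A = (LINT x:A|lborel. G x)" if "A \<in> sets borel" for A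
    by (rule signed_measure_density_of_distribution(2)[OF sm G(1) _ that]) (rule G(2))
  show "\<mu> \<in> ac_measures"
    unfolding ac_measures_def
  proof (intro CollectI conjI sm ballI impI)
    fix A :: "(real ^ 'n) set" assume A: "A \<in> sets borel" "emeasure lborel A = 0"
    have "AE x in lborel. indicator A x *\<^sub>R G x = 0"
      by (rule AE_I[of _ _ A]) (use A in \<open>auto simp: indicator_def\<close>)
    then have "(LINT x:A|lborel. G x) = 0"
      unfolding set_lebesgue_integral_def by (rule integral_eq_zero_AE)
    then show "\<mu> A = 0" using D[OF A(1)] by simp
  qed
qed

lemma signed_integral_signed_density:
  fixes \<mu> :: "(real ^ 'n::finite) set \<Rightarrow> real"
  assumes \<mu>: "\<mu> \<in> ac_measures" and \<psi>: "compact_smooth \<psi>"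
  shows "signed_integral \<mu> \<psi> = (\<integral>x. signed_density \<mu> x * \<psi> x \<partial>lborel)"
proof -
  obtain B where B: "\<And>x. \<bar>\<psi> x\<bar> \<le> B" using compact_smooth_bounds[OF \<psi>] by metis
  show ?thesis
    using signed_integral_ac[OF ac_measures_signed[OF \<mu>] signed_density[OF \<mu>] compact_smooth_measurable[OF \<psi>] B]
    by (simp add: mult.commute)
qed

text \<open>All weak derivatives \<open>g\<close> of the density are covered, because \<open>weak_deriv\<close> picks an unspecified one.\<close>
lemma density_weak_deriv_bound:
  fixes \<beta> :: "'n::finite \<Rightarrow> nat"
  assumes e: "e \<in> young_class" and m: "1 \<le> m" and \<beta>: "\<beta> \<in> mi_upto q"
  obtains C where "0 < C"
    "\<And>\<mu>. \<mu> \<in> interp_space q k m e \<Longrightarrow> \<exists>g. has_weak_deriv \<beta> (signed_density \<mu>) g"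
    "\<And>\<mu> g. \<mu> \<in> interp_space q k m e \<Longrightarrow> has_weak_deriv \<beta> (signed_density \<mu>) g \<Longrightarrow>
      orlicz_norm e g \<le> ennreal C * interp_rho q k m e \<mu>"
proof -
  obtain C where C: "0 < C"
    and lim: "\<And>\<mu> \<mu>s. \<mu> \<in> signed_measures \<Longrightarrow> (\<And>n. \<mu>s n \<in> ac_measures) \<Longrightarrow> interp_pi q k m e \<mu> \<mu>s < top \<Longrightarrow>
      \<exists>G. locally_integrable G \<and> orlicz_norm e G \<le> ennreal C * interp_pi q k m e \<mu> \<mu>s \<and>
        (\<forall>\<psi>. compact_smooth \<psi> \<longrightarrow> (\<integral>x. G x * \<psi> x \<partial>lborel) = signed_integral \<mu> (multi_deriv \<beta> \<psi>))"
    by (rule limit_derivative[OF e m \<beta>, of k]) (rule that; blast)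
  have key: "\<exists>g. has_weak_deriv \<beta> (signed_density \<mu>) g \<and> orlicz_norm e g \<le> ennreal C * interp_pi q k m e \<mu> \<mu>s"
    if \<mu>: "\<mu> \<in> interp_space q k m e" and \<mu>s: "\<And>n. \<mu>s n \<in> ac_measures" "interp_pi q k m e \<mu> \<mu>s < top"
    for \<mu> :: "(real ^ 'n) set \<Rightarrow> real" and \<mu>s
  proof -
    note ac = interp_space_ac[OF e m \<mu>] and sm = interp_space_signed[OF e m \<mu>]
    obtain G where G: "locally_integrable G" "orlicz_norm e G \<le> ennreal C * interp_pi q k m e \<mu> \<mu>s"
      "\<And>\<psi>. compact_smooth \<psi> \<Longrightarrow> (\<integral>x. G x * \<psi> x \<partial>lborel) = signed_integral \<mu> (multi_deriv \<beta> \<psi>)"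
      using lim[OF sm \<mu>s] by blast
    define s where "s = (- 1 :: real) ^ mi_order \<beta>"
    have s: "s * s = 1" "\<bar>s\<bar> = 1" by (simp_all add: s_def power_mult_distrib[symmetric] power_abs)
    have "has_weak_deriv \<beta> (signed_density \<mu>) (\<lambda>x. s * G x)"
      unfolding has_weak_deriv_def
    proof (intro conjI allI impI)
      show "locally_integrable (signed_density \<mu>)"
        by (rule integrable_locally_integrable[OF signed_density(1)[OF ac]])
      show "locally_integrable (\<lambda>x. s * G x)" by (rule locally_integrable_cmult[OF G(1)])
      fix \<psi> :: "real ^ 'n \<Rightarrow> real" assume "smooth \<psi>" "compact (closure {x. \<psi> x \<noteq> 0})"
      then have \<psi>: "compact_smooth \<psi>" by (simp add: compact_smooth_def)
      have "(\<integral>x. signed_density \<mu> x * multi_deriv \<beta> \<psi> x \<partial>lborel) = (\<integral>x. G x * \<psi> x \<partial>lborel)"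
        using signed_integral_signed_density[OF ac compact_smooth_multi_deriv[OF \<psi>]] G(3)[OF \<psi>] by simp
      also have "\<dots> = s * (\<integral>x. s * G x * \<psi> x \<partial>lborel)"
        by (subst integral_mult_right_zero[symmetric]) (simp add: mult.assoc[symmetric] s)
      finally show "(\<integral>x. signed_density \<mu> x * multi_deriv \<beta> \<psi> x \<partial>lborel) =
          (- 1) ^ mi_order \<beta> * (\<integral>x. s * G x * \<psi> x \<partial>lborel)" by (simp add: s_def)
    qed
    moreover have "orlicz_norm e (\<lambda>x. s * G x) = orlicz_norm e G"
      by (intro antisym orlicz_norm_mono_AE[OF e]) (auto simp: abs_mult s)
    ultimately show ?thesis using G(2) by (intro exI[of _ "\<lambda>x. s * G x"]) simp
  qed
  have unique: "AE x in lborel. g x = g' x"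
    if "has_weak_deriv \<beta> p g" "has_weak_deriv \<beta> p g'" for p g g' :: "real ^ 'n \<Rightarrow> real"
  proof (rule fundamental_lemma_calculus_of_variations)
    show "locally_integrable g" "locally_integrable g'" using that by (auto simp: has_weak_deriv_def)
    fix \<psi> :: "real ^ 'n \<Rightarrow> real" assume "compact_smooth \<psi>"
    then have "(- 1) ^ mi_order \<beta> * (\<integral>x. g x * \<psi> x \<partial>lborel) = (- 1) ^ mi_order \<beta> * (\<integral>x. g' x * \<psi> x \<partial>lborel)"
      using that by (auto simp: has_weak_deriv_def compact_smooth_def)
    then show "(\<integral>x. g x * \<psi> x \<partial>lborel) = (\<integral>x. g' x * \<psi> x \<partial>lborel)" by simp
  qed
  show ?thesis
  proof (rule that[OF C])
    fix \<mu> :: "(real ^ 'n) set \<Rightarrow> real" assume \<mu>: "\<mu> \<in> interp_space q k m e"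
    then show "\<exists>g. has_weak_deriv \<beta> (signed_density \<mu>) g"
      using key interp_space_finite_pi by metis
    fix g assume g: "has_weak_deriv \<beta> (signed_density \<mu>) g"
    show "orlicz_norm e g \<le> ennreal C * interp_rho q k m e \<mu>"
    proof (rule le_mult_interp_rho[OF _ C])
      fix \<mu>s :: "nat \<Rightarrow> (real ^ 'n) set \<Rightarrow> real"
      assume "\<And>n. \<mu>s n \<in> ac_measures" "interp_pi q k m e \<mu> \<mu>s < top"
      from key[OF \<mu> this] obtain g' where g': "has_weak_deriv \<beta> (signed_density \<mu>) g'"
        "orlicz_norm e g' \<le> ennreal C * interp_pi q k m e \<mu> \<mu>s" by blast
      then show "orlicz_norm e g \<le> ennreal C * interp_pi q k m e \<mu> \<mu>s"
        using orlicz_norm_cong_AE[OF e unique[OF g g'(1)]] by simp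
    qed
  qed
qed

lemma has_weak_deriv_zero: "locally_integrable p \<Longrightarrow> has_weak_deriv (\<lambda>_. 0) p p"
  by (simp add: has_weak_deriv_def multi_deriv_zero mi_order_def)

theorem theorem2p6:
  fixes q k m :: nat and e :: "real \<Rightarrow> real"
  assumes "m \<ge> 1" and "e \<in> young_class"
  shows "(q = 0 \<longrightarrow>
      (\<forall>\<mu> \<in> (interp_space q k m e :: ((real ^ 'n) set \<Rightarrow> real) set).
         \<mu> \<in> ac_measures \<and> signed_density \<mu> \<in> orlicz_space e) \<and>
      (\<exists>C::real. \<forall>\<mu> \<in> (interp_space q k m e :: ((real ^ 'n) set \<Rightarrow> real) set).
         orlicz_norm e (signed_density \<mu>) \<le> ennreal C * interp_rho q k m e \<mu>)) \<and>
    (q \<ge> 1 \<longrightarrow>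
      (\<forall>\<mu> \<in> (interp_space q k m e :: ((real ^ 'n) set \<Rightarrow> real) set).
         \<mu> \<in> ac_measures \<and> signed_density \<mu> \<in> sobolev_space q e) \<and>
      (\<exists>C::real. \<forall>\<mu> \<in> (interp_space q k m e :: ((real ^ 'n) set \<Rightarrow> real) set).
         sobolev_norm q e (signed_density \<mu>) \<le> ennreal C * interp_rho q k m e \<mu>))"
proof -
  note m = assms(1) and e = assms(2)
  let ?S = "interp_space q k m e :: ((real ^ 'n) set \<Rightarrow> real) set"
  let ?\<rho> = "interp_rho q k m e :: ((real ^ 'n) set \<Rightarrow> real) \<Rightarrow> ennreal"
  have ac: "\<mu> \<in> ac_measures" if "\<mu> \<in> ?S" for \<mu> by (rule interp_space_ac[OF e m that])
  have dm: "signed_density \<mu> \<in> borel_measurable borel" if "\<mu> \<in> ?S" for \<mu>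
    using signed_density(1)[OF ac[OF that]] by auto
  have fin: "ennreal C * ?\<rho> \<mu> < \<infinity>" if "\<mu> \<in> ?S" for C \<mu>
    using that by (simp add: interp_space_def ennreal_mult_less_top)
  have z: "(\<lambda>_. 0) \<in> (mi_upto q :: ('n \<Rightarrow> nat) set)" by (simp add: mi_upto_def mi_order_def)
  obtain C0 where C0: "\<And>\<mu> g. \<mu> \<in> ?S \<Longrightarrow> has_weak_deriv (\<lambda>_. 0) (signed_density \<mu>) g \<Longrightarrow>
      orlicz_norm e g \<le> ennreal C0 * ?\<rho> \<mu>"
    by (rule density_weak_deriv_bound[OF e m z, of k]) (rule that; blast)
  have orl: "orlicz_norm e (signed_density \<mu>) \<le> ennreal C0 * ?\<rho> \<mu>" if "\<mu> \<in> ?S" for \<mu>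
    by (intro C0 that has_weak_deriv_zero integrable_locally_integrable signed_density ac)
  have "\<exists>C>0. (\<forall>\<mu>\<in>?S. \<exists>g. has_weak_deriv \<beta> (signed_density \<mu>) g) \<and>
     (\<forall>\<mu>\<in>?S. \<forall>g. has_weak_deriv \<beta> (signed_density \<mu>) g \<longrightarrow> orlicz_norm e g \<le> ennreal C * ?\<rho> \<mu>)"
    if "\<beta> \<in> mi_upto q" for \<beta> :: "'n \<Rightarrow> nat"
    by (rule density_weak_deriv_bound[OF e m that, of k]) blast
  then obtain C where C: "\<And>\<beta> :: 'n \<Rightarrow> nat. \<beta> \<in> mi_upto q \<Longrightarrow> 0 < C \<beta>"
    "\<And>\<beta> \<mu>. \<beta> \<in> mi_upto q \<Longrightarrow> \<mu> \<in> ?S \<Longrightarrow> \<exists>g. has_weak_deriv \<beta> (signed_density \<mu>) g"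
    "\<And>\<beta> \<mu> g. \<beta> \<in> mi_upto q \<Longrightarrow> \<mu> \<in> ?S \<Longrightarrow> has_weak_deriv \<beta> (signed_density \<mu>) g \<Longrightarrow>
      orlicz_norm e g \<le> ennreal (C \<beta>) * ?\<rho> \<mu>"
    by metis
  define C1 where "C1 = (\<Sum>\<beta>\<in>(mi_upto q :: ('n \<Rightarrow> nat) set). C \<beta>)"
  have sob: "sobolev_norm q e (signed_density \<mu>) \<le> ennreal C1 * ?\<rho> \<mu>" if \<mu>: "\<mu> \<in> ?S" for \<mu>
  proof -
    have wd: "weakly_differentiable q (signed_density \<mu>)"
      unfolding weakly_differentiable_def using C(2)[OF _ \<mu>] by blast
    then have "sobolev_norm q e (signed_density \<mu>) = (\<Sum>\<beta>\<in>mi_upto q. orlicz_norm e (weak_deriv \<beta> (signed_density \<mu>)))"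
      by (simp add: sobolev_norm_def)
    also have "\<dots> \<le> (\<Sum>\<beta>\<in>mi_upto q. ennreal (C \<beta>) * ?\<rho> \<mu>)"
      by (intro sum_mono C(3) \<mu> has_weak_deriv_weak_deriv[OF wd])
    also have "\<dots> = ennreal C1 * ?\<rho> \<mu>"
      using C(1) unfolding C1_def sum_distrib_right[symmetric]
      by (subst sum_ennreal) (auto intro: less_imp_le)
    finally show ?thesis .
  qed
  have "signed_density \<mu> \<in> orlicz_space e" if "\<mu> \<in> ?S" for \<mu>
    unfolding orlicz_space_def using dm[OF that] le_less_trans[OF orl[OF that] fin[OF that]] by simp
  moreover have "signed_density \<mu> \<in> sobolev_space q e" if "\<mu> \<in> ?S" for \<mu>
    unfolding sobolev_space_def using dm[OF that] le_less_trans[OF sob[OF that] fin[OF that]] by simp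
  ultimately show ?thesis using ac orl sob by blast
qed

end
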